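(* Let $\{A_t\}_{t\in T}$ be a continuous field of unital $C^*$-algebras over a compact Hausdorff space $T$, arising from an injective unital $*$-homomorphism $j\colon C(T)\to\mathcal{Z}(A)$ into the center of a unital $C^*$-algebra $A$. Let $V\subseteq A$ be a complex subspace with $1_A\in V$ such that for all $t\in T$ the map $\mathrm{ev}_t\colon V\to A_t$ is injective and $V_t:=\mathrm{ev}_t(V)$ is invariant under the involution $*_t$ of $A_t$. For each $t\in T$ let $L_t\colon V_t\to[0,\infty)$ be a semi-norm with $L_t(1_{A_t})=0$ and $L_t(\xi^{*_t})=L_t(\xi)$ for all $\xi\in V_t$, and let $L_t^{\mathrm{sa}}$ denote its restriction to $V_t^{\mathrm{sa}}$. Suppose that $\{(V_t^{\mathrm{sa}},L_t^{\mathrm{sa}})\}_{t\in T}$ is a uniform family of order unit compact quantum metric spaces and that $\sup_{t\in T}r_t<\infty$, where $r_t\ge0$ denotes the radius of $(V_t^{\mathrm{sa}},L_t^{\mathrm{sa}})$. Let $t_0\in T$ be given and suppose that the unital $C^*$-algebra $A_{t_0}$ is separable. Then \[ \lim_{t\to t_0}\mathrm{dist}_q(V_t^{\mathrm{sa}},V_{t_0}^{\mathrm{sa}})=0. \]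
   Context: **Order unit compact quantum metric spaces.** Let $A$ be a unital $C^*$-algebra and $V\subseteq A$ a (not necessarily dense) complex subspace with $1\in V$, $V^*=V$. $V^{\mathrm{sa}}=\{\xi\in V\mid \xi=\xi^*\}$ is an order unit space with the order and unit of $A$; its state space $S(V^{\mathrm{sa}})$ is the set of positive $\mathbb{R}$-linear $\mu\colon V^{\mathrm{sa}}\to\mathbb{R}$ with $\mu(1)=1$, with the weak $*$-topology. For a semi-norm $L^{\mathrm{sa}}\colon V^{\mathrm{sa}}\to[0,\infty)$ with $L^{\mathrm{sa}}(1)=0$ put $\rho_{L^{\mathrm{sa}}}(\mu,\nu)=\sup\{|\mu(\xi)-\nu(\xi)| \mid \xi\in V^{\mathrm{sa}}, L^{\mathrm{sa}}(\xi)\le 1\}$. $(V^{\mathrm{sa}},L^{\mathrm{sa}})$ is an order unit compact quantum metric space if $\rho_{L^{\mathrm{sa}}}$ metrizes the weak $*$-topology on $S(V^{\mathrm{sa}})$. Its radius is $\frac12\sup\{\rho_{L^{\mathrm{sa}}}(\mu,\nu)\mid\mu,\nu\in S(V^{\mathrm{sa}})\}$. **Quantum Gromov-Hausdorff distance.** For order unit compact quantum metric spaces $(V_j^{\mathrm{sa}},L_j^{\mathrm{sa}})$, $j=1,2$, a semi-norm $L^{\mathrm{sa}}$ on $V_1^{\mathrm{sa}}\oplus V_2^{\mathrm{sa}}$ vanishing on the unit is admissible if $(V_1^{\mathrm{sa}}\oplus V_2^{\mathrm{sa}},L^{\mathrm{sa}})$ is an order unit compact quantum metric space and $L_j^{\mathrm{sa}}$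 is the quotient semi-norm of $L^{\mathrm{sa}}$ under the projection onto $V_j^{\mathrm{sa}}$, $j=1,2$. Then $\mathrm{dist}_q(V_1^{\mathrm{sa}},V_2^{\mathrm{sa}})$ is the infimum over admissible $L^{\mathrm{sa}}$ of the Hausdorff distance, with respect to $\rho_{L^{\mathrm{sa}}}$, between $S(V_1^{\mathrm{sa}})$ and $S(V_2^{\mathrm{sa}})$ viewed (via the projections) as subsets of $S(V_1^{\mathrm{sa}}\oplus V_2^{\mathrm{sa}})$. **Continuous fields.** Given $j\colon C(T)\to\mathcal{Z}(A)$, the fibre $A_t$ is the quotient of $A$ by the closed ideal generated by $j(\{f\in C(T)\mid f(t)=0\})$, $\mathrm{ev}_t\colon A\to A_t$ is the quotient map, $y_t:=\mathrm{ev}_t(y)$, and the field is continuous when $t\mapsto\|y_t\|_t$ is continuous for all $y\in A$, where $\|\cdot\|_t$ is the norm of $A_t$. $V$ itself need not be invariant under the involution of $A$; via the bijection $\mathrm{ev}_t\colon V\to V_t$ the involution $*_t$ of $A_t$ induces an involution $*_t\colon V\to V$. **Uniform family.** $\{(V_t^{\mathrm{sa}},L_t^{\mathrm{sa}})\}_{t\in T}$ is a uniform family of order unit compact quantum metric spaces when: (1) $(V_t^{\mathrm{sa}},L_t^{\mathrm{sa}})$ is an order unit compact quantum metric space for all $t\in T$; (2) $t\mapsto L_t(y_t)$ is continuous on $T$ for all $y\in V$; (3) for each $t_0\in T$ and $\varepsilon>0$ there is an open neighbourhood $U\subseteq T$ of $t_0$ with $(1-\varepsilon)L_{t_0}(y_{t_0})\le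 L_t(y_t)$ for all $y\in V$ and $t\in U$; (4) there exist a norm $\|\cdot\|_\star\colon V\to[0,\infty)$ and a constant $C>0$ such that $\|\xi^{*_t}\|_\star=\|\xi\|_\star$ and $\frac1C\|\xi\|_\star\le\|\xi_t\|_t\le C\|\xi\|_\star$ for all $\xi\in V$ and $t\in T$. *)

theory Defs
  imports "HOL-Analysis.Analysis" "HOL-Algebra.Module" "HOL-Algebra.QuotRing"
    "HOL-Algebra.Chinese_Remainder"
begin

section \<open>Unital C*-algebras\<close>

definition complex_field :: "complex ring"
  where "complex_field = \<lparr>carrier = UNIV, mult = (*), one = 1, zero = 0, add = (+)\<rparr>"

record 'a cstar = "(complex, 'a) module" +
  star :: "'a \<Rightarrow> 'a"
  nrm :: "'a \<Rightarrow> real"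

text \<open>The guard makes the distance symmetric and nonnegative on the whole type,
  as \<^locale>\<open>Metric_space\<close> requires.\<close>

definition cdist :: "'a cstar \<Rightarrow> 'a \<Rightarrow> 'a \<Rightarrow> real"
  where "cdist A x y =
    (if x \<in> carrier A \<and> y \<in> carrier A then nrm A (x \<ominus>\<^bsub>A\<^esub> y) else 0)"

definition norm_topology :: "'a cstar \<Rightarrow> 'a topology"
  where "norm_topology A = Metric_space.mtopology (carrier A) (cdist A)"

locale unital_cstar_algebra = module complex_field A + ring A for A :: "'a cstar" (structure) +
  assumes smult_mult_left:
      "\<lbrakk>x \<in> carrier A; y \<in> carrier A\<rbrakk> \<Longrightarrow> (c \<odot> x) \<otimes> y = c \<odot> (x \<otimes> y)"
    and smult_mult_right:
      "\<lbrakk>x \<in> carrier A; y \<in> carrier A\<rbrakk> \<Longrightarrow> x \<otimes> (c \<odot> y) = c \<odot> (x \<otimes> y)"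
    and star_closed: "x \<in> carrier A \<Longrightarrow> star A x \<in> carrier A"
    and star_star: "x \<in> carrier A \<Longrightarrow> star A (star A x) = x"
    and star_add:
      "\<lbrakk>x \<in> carrier A; y \<in> carrier A\<rbrakk> \<Longrightarrow> star A (x \<oplus> y) = star A x \<oplus> star A y"
    and star_smult: "x \<in> carrier A \<Longrightarrow> star A (c \<odot> x) = cnj c \<odot> star A x"
    and star_mult:
      "\<lbrakk>x \<in> carrier A; y \<in> carrier A\<rbrakk> \<Longrightarrow> star A (x \<otimes> y) = star A y \<otimes> star A x"
    and nrm_nonneg: "x \<in> carrier A \<Longrightarrow> 0 \<le> nrm A x"
    and nrm_eq_zero_iff: "x \<in> carrier A \<Longrightarrow> nrm A x = 0 \<longleftrightarrow> x = \<zero>"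
    and nrm_triangle:
      "\<lbrakk>x \<in> carrier A; y \<in> carrier A\<rbrakk> \<Longrightarrow> nrm A (x \<oplus> y) \<le> nrm A x + nrm A y"
    and nrm_smult: "x \<in> carrier A \<Longrightarrow> nrm A (c \<odot> x) = cmod c * nrm A x"
    and nrm_mult:
      "\<lbrakk>x \<in> carrier A; y \<in> carrier A\<rbrakk> \<Longrightarrow> nrm A (x \<otimes> y) \<le> nrm A x * nrm A y"
    and cstar_identity: "x \<in> carrier A \<Longrightarrow> nrm A (star A x \<otimes> x) = (nrm A x)\<^sup>2"
    and complete: "Metric_space.mcomplete (carrier A) (cdist A)"

definition centre :: "'a cstar \<Rightarrow> 'a set"
  where "centre A = {z \<in> carrier A. \<forall>x\<in>carrier A. z \<otimes>\<^bsub>A\<^esub> x = x \<otimes>\<^bsub>A\<^esub> z}"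

text \<open>Elements of \<^const>\<open>ring_hom\<close> preserve the unit.\<close>

definition unital_star_hom :: "'a cstar \<Rightarrow> 'b cstar \<Rightarrow> ('a \<Rightarrow> 'b) set"
  where "unital_star_hom A B =
    {h \<in> ring_hom A B. \<forall>x\<in>carrier A.
       (\<forall>c. h (c \<odot>\<^bsub>A\<^esub> x) = c \<odot>\<^bsub>B\<^esub> h x) \<and> h (star A x) = star B (h x)}"

definition positive :: "'a cstar \<Rightarrow> 'a \<Rightarrow> bool"
  where "positive A x \<longleftrightarrow> (\<exists>y\<in>carrier A. x = star A y \<otimes>\<^bsub>A\<^esub> y)"

definition continuous_functions :: "('t::topological_space \<Rightarrow> complex) cstar"
  where "continuous_functions =
    \<lparr>carrier = {f. continuous_on UNIV f}, mult = (\<lambda>f g x. f x * g x), one = (\<lambda>x. 1),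
     zero = (\<lambda>x. 0), add = (\<lambda>f g x. f x + g x), smult = (\<lambda>c f x. c * f x),
     star = (\<lambda>f x. cnj (f x)), nrm = (\<lambda>f. SUP x. cmod (f x))\<rparr>"

definition direct_sum :: "'a cstar \<Rightarrow> 'b cstar \<Rightarrow> ('a \<times> 'b) cstar"
  where "direct_sum A B =
    \<lparr>carrier = carrier (RDirProd A B), mult = mult (RDirProd A B), one = one (RDirProd A B),
     zero = zero (RDirProd A B), add = add (RDirProd A B),
     smult = (\<lambda>c (x, y). (c \<odot>\<^bsub>A\<^esub> x, c \<odot>\<^bsub>B\<^esub> y)),
     star = (\<lambda>(x, y). (star A x, star B y)), nrm = (\<lambda>(x, y). max (nrm A x) (nrm B y))\<rparr>"

text \<open>Elements of the quotient are cosets. As for \<^const>\<open>rcoset_mult\<close>, an operation on cosets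
  is the union of the cosets of the results on representatives.\<close>

definition quotient_cstar :: "'a cstar \<Rightarrow> 'a set \<Rightarrow> 'a set cstar"
  where "quotient_cstar A I =
    \<lparr>carrier = carrier (A Quot I), mult = mult (A Quot I), one = one (A Quot I),
     zero = zero (A Quot I), add = add (A Quot I),
     smult = (\<lambda>c X. \<Union>x\<in>X. I +>\<^bsub>A\<^esub> (c \<odot>\<^bsub>A\<^esub> x)),
     star = (\<lambda>X. \<Union>x\<in>X. I +>\<^bsub>A\<^esub> star A x), nrm = (\<lambda>X. Inf (nrm A ` X))\<rparr>"

definition closed_ideal_generated :: "'a cstar \<Rightarrow> 'a set \<Rightarrow> 'a set"
  where "closed_ideal_generated A S =
    \<Inter>{I. ideal I A \<and> closedin (norm_topology A) I \<and> S \<subseteq> I}"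


section \<open>Order unit compact quantum metric spaces\<close>

definition unital_selfadjoint_subspace :: "'a cstar \<Rightarrow> 'a set \<Rightarrow> bool"
  where "unital_selfadjoint_subspace A V \<longleftrightarrow>
    submodule V complex_field A \<and> \<one>\<^bsub>A\<^esub> \<in> V \<and> star A ` V = V"

definition sa :: "'a cstar \<Rightarrow> 'a set \<Rightarrow> 'a set"
  where "sa A V = {\<xi> \<in> V. star A \<xi> = \<xi>}"

text \<open>The scalars are those in \<open>K\<close>: below, \<open>K = \<real>\<close> for semi-norms on a space of
  self-adjoint elements and \<open>K = UNIV\<close> for complex semi-norms.\<close>

definition seminorm_on :: "complex set \<Rightarrow> 'a cstar \<Rightarrow> 'a set \<Rightarrow> ('a \<Rightarrow> real) \<Rightarrow> bool"
  where "seminorm_on K A V L \<longleftrightarrow>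
    (\<forall>\<xi>\<in>V. 0 \<le> L \<xi>) \<and>
    (\<forall>\<xi>\<in>V. \<forall>\<eta>\<in>V. L (\<xi> \<oplus>\<^bsub>A\<^esub> \<eta>) \<le> L \<xi> + L \<eta>) \<and>
    (\<forall>c\<in>K. \<forall>\<xi>\<in>V. L (c \<odot>\<^bsub>A\<^esub> \<xi>) = cmod c * L \<xi>)"

text \<open>In this section \<open>V\<close> is a unital self-adjoint subspace of \<open>A\<close>. The order unit space in
  question is \<^term>\<open>sa A V\<close>, and a semi-norm \<open>L\<close> only matters through its values there.
  States are functions on \<^term>\<open>sa A V\<close>, hence extensional.\<close>

definition states :: "'a cstar \<Rightarrow> 'a set \<Rightarrow> ('a \<Rightarrow> real) set"
  where "states A V = {\<mu> \<in> extensional (sa A V).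
    (\<forall>\<xi>\<in>sa A V. \<forall>\<eta>\<in>sa A V. \<mu> (\<xi> \<oplus>\<^bsub>A\<^esub> \<eta>) = \<mu> \<xi> + \<mu> \<eta>) \<and>
    (\<forall>r::real. \<forall>\<xi>\<in>sa A V. \<mu> (complex_of_real r \<odot>\<^bsub>A\<^esub> \<xi>) = r * \<mu> \<xi>) \<and>
    (\<forall>\<xi>\<in>sa A V. positive A \<xi> \<longrightarrow> 0 \<le> \<mu> \<xi>) \<and>
    \<mu> \<one>\<^bsub>A\<^esub> = 1}"

definition weak_star_topology :: "'a cstar \<Rightarrow> 'a set \<Rightarrow> ('a \<Rightarrow> real) topology"
  where "weak_star_topology A V = subtopology (powertop_real (sa A V)) (states A V)"

definition rho :: "'a cstar \<Rightarrow> 'a set \<Rightarrow> ('a \<Rightarrow> real) \<Rightarrow> ('a \<Rightarrow> real) \<Rightarrow> ('a \<Rightarrow> real) \<Rightarrow> ennreal"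
  where "rho A V L \<mu> \<nu> = (SUP \<xi>\<in>{\<xi> \<in> sa A V. L \<xi> \<le> 1}. ennreal \<bar>\<mu> \<xi> - \<nu> \<xi>\<bar>)"

text \<open>A priori \<open>rho\<close> is an extended metric. Metrizing the weak star topology includes being finite;
  this is no restriction, as the state space is convex, hence connected in that topology.\<close>

definition metrizes_states :: "'a cstar \<Rightarrow> 'a set \<Rightarrow> ('a \<Rightarrow> real) \<Rightarrow> bool"
  where "metrizes_states A V L \<longleftrightarrow>
    (\<forall>\<mu>\<in>states A V. \<forall>\<nu>\<in>states A V. rho A V L \<mu> \<nu> < \<infinity>) \<and>
    Metric_space (states A V) (\<lambda>\<mu> \<nu>. enn2real (rho A V L \<mu> \<nu>)) \<and>
    Metric_space.mtopology (states A V) (\<lambda>\<mu> \<nu>. enn2real (rho A V L \<mu> \<nu>)) =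
      weak_star_topology A V"

definition order_unit_cqms :: "'a cstar \<Rightarrow> 'a set \<Rightarrow> ('a \<Rightarrow> real) \<Rightarrow> bool"
  where "order_unit_cqms A V L \<longleftrightarrow>
    unital_selfadjoint_subspace A V \<and> seminorm_on \<real> A (sa A V) L \<and> L \<one>\<^bsub>A\<^esub> = 0 \<and>
    metrizes_states A V L"

definition radius :: "'a cstar \<Rightarrow> 'a set \<Rightarrow> ('a \<Rightarrow> real) \<Rightarrow> ennreal"
  where "radius A V L = (SUP \<mu>\<in>states A V. SUP \<nu>\<in>states A V. rho A V L \<mu> \<nu>) / 2"


section \<open>Quantum Gromov-Hausdorff distance\<close>

text \<open>The direct sum of the order unit spaces of \<open>V1 \<subseteq> A1\<close> and \<open>V2 \<subseteq> A2\<close> is the order unit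
  space of \<open>V1 \<times> V2 \<subseteq> direct_sum A1 A2\<close>.\<close>

definition admissible ::
    "'a cstar \<Rightarrow> 'a set \<Rightarrow> ('a \<Rightarrow> real) \<Rightarrow> 'b cstar \<Rightarrow> 'b set \<Rightarrow> ('b \<Rightarrow> real) \<Rightarrow> ('a \<times> 'b \<Rightarrow> real) \<Rightarrow> bool"
  where "admissible A1 V1 L1 A2 V2 L2 L \<longleftrightarrow>
    order_unit_cqms (direct_sum A1 A2) (V1 \<times> V2) L \<and>
    (\<forall>\<xi>\<in>sa A1 V1. L1 \<xi> = (INF \<eta>\<in>sa A2 V2. L (\<xi>, \<eta>))) \<and>
    (\<forall>\<eta>\<in>sa A2 V2. L2 \<eta> = (INF \<xi>\<in>sa A1 V1. L (\<xi>, \<eta>)))"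

definition pullback_fst ::
    "'a cstar \<Rightarrow> 'a set \<Rightarrow> 'b cstar \<Rightarrow> 'b set \<Rightarrow> ('a \<Rightarrow> real) \<Rightarrow> 'a \<times> 'b \<Rightarrow> real"
  where "pullback_fst A1 V1 A2 V2 \<mu> = restrict (\<mu> \<circ> fst) (sa (direct_sum A1 A2) (V1 \<times> V2))"

definition pullback_snd ::
    "'a cstar \<Rightarrow> 'a set \<Rightarrow> 'b cstar \<Rightarrow> 'b set \<Rightarrow> ('b \<Rightarrow> real) \<Rightarrow> 'a \<times> 'b \<Rightarrow> real"
  where "pullback_snd A1 V1 A2 V2 \<mu> = restrict (\<mu> \<circ> snd) (sa (direct_sum A1 A2) (V1 \<times> V2))"

definition hausdorff_distance :: "('x \<Rightarrow> 'x \<Rightarrow> ennreal) \<Rightarrow> 'x set \<Rightarrow> 'x set \<Rightarrow> ennreal"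
  where "hausdorff_distance d X Y = max (SUP x\<in>X. INF y\<in>Y. d x y) (SUP y\<in>Y. INF x\<in>X. d x y)"

definition dist_q ::
    "'a cstar \<Rightarrow> 'a set \<Rightarrow> ('a \<Rightarrow> real) \<Rightarrow> 'b cstar \<Rightarrow> 'b set \<Rightarrow> ('b \<Rightarrow> real) \<Rightarrow> ennreal"
  where "dist_q A1 V1 L1 A2 V2 L2 =
    (INF L\<in>{L. admissible A1 V1 L1 A2 V2 L2 L}.
       hausdorff_distance (rho (direct_sum A1 A2) (V1 \<times> V2) L)
         (pullback_fst A1 V1 A2 V2 ` states A1 V1)
         (pullback_snd A1 V1 A2 V2 ` states A2 V2))"


section \<open>Continuous fields and uniform families\<close>

definition fibre_ideal ::
    "'a cstar \<Rightarrow> (('t::topological_space \<Rightarrow> complex) \<Rightarrow> 'a) \<Rightarrow> 't \<Rightarrow> 'a set"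
  where "fibre_ideal A j t =
    closed_ideal_generated A (j ` {f \<in> carrier continuous_functions. f t = 0})"

definition fibre ::
    "'a cstar \<Rightarrow> (('t::topological_space \<Rightarrow> complex) \<Rightarrow> 'a) \<Rightarrow> 't \<Rightarrow> 'a set cstar"
  where "fibre A j t = quotient_cstar A (fibre_ideal A j t)"

definition ev ::
    "'a cstar \<Rightarrow> (('t::topological_space \<Rightarrow> complex) \<Rightarrow> 'a) \<Rightarrow> 't \<Rightarrow> 'a \<Rightarrow> 'a set"
  where "ev A j t y = fibre_ideal A j t +>\<^bsub>A\<^esub> y"

definition continuous_field ::
    "'a cstar \<Rightarrow> (('t::topological_space \<Rightarrow> complex) \<Rightarrow> 'a) \<Rightarrow> bool"
  where "continuous_field A j \<longleftrightarrow>
    (\<forall>y\<in>carrier A. continuous_on UNIV (\<lambda>t. nrm (fibre A j t) (ev A j t y)))"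

definition induced_star ::
    "'a cstar \<Rightarrow> (('t::topological_space \<Rightarrow> complex) \<Rightarrow> 'a) \<Rightarrow> 'a set \<Rightarrow> 't \<Rightarrow> 'a \<Rightarrow> 'a"
  where "induced_star A j V t \<xi> = inv_into V (ev A j t) (star (fibre A j t) (ev A j t \<xi>))"

definition uniform_family ::
    "'a cstar \<Rightarrow> (('t::topological_space \<Rightarrow> complex) \<Rightarrow> 'a) \<Rightarrow> 'a set \<Rightarrow> ('t \<Rightarrow> 'a set \<Rightarrow> real) \<Rightarrow> bool"
  where "uniform_family A j V L \<longleftrightarrow>
    (\<forall>t. order_unit_cqms (fibre A j t) (ev A j t ` V) (L t)) \<and>
    (\<forall>y\<in>V. continuous_on UNIV (\<lambda>t. L t (ev A j t y))) \<and>
    (\<forall>s. \<forall>\<epsilon>>0. \<exists>U. open U \<and> s \<in> U \<and>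
       (\<forall>y\<in>V. \<forall>t\<in>U. (1 - \<epsilon>) * L s (ev A j s y) \<le> L t (ev A j t y))) \<and>
    (\<exists>N C. C > 0 \<and> seminorm_on UNIV A V N \<and> (\<forall>\<xi>\<in>V. N \<xi> = 0 \<longrightarrow> \<xi> = \<zero>\<^bsub>A\<^esub>) \<and>
       (\<forall>\<xi>\<in>V. \<forall>t. N (induced_star A j V t \<xi>) = N \<xi> \<and>
          1 / C * N \<xi> \<le> nrm (fibre A j t) (ev A j t \<xi>) \<and>
          nrm (fibre A j t) (ev A j t \<xi>) \<le> C * N \<xi>))"

end

theory Submission
  imports Defs
begin

text \<open>The spaces of self-adjoint elements in two fibres are compared through the identification with
  \<open>V\<close>: on their direct sum consider the maximum of the two semi-norms and of a large multiple of
  the norm of the difference. By condition (4) of a uniform family all fibre norms are equivalent on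
  \<open>V\<close>, and the Lipschitz ball of the fibre at \<open>t0\<close> is totally bounded modulo scalars. Hence
  finitely many elements control this ball, and for \<open>t\<close> near \<open>t0\<close> the norms of the two fibres
  almost agree on it and it is almost fixed by the involution of the fibre at \<open>t\<close>; together with
  (2) and (3) this makes the semi-norm admissible. The largest value of the states at \<open>x\<close> is
  \<open>\<parallel>x + m\<parallel> - m\<close> for \<open>m \<ge> \<parallel>x\<parallel>\<close>, so it is almost the same in both fibres, and a Hahn-Banach
  argument produces, for a state of one fibre, a nearby state of the other.\<close>

section \<open>C*-algebras: linear identities, norm and limits\<close>

text \<open>The obstacle is that the identification of two fibres with \<open>V\<close> preserves
  neither the involution nor the order: an element that is self-adjoint in one fibre usually is not
  in the other. It is replaced by its real part there, and the error is measured by how far the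
  involution moves it. The order has no continuity of its own in \<open>t\<close>, but norms do.
  Hence positivity is expressed by norms (\<open>psd\<close>), and one shift
  \<open>m = D * R\<close>, large enough for both fibres, expresses the state values of both.
  Condition (2) is pointwise in \<open>y\<close>, so it is applied at the points of a finite net,
  whereas condition (3) is uniform in \<open>y\<close> and controls arbitrary elements.
  \<open>D\<close> compares any two fibre norms on \<open>V\<close>, \<open>R / 2\<close> bounds all
  radii, and scalars are subtracted freely, since states agree on them and the semi-norms vanish
  there. The facts about positive elements come from square roots found by iteration and from the
  C*-identity, without spectral theory.\<close>

lemma cdist_Metric_space:
  assumes "abelian_group A"
    and nonneg: "\<And>x. x \<in> carrier A \<Longrightarrow> 0 \<le> nrm A x"
    and zero: "\<And>x. x \<in> carrier A \<Longrightarrow> nrm A x = 0 \<longleftrightarrow> x = \<zero>\<^bsub>A\<^esub>"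
    and minus: "\<And>x. x \<in> carrier A \<Longrightarrow> nrm A (\<ominus>\<^bsub>A\<^esub> x) = nrm A x"
    and triangle: "\<And>x y. \<lbrakk>x \<in> carrier A; y \<in> carrier A\<rbrakk> \<Longrightarrow> nrm A (x \<oplus>\<^bsub>A\<^esub> y) \<le> nrm A x + nrm A y"
  shows "Metric_space (carrier A) (cdist A)"
proof -
  interpret abelian_group A by fact
  have com: "nrm A (x \<ominus>\<^bsub>A\<^esub> y) = nrm A (y \<ominus>\<^bsub>A\<^esub> x)" if "x \<in> carrier A" "y \<in> carrier A" for x y
    using minus[of "x \<ominus>\<^bsub>A\<^esub> y"] that by (simp add: minus_eq minus_add a_comm)
  show ?thesis
  proof
    show "0 \<le> cdist A x y" for x y by (simp add: cdist_def nonneg)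
    show "cdist A x y = cdist A y x" for x y by (simp add: cdist_def com)
    show "(cdist A x y = 0) = (x = y)" if xy: "x \<in> carrier A" "y \<in> carrier A" for x y
    proof -
      have "x \<ominus>\<^bsub>A\<^esub> y = \<zero>\<^bsub>A\<^esub> \<longleftrightarrow> x = y"
        using xy by (metis minus_eq r_neg minus_minus minus_equality a_inv_closed)
      then show ?thesis using xy zero by (simp add: cdist_def)
    qed
    show "cdist A x z \<le> cdist A x y + cdist A y z"
      if xyz: "x \<in> carrier A" "y \<in> carrier A" "z \<in> carrier A" for x y z
    proof -
      have "(x \<ominus>\<^bsub>A\<^esub> y) \<oplus>\<^bsub>A\<^esub> (y \<ominus>\<^bsub>A\<^esub> z) = x \<ominus>\<^bsub>A\<^esub> z"
        using xyz by (simp add: minus_eq a_assoc r_neg1)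
      then show ?thesis using triangle[of "x \<ominus>\<^bsub>A\<^esub> y" "y \<ominus>\<^bsub>A\<^esub> z"] xyz by (simp add: cdist_def)
    qed
  qed
qed

context unital_cstar_algebra
begin

lemma smult_in [simp, intro]: "x \<in> carrier A \<Longrightarrow> c \<odot> x \<in> carrier A"
  using smult_closed[of c x] by (simp add: complex_field_def)

lemma smult_add_left: "x \<in> carrier A \<Longrightarrow> (c + d) \<odot> x = c \<odot> x \<oplus> d \<odot> x"
  using smult_l_distr[of c d x] by (simp add: complex_field_def)

lemma smult_add_right:
  "\<lbrakk>x \<in> carrier A; y \<in> carrier A\<rbrakk> \<Longrightarrow> c \<odot> (x \<oplus> y) = c \<odot> x \<oplus> c \<odot> y"
  using smult_r_distr[of c x y] by (simp add: complex_field_def)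

lemma smult_smult [simp]: "x \<in> carrier A \<Longrightarrow> c \<odot> (d \<odot> x) = (c * d) \<odot> x"
  using smult_assoc1[of c d x] by (simp add: complex_field_def)

lemma one_smult [simp]: "x \<in> carrier A \<Longrightarrow> 1 \<odot> x = x"
  using smult_one[of x] by (simp add: complex_field_def)

lemma zero_smult [simp]: "x \<in> carrier A \<Longrightarrow> 0 \<odot> x = \<zero>"
  using smult_l_null[of x] by (simp add: complex_field_def)

lemma smult_zero [simp]: "c \<odot> \<zero> = \<zero>"
  using smult_r_null[of c] by (simp add: complex_field_def)

lemma minus_smult: "x \<in> carrier A \<Longrightarrow> (- c) \<odot> x = \<ominus> (c \<odot> x)"
  using smult_add_left[of x "-c" c] M.minus_equality[of "(-c) \<odot> x" "c \<odot> x"] by simp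

lemma a_inv_smult: "x \<in> carrier A \<Longrightarrow> \<ominus> x = (- 1) \<odot> x"
  using minus_smult[of x 1] by simp

text \<open>Identities between linear combinations of at most four elements are checked by comparing
  coefficients.\<close>

definition frame ::
    "'a \<Rightarrow> 'a \<Rightarrow> 'a \<Rightarrow> 'a \<Rightarrow> (complex \<Rightarrow> complex \<Rightarrow> complex \<Rightarrow> complex \<Rightarrow> 'a) \<Rightarrow> bool"
  where "frame x y z w F \<longleftrightarrow> x \<in> carrier A \<and> y \<in> carrier A \<and> z \<in> carrier A \<and> w \<in> carrier A \<and>
    F = (\<lambda>a b c d. (a \<odot> x \<oplus> b \<odot> y) \<oplus> (c \<odot> z \<oplus> d \<odot> w))"

lemma frame_exists:
  assumes "x \<in> carrier A" "y \<in> carrier A" "z \<in> carrier A" "w \<in> carrier A"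
  obtains F where "frame x y z w F"
  using assms unfolding frame_def by blast

text \<open>Used as rewrite rules, these turn each of the four vectors into the opaque
  \<open>F\<close> at a coordinate vector, so both sides of a linear identity become values of
  \<open>F\<close> and only complex arithmetic remains. Unneeded slots are filled by repeating a
  vector.\<close>

lemma frameD:
  assumes F: "frame x y z w F"
  shows "x = F 1 0 0 0" "y = F 0 1 0 0" "z = F 0 0 1 0" "w = F 0 0 0 1" "\<zero> = F 0 0 0 0"
    "F a b c d \<in> carrier A" "F a b c d \<oplus> F a' b' c' d' = F (a + a') (b + b') (c + c') (d + d')"
    "F a b c d \<ominus> F a' b' c' d' = F (a - a') (b - b') (c - c') (d - d')"
    "\<ominus> F a b c d = F (- a) (- b) (- c) (- d)" "e \<odot> F a b c d = F (e * a) (e * b) (e * c) (e * d)"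
proof -
  have cl: "F a b c d \<in> carrier A" for a b c d
    using assms by (auto simp: frame_def)
  have sm: "e \<odot> F a b c d = F (e * a) (e * b) (e * c) (e * d)" for a b c d e
    using assms by (simp add: frame_def smult_add_right)
  have ad: "F a b c d \<oplus> F a' b' c' d' = F (a + a') (b + b') (c + c') (d + d')" for a b c d a' b' c' d'
    using assms by (simp add: frame_def smult_add_left M.a_ac)
  have mi: "\<ominus> F a b c d = F (- a) (- b) (- c) (- d)" for a b c d
    using a_inv_smult[OF cl] by (simp add: sm)
  show "F a b c d \<ominus> F a' b' c' d' = F (a - a') (b - b') (c - c') (d - d')"
    by (simp add: M.minus_eq mi ad)
  show "x = F 1 0 0 0" "y = F 0 1 0 0" "z = F 0 0 1 0" "w = F 0 0 0 1" "\<zero> = F 0 0 0 0"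
    using assms by (simp_all add: frame_def)
  show "F a b c d \<in> carrier A" "F a b c d \<oplus> F a' b' c' d' = F (a + a') (b + b') (c + c') (d + d')"
    "\<ominus> F a b c d = F (- a) (- b) (- c) (- d)" "e \<odot> F a b c d = F (e * a) (e * b) (e * c) (e * d)"
    by (rule cl ad mi sm)+
qed

section \<open>Involution and norm\<close>

lemma star_zero [simp]: "star A \<zero> = \<zero>"
  using star_smult[of \<zero> 0] by (simp add: star_closed)

lemma star_one [simp]: "star A \<one> = \<one>"
  using star_mult[of "star A \<one>" \<one>] by (simp add: star_closed star_star)

declare star_closed [simp, intro] star_star [simp]

lemma star_minus: "x \<in> carrier A \<Longrightarrow> star A (\<ominus> x) = \<ominus> star A x"
  by (simp add: a_inv_smult star_smult)

lemma star_diff: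
  "\<lbrakk>x \<in> carrier A; y \<in> carrier A\<rbrakk> \<Longrightarrow> star A (x \<ominus> y) = star A x \<ominus> star A y"
  by (simp add: a_minus_def star_add star_minus)

lemma mult_diff_left:
  "\<lbrakk>x \<in> carrier A; y \<in> carrier A; z \<in> carrier A\<rbrakk> \<Longrightarrow> (x \<ominus> y) \<otimes> z = x \<otimes> z \<ominus> y \<otimes> z"
  by (simp add: M.minus_eq l_distr l_minus)

lemma mult_diff_right:
  "\<lbrakk>x \<in> carrier A; y \<in> carrier A; z \<in> carrier A\<rbrakk> \<Longrightarrow> z \<otimes> (x \<ominus> y) = z \<otimes> x \<ominus> z \<otimes> y"
  by (simp add: M.minus_eq r_distr r_minus)

lemma nrm_zero [simp]: "nrm A \<zero> = 0"
  by (simp add: nrm_eq_zero_iff)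

lemma nrm_star [simp]:
  assumes "x \<in> carrier A"
  shows "nrm A (star A x) = nrm A x"
proof -
  have "nrm A y \<le> nrm A (star A y)" if y: "y \<in> carrier A" for y
  proof -
    have "nrm A y * nrm A y \<le> nrm A (star A y) * nrm A y"
      using cstar_identity[OF y] nrm_mult[of "star A y" y] y by (simp add: power2_eq_square)
    then show ?thesis
      using nrm_nonneg[OF y] nrm_nonneg[of "star A y"] y
      by (cases "nrm A y = 0") auto
  qed
  from this[of x] this[of "star A x"] assms show ?thesis by simp
qed

lemma nrm_minus [simp]: "x \<in> carrier A \<Longrightarrow> nrm A (\<ominus> x) = nrm A x"
  by (simp add: a_inv_smult nrm_smult)

lemma nrm_diff_commute:
  "\<lbrakk>x \<in> carrier A; y \<in> carrier A\<rbrakk> \<Longrightarrow> nrm A (x \<ominus> y) = nrm A (y \<ominus> x)"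
  using nrm_minus[of "x \<ominus> y"] by (simp add: M.minus_eq M.minus_add M.a_comm)

lemma nrm_diff_triangle:
  assumes "x \<in> carrier A" "y \<in> carrier A" "z \<in> carrier A"
  shows "nrm A (x \<ominus> z) \<le> nrm A (x \<ominus> y) + nrm A (y \<ominus> z)"
proof -
  obtain F where F: "frame x y z z F"
    using frame_exists assms by blast
  then have "x \<ominus> z = (x \<ominus> y) \<oplus> (y \<ominus> z)" by (simp add: frameD[OF F])
  then show ?thesis
    using nrm_triangle[of "x \<ominus> y" "y \<ominus> z"] assms by simp
qed

lemma nrm_triangle_diff:
  "\<lbrakk>x \<in> carrier A; y \<in> carrier A\<rbrakk> \<Longrightarrow> nrm A (x \<ominus> y) \<le> nrm A x + nrm A y"
  using nrm_triangle[of x "\<ominus> y"] by (simp add: a_minus_def)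

lemma nrm_reverse_triangle:
  assumes "x \<in> carrier A" "y \<in> carrier A"
  shows "\<bar>nrm A x - nrm A y\<bar> \<le> nrm A (x \<ominus> y)"
  using nrm_diff_triangle[of x y \<zero>] nrm_diff_triangle[of y x \<zero>] assms nrm_diff_commute[of x y]
  by (simp add: M.minus_eq)

lemma eq_iff_nrm_diff:
  "\<lbrakk>x \<in> carrier A; y \<in> carrier A\<rbrakk> \<Longrightarrow> x = y \<longleftrightarrow> nrm A (x \<ominus> y) = 0"
  by (metis M.minus_closed M.minus_eq M.r_neg nrm_eq_zero_iff M.minus_minus M.minus_equality M.a_inv_closed)

text \<open>The C*-identity makes the norm of \<open>\<one>\<close> idempotent, hence 0 or 1. The
  inequality also covers the zero algebra.\<close>

lemma nrm_one_le: "nrm A \<one> \<le> 1"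
proof -
  have "nrm A \<one> * nrm A \<one> = nrm A \<one> * 1"
    using cstar_identity[of \<one>] by (simp add: power2_eq_square)
  then show ?thesis by (cases "nrm A \<one> = 0") auto
qed

lemma nrm_one: "\<one> \<noteq> \<zero> \<Longrightarrow> nrm A \<one> = 1"
  using cstar_identity[of \<one>] nrm_eq_zero_iff[of \<one>] by (simp add: power2_eq_square)

section \<open>Norm limits of sequences\<close>

abbreviation conv :: "(nat \<Rightarrow> 'a) \<Rightarrow> 'a \<Rightarrow> bool"
  where "conv s l \<equiv> (\<lambda>n. nrm A (s n \<ominus> l)) \<longlonglongrightarrow> 0"

sublocale Metric_space "carrier A" "cdist A"
  by (intro cdist_Metric_space M.abelian_group_axioms nrm_nonneg nrm_eq_zero_iff nrm_minus nrm_triangle)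

lemma conv_iff_limitin:
  assumes "\<And>n. s n \<in> carrier A"
  shows "limitin mtopology s l sequentially \<longleftrightarrow> l \<in> carrier A \<and> conv s l"
  using assms
  by (auto simp: limitin_metric_dist_null cdist_def)

lemma complete_conv:
  assumes "\<And>n. s n \<in> carrier A"
    and "\<And>e. e > 0 \<Longrightarrow> \<exists>N. \<forall>m\<ge>N. \<forall>n\<ge>N. nrm A (s m \<ominus> s n) < e"
  obtains l where "l \<in> carrier A" "conv s l"
proof -
  have "MCauchy s"
    using assms by (auto simp: MCauchy_def cdist_def)
  then obtain l where "limitin mtopology s l sequentially"
    using complete by (auto simp: mcomplete_def)
  then show thesis using that assms conv_iff_limitin by blast
qed

lemma conv_unique:
  assumes "\<And>n. s n \<in> carrier A" "k \<in> carrier A" "l \<in> carrier A" "conv s k" "conv s l"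
  shows "k = l"
proof -
  have "limitin mtopology s k sequentially" "limitin mtopology s l sequentially"
    using assms conv_iff_limitin by auto
  then show ?thesis
    using limitin_metric_unique trivial_limit_sequentially by blast
qed

lemma conv_add:
  assumes "\<And>n. s n \<in> carrier A" "k \<in> carrier A" "conv s k"
    and "\<And>n. u n \<in> carrier A" "l \<in> carrier A" "conv u l"
  shows "conv (\<lambda>n. s n \<oplus> u n) (k \<oplus> l)"
proof (rule tendsto_sandwich[OF _ _ tendsto_const])
  show "(\<lambda>n. nrm A (s n \<ominus> k) + nrm A (u n \<ominus> l)) \<longlonglongrightarrow> 0"
    using tendsto_add[OF assms(3,6)] by simp
  have "nrm A (s n \<oplus> u n \<ominus> (k \<oplus> l)) \<le> nrm A (s n \<ominus> k) + nrm A (u n \<ominus> l)" for n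
  proof -
    have "s n \<oplus> u n \<ominus> (k \<oplus> l) = (s n \<ominus> k) \<oplus> (u n \<ominus> l)"
      using assms(1)[of n] assms(4)[of n] assms(2,5)
      by (simp add: M.minus_eq M.minus_add M.a_ac)
    then show ?thesis
      using assms(1)[of n] assms(4)[of n] assms(2,5) nrm_triangle[of "s n \<ominus> k" "u n \<ominus> l"] by simp
  qed
  then show "\<forall>\<^sub>F n in sequentially. nrm A (s n \<oplus> u n \<ominus> (k \<oplus> l)) \<le> nrm A (s n \<ominus> k) + nrm A (u n \<ominus> l)"
    by simp
qed (use assms in \<open>simp add: nrm_nonneg\<close>)

lemma conv_smult:
  assumes "\<And>n. s n \<in> carrier A" "k \<in> carrier A" "conv s k"
  shows "conv (\<lambda>n. c \<odot> s n) (c \<odot> k)"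
proof -
  have "c \<odot> s n \<ominus> c \<odot> k = c \<odot> (s n \<ominus> k)" for n
    using assms(1)[of n] assms(2) by (simp add: M.minus_eq smult_add_right a_inv_smult)
  then show ?thesis
    using tendsto_mult_left[OF assms(3), of "cmod c"] assms by (simp add: nrm_smult)
qed

lemma conv_star:
  assumes "\<And>n. s n \<in> carrier A" "k \<in> carrier A" "conv s k"
  shows "conv (\<lambda>n. star A (s n)) (star A k)"
  using assms by (simp add: star_diff [symmetric])

lemma conv_nrm:
  assumes "\<And>n. s n \<in> carrier A" "k \<in> carrier A" "conv s k"
  shows "(\<lambda>n. nrm A (s n)) \<longlonglongrightarrow> nrm A k"
proof -
  have "(\<lambda>n. \<bar>nrm A (s n) - nrm A k\<bar>) \<longlonglongrightarrow> 0"
    by (rule tendsto_sandwich[OF _ _ tendsto_const assms(3)])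
      (use assms nrm_reverse_triangle in \<open>auto simp: nrm_nonneg\<close>)
  then show ?thesis
    by (simp add: LIM_zero_iff tendsto_rabs_zero_iff)
qed

lemma conv_mult:
  assumes "\<And>n. s n \<in> carrier A" "k \<in> carrier A" "conv s k"
    and "\<And>n. u n \<in> carrier A" "l \<in> carrier A" "conv u l"
  shows "conv (\<lambda>n. s n \<otimes> u n) (k \<otimes> l)"
proof (rule tendsto_sandwich[OF _ _ tendsto_const])
  show "(\<lambda>n. nrm A (s n \<ominus> k) * nrm A (u n) + nrm A k * nrm A (u n \<ominus> l)) \<longlonglongrightarrow> 0"
    using tendsto_add[OF tendsto_mult[OF assms(3) conv_nrm[OF assms(4-6)]]
        tendsto_mult_left[OF assms(6)]] by simp
  have "nrm A (s n \<otimes> u n \<ominus> k \<otimes> l) \<le> nrm A (s n \<ominus> k) * nrm A (u n) + nrm A k * nrm A (u n \<ominus> l)" for n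
  proof -
    note c = assms(1)[of n] assms(4)[of n] assms(2,5)
    have "s n \<otimes> u n \<ominus> k \<otimes> l = (s n \<ominus> k) \<otimes> u n \<oplus> k \<otimes> (u n \<ominus> l)"
    proof -
      obtain F where F: "frame (s n \<otimes> u n) (k \<otimes> u n) (k \<otimes> l) (k \<otimes> l) F"
        using frame_exists c by (metis m_closed)
      show ?thesis using c by (simp add: mult_diff_left mult_diff_right frameD[OF F])
    qed
    then show ?thesis
      using c nrm_triangle[of "(s n \<ominus> k) \<otimes> u n" "k \<otimes> (u n \<ominus> l)"]
        nrm_mult[of "s n \<ominus> k" "u n"] nrm_mult[of k "u n \<ominus> l"] by simp
  qed
  then show "\<forall>\<^sub>F n in sequentially. nrm A (s n \<otimes> u n \<ominus> k \<otimes> l) \<le> nrm A (s n \<ominus> k) * nrm A (u n) + nrm A k * nrm A (u n \<ominus> l)"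
    by simp
qed (use assms in \<open>simp add: nrm_nonneg\<close>)

end

section \<open>Square roots and positive elements\<close>

primrec majorant :: "nat \<Rightarrow> real"
  where "majorant 0 = 0"
  | "majorant (Suc n) = (1 + (majorant n)\<^sup>2) / 2"

lemma majorant_bounds: "0 \<le> majorant n \<and> majorant n \<le> 1"
proof (induction n)
  case (Suc n)
  then have "(majorant n)\<^sup>2 \<le> 1" by (simp add: power_le_one)
  then show ?case by simp
qed simp

text \<open>The increment is half the square of \<open>majorant n - 1\<close>.\<close>

lemma majorant_mono: "majorant n \<le> majorant (Suc n)"
  using sum_power2_ge_zero[of "majorant n - 1" 0] by (simp add: power2_eq_square algebra_simps)

lemma majorant_Cauchy: "Cauchy majorant"
proof -
  have "incseq majorant" by (intro incseq_SucI majorant_mono)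
  then have "convergent majorant"
    using majorant_bounds by (intro Bseq_mono_convergent BseqI'[of _ 1]) (auto simp: incseq_def)
  then show ?thesis by (rule convergent_Cauchy)
qed

context unital_cstar_algebra
begin

section \<open>Self-adjoint elements\<close>

abbreviation herm :: "'a set"
  where "herm \<equiv> sa A (carrier A)"

lemma herm_iff: "x \<in> herm \<longleftrightarrow> x \<in> carrier A \<and> star A x = x"
  by (auto simp: sa_def)

lemma hermD: "x \<in> herm \<Longrightarrow> x \<in> carrier A" "x \<in> herm \<Longrightarrow> star A x = x"
  by (auto simp: sa_def)

lemma herm_zero [simp]: "\<zero> \<in> herm" and herm_one [simp]: "\<one> \<in> herm"
  by (simp_all add: herm_iff)

lemma herm_add: "\<lbrakk>x \<in> herm; y \<in> herm\<rbrakk> \<Longrightarrow> x \<oplus> y \<in> herm"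
  by (simp add: herm_iff star_add)

lemma herm_diff: "\<lbrakk>x \<in> herm; y \<in> herm\<rbrakk> \<Longrightarrow> x \<ominus> y \<in> herm"
  by (simp add: herm_iff star_diff)

lemma herm_smult: "x \<in> herm \<Longrightarrow> complex_of_real r \<odot> x \<in> herm"
  by (simp add: herm_iff star_smult)

lemma herm_mult: "\<lbrakk>x \<in> herm; y \<in> herm; x \<otimes> y = y \<otimes> x\<rbrakk> \<Longrightarrow> x \<otimes> y \<in> herm"
  by (simp add: herm_iff star_mult)

lemma herm_square: "x \<in> herm \<Longrightarrow> x \<otimes> x \<in> herm"
  by (simp add: herm_mult)

lemma herm_star_mult: "x \<in> carrier A \<Longrightarrow> star A x \<otimes> x \<in> herm"
  by (simp add: herm_iff star_mult)

lemma nrm_square: "x \<in> herm \<Longrightarrow> nrm A (x \<otimes> x) = (nrm A x)\<^sup>2"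
  using cstar_identity[of x] by (simp add: herm_iff)

lemma conv_herm:
  assumes "\<And>n. s n \<in> herm" "k \<in> carrier A" "conv s k"
  shows "k \<in> herm"
proof -
  have s: "\<And>n. s n \<in> carrier A" and ss: "\<And>n. star A (s n) = s n"
    using assms(1) by (auto simp: herm_iff)
  have "conv s (star A k)"
    using conv_star[OF s assms(2,3)] ss by simp
  then show ?thesis
    using conv_unique[OF s _ _ _ assms(3)] assms(2) by (auto simp: herm_iff)
qed

text \<open>Lets commutation pass from the iterates to the square root in
  \<open>square_root_exists\<close>.\<close>

lemma conv_commute:
  assumes s: "\<And>n. s n \<in> carrier A" and k: "k \<in> carrier A" "conv s k" and y: "y \<in> carrier A"
    and c: "\<And>n. y \<otimes> s n = s n \<otimes> y"
  shows "y \<otimes> k = k \<otimes> y"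
proof -
  have cy: "conv (\<lambda>n. y) y" using y by (simp add: M.minus_eq M.r_neg)
  have "conv (\<lambda>n. y \<otimes> s n) (y \<otimes> k)"
    using conv_mult[OF _ y cy s k] y by simp
  moreover have "conv (\<lambda>n. y \<otimes> s n) (k \<otimes> y)"
    using conv_mult[OF s k _ y cy] y c by simp
  ultimately show ?thesis
    using conv_unique[of "\<lambda>n. y \<otimes> s n" "y \<otimes> k" "k \<otimes> y"] s k y by simp
qed

text \<open>A solution of \<open>2 r = x + r\<^sup>2\<close> makes \<open>1 - r\<close> a square root of \<open>1 - x\<close>. It is found by
  iteration; the iteration for the number \<open>1\<close> in place of \<open>x\<close> dominates this one and is increasing
  and bounded by \<open>1\<close>.\<close>

primrec root_iter :: "'a \<Rightarrow> nat \<Rightarrow> 'a"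
  where "root_iter x 0 = \<zero>"
  | "root_iter x (Suc n) = (1 / 2) \<odot> (x \<oplus> root_iter x n \<otimes> root_iter x n)"

lemma root_iter_in: "x \<in> carrier A \<Longrightarrow> root_iter x n \<in> carrier A"
  by (induction n) auto

lemma root_iter_commute:
  assumes "x \<in> carrier A" "y \<in> carrier A" "y \<otimes> x = x \<otimes> y"
  shows "y \<otimes> root_iter x n = root_iter x n \<otimes> y"
proof (induction n)
  case (Suc n)
  note c = assms(1,2) root_iter_in[OF assms(1), of n]
  have "y \<otimes> (root_iter x n \<otimes> root_iter x n) = root_iter x n \<otimes> root_iter x n \<otimes> y"
    using Suc c by (metis m_assoc)
  then show ?case
    using c assms(3) by (simp add: smult_mult_left smult_mult_right l_distr r_distr)
qed (use assms in simp)

lemma root_iter_herm: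
  assumes "x \<in> herm"
  shows "root_iter x n \<in> herm"
proof (induction n)
  case (Suc n)
  then have "x \<oplus> root_iter x n \<otimes> root_iter x n \<in> herm"
    using assms by (intro herm_add herm_square)
  from herm_smult[OF this, of "1/2"] show ?case by simp
qed simp

lemma nrm_root_iter:
  assumes "x \<in> carrier A" "nrm A x \<le> 1"
  shows "nrm A (root_iter x n) \<le> majorant n"
proof (induction n)
  case (Suc n)
  note c = assms(1) root_iter_in[OF assms(1), of n]
  have "nrm A (root_iter x n \<otimes> root_iter x n) \<le> (majorant n)\<^sup>2"
    using nrm_mult[of "root_iter x n" "root_iter x n"] c Suc nrm_nonneg[of "root_iter x n"]
      power_mono[OF Suc, of 2] by (simp add: power2_eq_square)
  then show ?case
    using nrm_triangle[of x "root_iter x n \<otimes> root_iter x n"] c assms(2) by (simp add: nrm_smult)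
qed simp

text \<open>Since all iterates commute, \<open>p \<otimes> p \<ominus> q \<otimes> q\<close> factors
  as \<open>(p \<oplus> q) \<otimes> (p \<ominus> q)\<close>, and the increments of
  \<open>majorant\<close> obey the same recursion with equality. For \<open>nrm A x = 1\<close> the
  iteration need not contract, so summability is borrowed from the convergence of
  \<open>majorant\<close>.\<close>

lemma nrm_root_iter_diff:
  assumes "x \<in> carrier A" "nrm A x \<le> 1"
  shows "nrm A (root_iter x (Suc n) \<ominus> root_iter x n) \<le> majorant (Suc n) - majorant n"
proof (induction n)
  case 0
  then show ?case using assms by (simp add: nrm_smult M.minus_eq)
next
  case (Suc n)
  let ?r = "root_iter x"
  note r = root_iter_in[OF assms(1)]
  define p q where "p = ?r (Suc n)" and "q = ?r n"
  have pq: "p \<in> carrier A" "q \<in> carrier A" using r by (auto simp: p_def q_def simp del: root_iter.simps)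
  have "x \<otimes> q = q \<otimes> x" unfolding q_def using root_iter_commute[OF assms(1) assms(1)] by simp
  then have "q \<otimes> x = x \<otimes> q" by simp
  then have com: "q \<otimes> p = p \<otimes> q"
    unfolding p_def using root_iter_commute[OF assms(1) pq(2)] by blast
  have "?r (Suc (Suc n)) \<ominus> ?r (Suc n) = (1/2) \<odot> (x \<oplus> p \<otimes> p) \<ominus> (1/2) \<odot> (x \<oplus> q \<otimes> q)"
    by (simp add: p_def q_def)
  also have "\<dots> = (1/2) \<odot> ((p \<oplus> q) \<otimes> (p \<ominus> q))"
  proof -
    obtain F where F: "frame x (p \<otimes> p) (q \<otimes> q) (p \<otimes> q) F"
      using frame_exists[of x "p \<otimes> p" "q \<otimes> q" "p \<otimes> q"] pq assms by auto
    show ?thesis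
      using pq assms com by (simp add: mult_diff_right l_distr) (simp add: frameD[OF F])
  qed
  finally have "nrm A (?r (Suc (Suc n)) \<ominus> ?r (Suc n)) = 1/2 * nrm A ((p \<oplus> q) \<otimes> (p \<ominus> q))"
    using pq by (simp add: nrm_smult)
  also have "\<dots> \<le> 1/2 * ((majorant (Suc n) + majorant n) * (majorant (Suc n) - majorant n))"
  proof -
    have "nrm A ((p \<oplus> q) \<otimes> (p \<ominus> q)) \<le> nrm A (p \<oplus> q) * nrm A (p \<ominus> q)"
      using pq by (intro nrm_mult) auto
    also have "\<dots> \<le> (majorant (Suc n) + majorant n) * (majorant (Suc n) - majorant n)"
    proof (rule mult_mono)
      show "nrm A (p \<oplus> q) \<le> majorant (Suc n) + majorant n"
        using nrm_triangle[OF pq] nrm_root_iter[OF assms, of n] nrm_root_iter[OF assms, of "Suc n"]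
        unfolding p_def q_def by linarith
      show "nrm A (p \<ominus> q) \<le> majorant (Suc n) - majorant n"
        using Suc unfolding p_def q_def by blast
      show "0 \<le> majorant (Suc n) + majorant n"
        using majorant_bounds[of n] majorant_bounds[of "Suc n"] by linarith
      show "0 \<le> nrm A (p \<ominus> q)" using pq by (intro nrm_nonneg) auto
    qed
    finally show ?thesis by simp
  qed
  also have "\<dots> = majorant (Suc (Suc n)) - majorant (Suc n)"
    by (simp add: power2_eq_square field_simps)
  finally show ?case .
qed

lemma nrm_root_iter_diff_le:
  assumes "x \<in> carrier A" "nrm A x \<le> 1" "m \<le> n"
  shows "nrm A (root_iter x n \<ominus> root_iter x m) \<le> majorant n - majorant m"
  using assms(3)
proof (induction n rule: dec_induct)
  case base
  then show ?case using root_iter_in[OF assms(1)] by (simp add: M.minus_eq M.r_neg)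
next
  case (step n)
  then show ?case
    using nrm_diff_triangle[of "root_iter x (Suc n)" "root_iter x n" "root_iter x m"]
      nrm_root_iter_diff[OF assms(1,2), of n] root_iter_in[OF assms(1)]
    by (simp del: root_iter.simps majorant.simps)
qed

text \<open>The norm bound on \<open>\<one> \<ominus> k\<close> later says that \<open>k\<close> is
  positive (\<open>psd\<close> with radius 1), and commutation with everything that commutes with
  \<open>x\<close> replaces functional calculus.\<close>

lemma square_root_exists:
  assumes x: "x \<in> herm" "nrm A x \<le> 1"
  obtains k where "k \<in> herm" "k \<otimes> k = \<one> \<ominus> x" "nrm A (\<one> \<ominus> k) \<le> 1"
    "\<And>y. \<lbrakk>y \<in> carrier A; y \<otimes> x = x \<otimes> y\<rbrakk> \<Longrightarrow> y \<otimes> k = k \<otimes> y"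
proof -
  let ?r = "root_iter x"
  have xc: "x \<in> carrier A" using x herm_iff by blast
  note r = root_iter_in[OF xc]
  have "\<exists>N. \<forall>m\<ge>N. \<forall>n\<ge>N. nrm A (?r m \<ominus> ?r n) < e" if "e > 0" for e
  proof -
    obtain N where N: "\<forall>m\<ge>N. \<forall>n\<ge>N. \<bar>majorant m - majorant n\<bar> < e"
      using majorant_Cauchy \<open>e > 0\<close> unfolding Cauchy_def dist_real_def by blast
    have "nrm A (?r m \<ominus> ?r n) < e" if "m \<ge> N" "n \<ge> N" for m n
      using N that nrm_root_iter_diff_le[OF xc x(2), of m n]
        nrm_root_iter_diff_le[OF xc x(2), of n m] nrm_diff_commute[OF r r, of m n]
      by (smt (verit, best) nle_le)
    then show ?thesis by blast
  qed
  then obtain l where l: "l \<in> carrier A" "conv ?r l"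
    using complete_conv[of ?r] r by metis
  have cx: "conv (\<lambda>n. x) x" using xc by (simp add: M.minus_eq M.r_neg)
  have "conv (\<lambda>n. (1/2) \<odot> (x \<oplus> ?r n \<otimes> ?r n)) ((1/2) \<odot> (x \<oplus> l \<otimes> l))"
    using r xc l by (intro conv_smult conv_add conv_mult cx) auto
  moreover have "conv (\<lambda>n. (1/2) \<odot> (x \<oplus> ?r n \<otimes> ?r n)) l"
    using LIMSEQ_Suc[OF l(2)] by simp
  ultimately have eq: "(1/2) \<odot> (x \<oplus> l \<otimes> l) = l"
    using r xc l(1) conv_unique[of "\<lambda>n. (1/2) \<odot> (x \<oplus> ?r n \<otimes> ?r n)"] by auto
  have lh: "l \<in> herm" using conv_herm[OF root_iter_herm[OF x(1)] l] .
  have "nrm A l \<le> 1"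
    using conv_nrm[OF r l] nrm_root_iter[OF xc x(2)] majorant_bounds
    by (intro LIMSEQ_le_const2[of "\<lambda>n. nrm A (?r n)"]) (auto intro: order_trans)
  moreover have "\<one> \<ominus> (\<one> \<ominus> l) = l"
  proof -
    obtain F where F: "frame \<one> l l l F" using frame_exists l(1) by blast
    show ?thesis by (simp add: frameD[OF F])
  qed
  moreover have "(\<one> \<ominus> l) \<otimes> (\<one> \<ominus> l) = \<one> \<ominus> x"
  proof -
    define m where "m = l \<otimes> l"
    have "m \<in> carrier A" using l(1) by (simp add: m_def)
    then obtain F where F: "frame \<one> m x l F"
      using frame_exists[of \<one> m x l] l(1) xc by auto
    have "l = (1/2) \<odot> x \<oplus> (1/2) \<odot> (l \<otimes> l)"
      using eq l(1) xc by (simp add: smult_add_right)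
    then have 2: "2 \<odot> l = x \<oplus> l \<otimes> l" using l(1) xc smult_add_right[of "(1/2) \<odot> x" "(1/2) \<odot> (l \<otimes> l)" 2]
      by simp
    have "(\<one> \<ominus> l) \<otimes> (\<one> \<ominus> l) = (\<one> \<oplus> l \<otimes> l) \<ominus> 2 \<odot> l"
      using l(1) by (simp add: mult_diff_right mult_diff_left flip: m_def) (simp add: frameD[OF F])
    also have "\<dots> = \<one> \<ominus> x"
      unfolding 2 m_def[symmetric] by (simp add: frameD[OF F])
    finally show ?thesis .
  qed
  moreover have "y \<otimes> (\<one> \<ominus> l) = (\<one> \<ominus> l) \<otimes> y" if "y \<in> carrier A" "y \<otimes> x = x \<otimes> y" for y
    using conv_commute[OF r l that(1) root_iter_commute[OF xc that]] that(1) l(1)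
    by (simp add: mult_diff_left mult_diff_right)
  moreover have "\<one> \<ominus> l \<in> herm" using lh by (simp add: herm_diff)
  ultimately show thesis by (intro that[of "\<one> \<ominus> l"]) auto
qed

text \<open>For \<open>u = f \<oplus> \<i> \<odot> g\<close> the product
  \<open>star A u \<otimes> u\<close> is the sum of the two squares, because \<open>f\<close> and
  \<open>g\<close> commute. As \<open>f\<close> is the real part of \<open>u\<close>, its norm is at
  most that of \<open>u\<close>. Most norm estimates for positive elements below come down to
  this.\<close>

lemma nrm_square_le_sum:
  assumes f: "f \<in> herm" and g: "g \<in> herm" and com: "f \<otimes> g = g \<otimes> f"
  shows "(nrm A f)\<^sup>2 \<le> nrm A (f \<otimes> f \<oplus> g \<otimes> g)"
proof -
  note c = hermD[OF f] hermD[OF g]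
  define u where "u = f \<oplus> \<i> \<odot> g"
  have u: "u \<in> carrier A" using c by (simp add: u_def)
  have su: "star A u = f \<oplus> (- \<i>) \<odot> g" using c by (simp add: u_def star_add star_smult)
  obtain G where G: "frame f g g g G" using frame_exists c by blast
  obtain F where F: "frame (f \<otimes> f) (g \<otimes> g) (g \<otimes> f) (g \<otimes> f) F"
    using frame_exists[of "f \<otimes> f" "g \<otimes> g" "g \<otimes> f" "g \<otimes> f"] c by auto
  have "star A u \<otimes> u = f \<otimes> f \<oplus> g \<otimes> g"
    unfolding su unfolding u_def
    using c com by (simp add: l_distr r_distr smult_mult_left smult_mult_right) (simp add: frameD[OF F])
  then have nu: "nrm A (f \<otimes> f \<oplus> g \<otimes> g) = (nrm A u)\<^sup>2"
    using cstar_identity[OF u] by simp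
  have "f = (1/2) \<odot> (u \<oplus> star A u)"
    unfolding su unfolding u_def by (simp add: frameD[OF G])
  then have "nrm A f = 1/2 * nrm A (u \<oplus> star A u)"
    using u by (metis nrm_smult M.a_closed star_closed norm_divide norm_one norm_numeral)
  also have "\<dots> \<le> nrm A u"
    using nrm_triangle[of u "star A u"] u by simp
  finally show ?thesis
    unfolding nu using nrm_nonneg[OF c(1)] by (simp add: power_mono)
qed

text \<open>A square root \<open>k\<close> of \<open>\<one> \<ominus> h \<otimes> h\<close>
  satisfies \<open>k \<otimes> k \<oplus> h \<otimes> h = \<one>\<close>, so
  \<open>nrm_square_le_sum\<close> bounds it.\<close>

lemma nrm_one_minus_square:
  assumes h: "h \<in> herm" "nrm A h \<le> 1"
  shows "nrm A (\<one> \<ominus> h \<otimes> h) \<le> 1"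
proof -
  have "nrm A (h \<otimes> h) \<le> 1" using nrm_square[OF h(1)] h nrm_nonneg[OF hermD(1)]
    by (simp add: power_le_one)
  then obtain k where k: "k \<in> herm" "k \<otimes> k = \<one> \<ominus> h \<otimes> h"
      "\<And>y. \<lbrakk>y \<in> carrier A; y \<otimes> (h \<otimes> h) = (h \<otimes> h) \<otimes> y\<rbrakk> \<Longrightarrow> y \<otimes> k = k \<otimes> y"
    using square_root_exists[OF herm_square[OF h(1)]] by metis
  note c = hermD[OF h(1)] hermD[OF k(1)]
  have hk: "h \<otimes> k = k \<otimes> h"
    using k(3)[of h] c by (simp add: m_assoc)
  obtain F where F: "frame \<one> (h \<otimes> h) \<one> \<one> F" using frame_exists[of \<one> "h \<otimes> h" \<one> \<one>] c by auto
  have "k \<otimes> k \<oplus> h \<otimes> h = \<one>"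
    unfolding k(2) by (simp add: frameD[OF F])
  then have "(nrm A k)\<^sup>2 \<le> 1"
    using nrm_square_le_sum[OF k(1) h(1)] hk nrm_one_le by simp
  then show ?thesis using nrm_square[OF k(1)] k(2) by simp
qed

section \<open>Positive elements\<close>

abbreviation scal :: "real \<Rightarrow> 'a"
  where "scal r \<equiv> complex_of_real r \<odot> \<one>"

lemma scal_herm [simp]: "scal r \<in> herm"
  by (rule herm_smult) simp

lemma scal_in [simp]: "scal r \<in> carrier A"
  by simp

lemma nrm_scal_le: "nrm A (scal r) \<le> \<bar>r\<bar>"
  using nrm_one_le mult_left_mono[of "nrm A \<one>" 1 "\<bar>r\<bar>"] by (simp add: nrm_smult)

lemma scal_mult: "x \<in> carrier A \<Longrightarrow> scal r \<otimes> x = complex_of_real r \<odot> x"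
  "x \<in> carrier A \<Longrightarrow> x \<otimes> scal r = complex_of_real r \<odot> x"
  by (simp_all add: smult_mult_left smult_mult_right)

text \<open>Positivity in terms of the norm: the spectrum of a self-adjoint \<open>x\<close> lies in
  \<open>[0, 2 * R]\<close> exactly when \<open>x\<close> is within \<open>R\<close> of the scalar
  \<open>R\<close>. Such radii add and scale, so the cone properties are immediate; agreement with
  \<open>positive\<close> is \<open>positive_iff_psd\<close>.\<close>

definition psd :: "'a \<Rightarrow> bool"
  where "psd x \<longleftrightarrow> x \<in> herm \<and> (\<exists>R. nrm A (scal R \<ominus> x) \<le> R)"

lemma psdI: "\<lbrakk>x \<in> herm; nrm A (scal R \<ominus> x) \<le> R\<rbrakk> \<Longrightarrow> psd x"
  unfolding psd_def by blast

lemma psd_herm: "psd x \<Longrightarrow> x \<in> herm"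
  by (simp add: psd_def)

lemma psd_in: "psd x \<Longrightarrow> x \<in> carrier A"
  by (simp add: psd_def herm_iff)

lemma psd_scal_diff:
  assumes "x \<in> herm" "nrm A x \<le> c"
  shows "psd (scal c \<ominus> x)"
proof -
  have x: "x \<in> carrier A" using assms herm_iff by blast
  obtain F where F: "frame \<one> x x x F" using frame_exists x by blast
  have "scal c \<ominus> (scal c \<ominus> x) = x" by (simp add: frameD[OF F])
  then show ?thesis using assms herm_diff[OF scal_herm assms(1)] psdI[of "scal c \<ominus> x" c] by simp
qed

lemma psd_scal_add:
  assumes "x \<in> herm" "nrm A x \<le> c"
  shows "psd (x \<oplus> scal c)"
proof -
  have x: "x \<in> carrier A" using assms herm_iff by blast
  have "psd (scal c \<ominus> (\<zero> \<ominus> x))"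
    using assms x nrm_diff_commute[of x \<zero>] by (intro psd_scal_diff herm_diff) (auto simp: M.minus_eq)
  moreover obtain F where F: "frame \<one> x x x F" using frame_exists x by blast
  have "scal c \<ominus> (\<zero> \<ominus> x) = x \<oplus> scal c" by (simp add: frameD[OF F])
  ultimately show ?thesis by simp
qed

lemma psd_add:
  assumes "psd x" "psd y"
  shows "psd (x \<oplus> y)"
proof -
  obtain R S where RS: "nrm A (scal R \<ominus> x) \<le> R" "nrm A (scal S \<ominus> y) \<le> S"
    using assms by (auto simp: psd_def)
  note c = psd_in[OF assms(1)] psd_in[OF assms(2)]
  obtain F where F: "frame \<one> x y y F" using frame_exists c by blast
  have "scal (R + S) \<ominus> (x \<oplus> y) = (scal R \<ominus> x) \<oplus> (scal S \<ominus> y)" by (simp add: frameD[OF F])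
  then have "nrm A (scal (R + S) \<ominus> (x \<oplus> y)) \<le> R + S"
    using nrm_triangle[of "scal R \<ominus> x" "scal S \<ominus> y"] c RS by simp
  then show ?thesis using herm_add[OF assms[THEN psd_herm]] psdI by blast
qed

lemma psd_smult:
  assumes "psd x" "0 \<le> r"
  shows "psd (complex_of_real r \<odot> x)"
proof -
  obtain R where R: "nrm A (scal R \<ominus> x) \<le> R"
    using assms by (auto simp: psd_def)
  obtain F where F: "frame \<one> x x x F" using frame_exists psd_in[OF assms(1)] by blast
  have "scal (r * R) \<ominus> complex_of_real r \<odot> x = complex_of_real r \<odot> (scal R \<ominus> x)"
    by (simp add: frameD[OF F])
  then have "nrm A (scal (r * R) \<ominus> complex_of_real r \<odot> x) \<le> r * R"
    using R assms psd_in[OF assms(1)] by (simp add: nrm_smult mult_left_mono)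
  then show ?thesis using herm_smult[OF psd_herm[OF assms(1)]] psdI by blast
qed

lemma psd_scal: "0 \<le> r \<Longrightarrow> psd (scal r)"
  using psd_scal_diff[OF herm_zero, of r] by (simp add: M.minus_eq)

lemma psd_zero [simp]: "psd \<zero>"
  using psd_scal[of 0] by simp

text \<open>Makes squares \<open>psd\<close> with the explicit radius
  \<open>(nrm A h)\<^sup>2\<close>, on which \<open>psd_nrm\<close> relies. Rescaling
  \<open>h\<close> to norm at most 1 reduces it to \<open>nrm_one_minus_square\<close>.\<close>

lemma nrm_scal_square_diff:
  assumes h: "h \<in> herm"
  shows "nrm A (scal ((nrm A h)\<^sup>2) \<ominus> h \<otimes> h) \<le> (nrm A h)\<^sup>2"
proof (cases "nrm A h = 0")
  case True
  then have "h = \<zero>" using hermD(1)[OF h] nrm_eq_zero_iff by blast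
  then show ?thesis by (simp add: M.minus_eq)
next
  case False
  define r where "r = nrm A h"
  have r: "r > 0" using False nrm_nonneg[OF hermD(1)[OF h]] by (simp add: r_def)
  define g where "g = complex_of_real (1 / r) \<odot> h"
  have g: "g \<in> herm" unfolding g_def by (rule herm_smult[OF h])
  have hc: "h \<in> carrier A" using h hermD by blast
  have ng: "nrm A g \<le> 1" using r hc by (simp add: g_def nrm_smult r_def norm_divide)
  define q where "q = h \<otimes> h"
  have q: "q \<in> carrier A" using hc by (simp add: q_def)
  have gg: "g \<otimes> g = complex_of_real (1 / r\<^sup>2) \<odot> q"
    using hc by (simp add: g_def q_def smult_mult_left smult_mult_right power2_eq_square)
  obtain F where F: "frame \<one> q q q F" using frame_exists q by blast
  have "scal (r\<^sup>2) \<ominus> q = complex_of_real (r\<^sup>2) \<odot> (\<one> \<ominus> g \<otimes> g)"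
    unfolding gg using r by (simp add: frameD[OF F])
  then have "nrm A (scal (r\<^sup>2) \<ominus> q) \<le> r\<^sup>2 * 1"
    using nrm_one_minus_square[OF g ng] hermD(1)[OF g] mult_left_mono[of "nrm A (\<one> \<ominus> g \<otimes> g)" 1 "r\<^sup>2"]
    by (simp add: nrm_smult norm_power)
  then show ?thesis by (simp add: r_def q_def)
qed

lemma psd_square: "h \<in> herm \<Longrightarrow> psd (h \<otimes> h)"
  using nrm_scal_square_diff[of h] herm_square[of h] psdI by blast

text \<open>If \<open>R > 0\<close> is a radius for \<open>x\<close>, then
  \<open>z = (R - x) / R\<close> has norm at most 1 and \<open>x\<close> is \<open>R\<close> times
  \<open>\<one> \<ominus> z\<close>, whose root comes from
  \<open>square_root_exists\<close>.\<close>

lemma psd_square_root: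
  assumes "psd x"
  obtains k where "psd k" "k \<otimes> k = x"
    "\<And>y. \<lbrakk>y \<in> carrier A; y \<otimes> x = x \<otimes> y\<rbrakk> \<Longrightarrow> y \<otimes> k = k \<otimes> y"
proof -
  obtain R where R: "nrm A (scal R \<ominus> x) \<le> R" and xh: "x \<in> herm"
    using assms by (auto simp: psd_def)
  have x: "x \<in> carrier A" using xh hermD by blast
  have R0: "0 \<le> R" using R nrm_nonneg[of "scal R \<ominus> x"] x by simp
  show thesis
  proof (cases "R = 0")
    case True
    then have "nrm A (\<zero> \<ominus> x) = 0" using R nrm_nonneg[of "\<zero> \<ominus> x"] x by simp
    then have "x = \<zero>" using eq_iff_nrm_diff[of \<zero> x] x by simp
    then show ?thesis by (intro that[of \<zero>]) auto
  next
    case False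
    then have R: "R > 0" "nrm A (scal R \<ominus> x) \<le> R" using R0 R by auto
    obtain F where F: "frame \<one> x x x F" using frame_exists x by blast
    define z where "z = complex_of_real (1 / R) \<odot> (scal R \<ominus> x)"
    have zh: "z \<in> herm" unfolding z_def by (intro herm_smult herm_diff scal_herm xh)
    have "nrm A z \<le> 1" using R x by (simp add: z_def nrm_smult norm_divide)
    then obtain k where k: "k \<in> herm" "k \<otimes> k = \<one> \<ominus> z" "nrm A (\<one> \<ominus> k) \<le> 1"
      "\<And>y. \<lbrakk>y \<in> carrier A; y \<otimes> z = z \<otimes> y\<rbrakk> \<Longrightarrow> y \<otimes> k = k \<otimes> y"
      using square_root_exists[OF zh] by metis
    have kc: "k \<in> carrier A" using k hermD by blast
    have "psd k" using k(1,3) psdI[of k 1] kc by simp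
    then have p: "psd (complex_of_real (sqrt R) \<odot> k)" using psd_smult R by simp
    have "\<one> \<ominus> z = complex_of_real (1 / R) \<odot> x"
      unfolding z_def using R by (simp add: frameD[OF F])
    then have s: "(complex_of_real (sqrt R) \<odot> k) \<otimes> (complex_of_real (sqrt R) \<odot> k) = x"
      using kc k(2) R x by (simp add: smult_mult_left smult_mult_right flip: of_real_mult)
    have "y \<otimes> k = k \<otimes> y" if y: "y \<in> carrier A" "y \<otimes> x = x \<otimes> y" for y
      using y x by (intro k(4)) (simp_all add: z_def mult_diff_left mult_diff_right
          smult_mult_left smult_mult_right)
    then have "y \<otimes> (complex_of_real (sqrt R) \<odot> k) = (complex_of_real (sqrt R) \<odot> k) \<otimes> y"
      if y: "y \<in> carrier A" "y \<otimes> x = x \<otimes> y" for y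
      using y kc by (simp add: smult_mult_left smult_mult_right)
    with p s show ?thesis using that by blast
  qed
qed

text \<open>Write \<open>x\<close> as \<open>k \<otimes> k\<close> and use the radius
  \<open>(nrm A k)\<^sup>2 = nrm A x\<close>; the radius in \<open>psd\<close> is arbitrary and may
  be much larger.\<close>

lemma psd_nrm:
  assumes "psd x"
  shows "nrm A (scal (nrm A x) \<ominus> x) \<le> nrm A x"
proof -
  obtain k where k: "psd k" "k \<otimes> k = x" using psd_square_root[OF assms] by metis
  then show ?thesis
    using nrm_scal_square_diff[of k] nrm_square[of k] psd_herm by auto
qed

lemma nrm_psd_le_sum:
  assumes f: "f \<in> herm" and x: "psd x" and com: "f \<otimes> x = x \<otimes> f"
  shows "(nrm A f)\<^sup>2 \<le> nrm A (f \<otimes> f \<oplus> x)"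
proof -
  obtain k where k: "psd k" "k \<otimes> k = x" "f \<otimes> k = k \<otimes> f"
    using psd_square_root[OF x] com f hermD(1) by metis
  then show ?thesis using nrm_square_le_sum[OF f psd_herm[OF k(1)]] by simp
qed

text \<open>The cone contains no line: with \<open>x = k \<otimes> k\<close> and
  \<open>y = \<ominus> x\<close>, which commutes with \<open>k\<close>, the squared norm of
  \<open>k\<close> is bounded by the norm of the zero sum.\<close>

lemma psd_sum_zero:
  assumes "psd x" "psd y" "x \<oplus> y = \<zero>"
  shows "x = \<zero>"
proof -
  obtain k where k: "psd k" "k \<otimes> k = x" using psd_square_root[OF assms(1)] by metis
  note c = psd_in[OF k(1)] psd_in[OF assms(1)] psd_in[OF assms(2)]
  have "y = \<ominus> x" using M.minus_equality[of y x] assms(3) c by (simp add: M.a_comm)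
  then have "k \<otimes> y = y \<otimes> k" using c k(2) by (metis m_assoc l_minus r_minus)
  from nrm_psd_le_sum[OF psd_herm[OF k(1)] assms(2) this]
  have "nrm A k = 0" using assms(3) k(2) by simp
  then show ?thesis using k c nrm_eq_zero_iff[of k] by simp
qed

text \<open>The root of \<open>x\<close> commutes with \<open>scal c \<ominus> x\<close>, so
  \<open>nrm_psd_le_sum\<close> compares \<open>x\<close> with the sum
  \<open>scal c\<close>.\<close>

lemma nrm_le_of_psd:
  assumes "psd x" "psd (scal c \<ominus> x)"
  shows "nrm A x \<le> \<bar>c\<bar>"
proof -
  obtain k where k: "psd k" "k \<otimes> k = x" using psd_square_root[OF assms(1)] by metis
  note c = psd_in[OF k(1)] psd_in[OF assms(1)]
  have "k \<otimes> (scal c \<ominus> x) = (scal c \<ominus> x) \<otimes> k"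
    using c k(2) m_assoc[of k k k] by (simp add: mult_diff_left mult_diff_right scal_mult)
  from nrm_psd_le_sum[OF psd_herm[OF k(1)] assms(2) this]
  have "nrm A x \<le> nrm A (x \<oplus> (scal c \<ominus> x))" using k nrm_square[OF psd_herm[OF k(1)]] by simp
  moreover obtain F where F: "frame \<one> x x x F" using frame_exists c by blast
  have "x \<oplus> (scal c \<ominus> x) = scal c" by (simp add: frameD[OF F])
  ultimately show ?thesis using nrm_scal_le[of c] by simp
qed

lemma psd_scalD:
  assumes "\<one> \<noteq> \<zero>" "psd (scal c)"
  shows "0 \<le> c"
proof (rule ccontr)
  assume "\<not> 0 \<le> c"
  then have "psd (scal (- c))" by (intro psd_scal) simp
  moreover have "scal c \<oplus> scal (- c) = \<zero>" using smult_add_left[of \<one> c "-c"] by simp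
  ultimately have "scal c = \<zero>" using psd_sum_zero[OF assms(2)] by blast
  then have "cmod c * nrm A \<one> = 0" using nrm_smult[of \<one> c] by simp
  then show False using nrm_one[OF assms(1)] \<open>\<not> 0 \<le> c\<close> by simp
qed

text \<open>The roots \<open>f\<close> and \<open>g\<close> of the two positive elements commute
  with each other and with \<open>x\<close>, and the square of \<open>f \<otimes> g\<close> is
  \<open>c\<^sup>2 - x\<^sup>2\<close>. So \<open>x \<otimes> x\<close> and a commuting square add
  up to a scalar.\<close>

lemma nrm_le_of_psd_diff_add:
  assumes x: "x \<in> herm" and "psd (scal c \<ominus> x)" "psd (scal c \<oplus> x)"
  shows "nrm A x \<le> \<bar>c\<bar>"
proof -
  have xc: "x \<in> carrier A" using x hermD by blast
  obtain f where f: "psd f" "f \<otimes> f = scal c \<ominus> x"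
    "\<And>y. \<lbrakk>y \<in> carrier A; y \<otimes> (scal c \<ominus> x) = (scal c \<ominus> x) \<otimes> y\<rbrakk> \<Longrightarrow> y \<otimes> f = f \<otimes> y"
    using psd_square_root[OF assms(2)] by metis
  obtain g where g: "psd g" "g \<otimes> g = scal c \<oplus> x"
    "\<And>y. \<lbrakk>y \<in> carrier A; y \<otimes> (scal c \<oplus> x) = (scal c \<oplus> x) \<otimes> y\<rbrakk> \<Longrightarrow> y \<otimes> g = g \<otimes> y"
    using psd_square_root[OF assms(3)] by metis
  note c = psd_in[OF f(1)] psd_in[OF g(1)] xc
  have xf: "x \<otimes> f = f \<otimes> x"
    using xc by (intro f(3)) (simp_all add: mult_diff_left mult_diff_right scal_mult)
  have xg: "x \<otimes> g = g \<otimes> x"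
    using xc by (intro g(3)) (simp_all add: l_distr r_distr scal_mult)
  have fg: "f \<otimes> g = g \<otimes> f"
    using c xf by (intro g(3)) (simp_all add: l_distr r_distr scal_mult)
  define q where "q = x \<otimes> x"
  have q: "q \<in> carrier A" using xc by (simp add: q_def)
  have "(f \<otimes> g) \<otimes> (f \<otimes> g) = (f \<otimes> f) \<otimes> (g \<otimes> g)"
    using c fg by (metis m_assoc m_closed)
  also have "\<dots> = (scal c \<ominus> x) \<otimes> scal c \<oplus> (scal c \<ominus> x) \<otimes> x"
    unfolding f g using xc by (simp add: r_distr)
  also have "\<dots> = complex_of_real c \<odot> (scal c \<ominus> x) \<oplus> (complex_of_real c \<odot> x \<ominus> q)"
    using xc by (simp add: q_def mult_diff_left scal_mult)
  finally have e: "(f \<otimes> g) \<otimes> (f \<otimes> g) = complex_of_real c \<odot> (scal c \<ominus> x) \<oplus> (complex_of_real c \<odot> x \<ominus> q)" .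
  obtain F where F: "frame \<one> x q q F" using frame_exists xc q by blast
  have "x \<otimes> x \<oplus> (f \<otimes> g) \<otimes> (f \<otimes> g) = scal (c\<^sup>2)"
    unfolding e q_def[symmetric] by (simp add: frameD[OF F] power2_eq_square)
  moreover have "f \<otimes> g \<in> herm" using f g fg herm_mult psd_herm by blast
  moreover have "x \<otimes> (f \<otimes> g) = (f \<otimes> g) \<otimes> x" using xf xg c by (metis m_assoc)
  ultimately have "(nrm A x)\<^sup>2 \<le> c\<^sup>2"
    using nrm_square_le_sum[OF x, of "f \<otimes> g"] nrm_scal_le[of "c\<^sup>2"] by simp
  then show ?thesis using abs_le_square_iff[of "nrm A x" c] nrm_nonneg[OF xc] by simp
qed

text \<open>For \<open>z = m y*\<close> one has \<open>z* z = - (y y*)\<^sup>2\<close> and \<open>z z* = - m\<^sup>4\<close>, whereas \<open>z z* + z* z\<close> is always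
  a sum of two squares. So a sum of squares that includes \<open>m\<^sup>4\<close> vanishes.\<close>

lemma star_mult_neg_square:
  assumes y: "y \<in> carrier A" and m: "m \<in> herm" and eq: "star A y \<otimes> y = \<ominus> (m \<otimes> m)"
  shows "m = \<zero>"
proof -
  define s where "s = star A y"
  have s: "s \<in> carrier A" "star A s = y" "star A y = s" using y by (simp_all add: s_def)
  note c = y s hermD[OF m]
  define w where "w = y \<otimes> s"
  define z where "z = m \<otimes> s"
  define z' where "z' = y \<otimes> m"
  define p where "p = z' \<otimes> z"
  define q where "q = z \<otimes> z'"
  have z: "z \<in> carrier A" "z' \<in> carrier A" "star A z = z'" "star A z' = z" using c
    by (simp_all add: z_def z'_def star_mult)
  have wh: "w \<in> herm" "m \<otimes> m \<in> herm"
    using c m herm_square by (simp_all add: w_def herm_iff star_mult)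
  have eq': "s \<otimes> y = \<ominus> (m \<otimes> m)" using eq by (simp add: s_def)
  have mm: "m \<otimes> m = \<ominus> (s \<otimes> y)" using c unfolding eq' by simp
  have pp: "p = \<ominus> (w \<otimes> w)"
  proof -
    have "p = y \<otimes> (m \<otimes> m) \<otimes> s" using c by (simp add: p_def z_def z'_def m_assoc)
    then show ?thesis unfolding mm using c by (simp add: w_def l_minus r_minus m_assoc)
  qed
  have qq: "q = \<ominus> ((m \<otimes> m) \<otimes> (m \<otimes> m))"
  proof -
    have "q = m \<otimes> (s \<otimes> y) \<otimes> m" using c by (simp add: q_def z_def z'_def m_assoc)
    then show ?thesis unfolding eq' using c by (simp add: l_minus r_minus m_assoc)
  qed
  \<comment> \<open>Up to the factors 2 and -2 these are the real and imaginary parts of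
    \<open>z\<close>; the terms \<open>z \<otimes> z\<close> and \<open>z' \<otimes> z'\<close>
    cancel in the sum of their squares.\<close>
  define u where "u = z \<oplus> z'"
  define v where "v = \<i> \<odot> (z \<ominus> z')"
  obtain F0 where F0: "frame z z' z z' F0" using frame_exists z by blast
  have uh: "u \<in> herm" using z by (simp add: u_def herm_iff star_add M.a_comm)
  have vh: "v \<in> herm"
  proof -
    have "star A v = (- \<i>) \<odot> (z' \<ominus> z)" using z by (simp add: v_def star_smult star_diff)
    also have "\<dots> = v" by (simp add: v_def frameD[OF F0])
    finally show ?thesis using z by (simp add: v_def herm_iff)
  qed
  define a where "a = z \<otimes> z"
  define b where "b = z' \<otimes> z'"
  have ab: "a \<in> carrier A" "b \<in> carrier A" "p \<in> carrier A" "q \<in> carrier A"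
    using z by (simp_all add: a_def b_def p_def q_def)
  obtain F where F: "frame a b p q F" using frame_exists ab by blast
  have "u \<otimes> u = (a \<oplus> q) \<oplus> (p \<oplus> b)"
    using z by (simp add: u_def a_def b_def p_def q_def l_distr r_distr M.a_ac)
  moreover have "v \<otimes> v = \<i> \<odot> (\<i> \<odot> (a \<ominus> p) \<ominus> \<i> \<odot> (q \<ominus> b))"
    using z by (simp add: v_def a_def b_def p_def q_def mult_diff_left mult_diff_right
        smult_mult_left smult_mult_right)
  ultimately have uv: "u \<otimes> u \<oplus> v \<otimes> v = 2 \<odot> (p \<oplus> q)"
    by (simp add: frameD[OF F])
  define W where "W = w \<otimes> w"
  define X where "X = (m \<otimes> m) \<otimes> (m \<otimes> m)"
  define Q where "Q = u \<otimes> u \<oplus> v \<otimes> v"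
  have psd: "psd W" "psd X" "psd Q"
    unfolding W_def X_def Q_def by (intro psd_add psd_square wh uh vh)+
  obtain G where G: "frame W X Q Q G" using frame_exists psd[THEN psd_in] by blast
  have Q2: "Q = 2 \<odot> (\<ominus> W \<oplus> \<ominus> X)"
    using uv unfolding pp qq by (simp add: Q_def W_def X_def)
  obtain G where G: "frame W X X X G" using frame_exists psd[THEN psd_in] by blast
  \<comment> \<open>Half of \<open>Q\<close> equals \<open>\<ominus> W \<oplus> \<ominus> X\<close>,
    so three positive elements add up to zero.\<close>
  have "X \<oplus> (W \<oplus> complex_of_real (1/2) \<odot> Q) = \<zero>"
    unfolding Q2 by (simp add: frameD[OF G])
  then have "X = \<zero>"
    using psd_sum_zero[OF psd(2)] psd_add[OF psd(1) psd_smult[OF psd(3), of "1/2"]] by simp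
  then have "((nrm A m)\<^sup>2)\<^sup>2 = 0"
    using nrm_square[OF wh(2)] nrm_square[OF m] by (simp add: X_def)
  then show ?thesis using nrm_eq_zero_iff[of m] c by simp
qed

text \<open>With \<open>h = y* y\<close>, \<open>a = \<bar>h\<bar>\<close> and \<open>d = a - h\<close>, which is twice the negative part of \<open>h\<close>,
  the element \<open>y d\<close> satisfies \<open>(y d)* (y d) = d h d = - a d\<^sup>2\<close>, a negative square.\<close>

lemma psd_star_mult:
  assumes y: "y \<in> carrier A"
  shows "psd (star A y \<otimes> y)"
proof -
  define h where "h = star A y \<otimes> y"
  have hh: "h \<in> herm" unfolding h_def by (rule herm_star_mult[OF y])
  obtain a where a: "psd a" "a \<otimes> a = h \<otimes> h"
    "\<And>x. \<lbrakk>x \<in> carrier A; x \<otimes> (h \<otimes> h) = (h \<otimes> h) \<otimes> x\<rbrakk> \<Longrightarrow> x \<otimes> a = a \<otimes> x"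
    using psd_square_root[OF psd_square[OF hh]] by metis
  obtain l where l: "psd l" "l \<otimes> l = a"
    "\<And>x. \<lbrakk>x \<in> carrier A; x \<otimes> a = a \<otimes> x\<rbrakk> \<Longrightarrow> x \<otimes> l = l \<otimes> x"
    using psd_square_root[OF a(1)] by metis
  note c = y hermD(1)[OF hh] psd_in[OF a(1)] psd_in[OF l(1)]
  have ha: "h \<otimes> a = a \<otimes> h" using c by (intro a(3)) (simp_all add: m_assoc)
  define d where "d = a \<ominus> h"
  have dh: "d \<in> herm" unfolding d_def by (intro herm_diff psd_herm a(1) hh)
  have dc: "d \<in> carrier A" using dh hermD by blast
  have da: "d \<otimes> a = a \<otimes> d" "h \<otimes> d = d \<otimes> h" using c ha
    by (simp_all add: d_def mult_diff_left mult_diff_right)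
  have dl: "d \<otimes> l = l \<otimes> d" by (intro l(3) dc da)
  \<comment> \<open>The product is \<open>a \<otimes> a \<ominus> h \<otimes> h\<close>, as
    \<open>a\<close> and \<open>h\<close> commute.\<close>
  have "(a \<oplus> h) \<otimes> d = \<zero>"
    using c a(2) ha by (simp add: d_def l_distr mult_diff_right) (simp add: M.minus_eq M.r_neg M.a_ac M.r_neg1 M.r_neg2)
  then have hd: "h \<otimes> d = \<ominus> (a \<otimes> d)"
    using c dc M.minus_equality[of "h \<otimes> d" "a \<otimes> d"] by (simp add: l_distr M.a_comm)
  have m: "l \<otimes> d \<in> herm" using dl by (intro herm_mult psd_herm l(1) dh) simp
  have mm: "(l \<otimes> d) \<otimes> (l \<otimes> d) = a \<otimes> d \<otimes> d"
    using c dc dl l(2) by (metis m_assoc m_closed)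
  have "star A (y \<otimes> d) \<otimes> (y \<otimes> d) = d \<otimes> h \<otimes> d"
    using c dc hermD(2)[OF dh] by (simp add: star_mult h_def m_assoc)
  also have "\<dots> = h \<otimes> d \<otimes> d" using da by simp
  also have "\<dots> = \<ominus> ((l \<otimes> d) \<otimes> (l \<otimes> d))" unfolding hd mm using c dc by (simp add: l_minus)
  finally have "l \<otimes> d = \<zero>" using star_mult_neg_square[of "y \<otimes> d", OF _ m] c dc by simp
  \<comment> \<open>Both parts of the cube of \<open>d = a \<ominus> h\<close> vanish, and a
    self-adjoint nilpotent element is zero by the C*-identity.\<close>
  then have "a \<otimes> d \<otimes> d = \<zero>" using mm dc by simp
  moreover have "h \<otimes> d \<otimes> d = \<ominus> (a \<otimes> d \<otimes> d)" unfolding hd using c dc by (simp add: l_minus)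
  moreover have "d \<otimes> d \<otimes> d = a \<otimes> d \<otimes> d \<ominus> h \<otimes> d \<otimes> d"
    using c dc by (subst (1) d_def) (simp add: mult_diff_left)
  ultimately have "d \<otimes> d \<otimes> d = \<zero>" by (simp add: M.minus_eq)
  then have "(d \<otimes> d) \<otimes> (d \<otimes> d) = \<zero>" using dc by (simp flip: m_assoc)
  then have "((nrm A d)\<^sup>2)\<^sup>2 = 0" using nrm_square[OF herm_square[OF dh]] nrm_square[OF dh] by simp
  then have "d = \<zero>" using nrm_eq_zero_iff[OF dc] by simp
  then have "nrm A (a \<ominus> h) = 0" by (simp add: d_def)
  then have "a = h" using eq_iff_nrm_diff c by blast
  then show ?thesis using a(1) by (simp add: h_def)
qed

lemma positive_iff_psd: "positive A x \<longleftrightarrow> psd x"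
proof
  assume "psd x"
  then obtain k where "psd k" "k \<otimes> k = x" using psd_square_root by metis
  then show "positive A x"
    using psd_in[of k] hermD(2)[OF psd_herm, of k] unfolding positive_def by metis
qed (auto simp: positive_def psd_star_mult)

text \<open>This is the largest value of a state at a self-adjoint \<open>x\<close>; see \<open>state_le_upper\<close> and
  \<open>state_attains_upper\<close> below.\<close>

definition upper :: "'a \<Rightarrow> real"
  where "upper x = nrm A (x \<oplus> scal (nrm A x)) - nrm A x"

text \<open>Adding a scalar \<open>s \<ge> 0\<close> to a positive element raises its norm by
  exactly \<open>s\<close>, so every shift \<open>M\<close> above the norm gives the same value. Two
  fibres can therefore use one common shift, and their values of \<open>upper\<close> are compared
  through norms.\<close>

lemma upper_eq:
  assumes nz: "\<one> \<noteq> \<zero>" and x: "x \<in> herm" and M: "nrm A x \<le> M"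
  shows "upper x = nrm A (x \<oplus> scal M) - M"
proof -
  have xc: "x \<in> carrier A" using x hermD by blast
  obtain F where F: "frame \<one> x x x F" using frame_exists xc by blast
  define y where "y = x \<oplus> scal (nrm A x)"
  define s where "s = M - nrm A x"
  define c where "c = nrm A (x \<oplus> scal M)"
  have y: "psd y" unfolding y_def by (rule psd_scal_add[OF x]) simp
  have e: "x \<oplus> scal M = y \<oplus> scal s" by (simp add: y_def s_def frameD[OF F])
  have "c \<le> nrm A y + s"
    using nrm_triangle[of y "scal s"] nrm_scal_le[of s] psd_in[OF y] M
    by (simp add: c_def e s_def)
  moreover have "nrm A y \<le> c - s"
  proof -
    have "psd (scal c \<ominus> (x \<oplus> scal M))"
      by (rule psd_scal_diff) (simp_all add: c_def herm_add x)
    moreover have "scal c \<ominus> (x \<oplus> scal M) = scal (c - s) \<ominus> y"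
      by (simp add: y_def s_def frameD[OF F])
    ultimately have p: "psd (scal (c - s) \<ominus> y)" by simp
    have "y \<oplus> (scal (c - s) \<ominus> y) = scal (c - s)"
      by (simp add: y_def frameD[OF F])
    then have "psd (scal (c - s))" using psd_add[OF y p] by simp
    then have "0 \<le> c - s" by (rule psd_scalD[OF nz])
    then show ?thesis using nrm_le_of_psd[OF y p] by simp
  qed
  ultimately show ?thesis by (simp add: upper_def y_def s_def c_def)
qed

text \<open>With the shift \<open>nrm A x + nrm A y\<close>, permitted by \<open>upper_eq\<close>,
  this is the triangle inequality.\<close>

lemma upper_add:
  assumes nz: "\<one> \<noteq> \<zero>" and x: "x \<in> herm" and y: "y \<in> herm"
  shows "upper (x \<oplus> y) \<le> upper x + upper y"
proof -
  note c = hermD(1)[OF x] hermD(1)[OF y]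
  obtain F where F: "frame \<one> x y y F" using frame_exists c by blast
  have "(x \<oplus> y) \<oplus> scal (nrm A x + nrm A y) = (x \<oplus> scal (nrm A x)) \<oplus> (y \<oplus> scal (nrm A y))"
    by (simp add: frameD(1-4,6-10)[OF F])
  then have "nrm A ((x \<oplus> y) \<oplus> scal (nrm A x + nrm A y)) \<le> nrm A (x \<oplus> scal (nrm A x)) + nrm A (y \<oplus> scal (nrm A y))"
    using nrm_triangle[of "x \<oplus> scal (nrm A x)" "y \<oplus> scal (nrm A y)"] c by simp
  then show ?thesis
    using upper_eq[OF nz herm_add[OF x y] nrm_triangle[OF c]] by (simp add: upper_def)
qed

lemma upper_smult:
  assumes x: "x \<in> herm" and "0 \<le> r"
  shows "upper (complex_of_real r \<odot> x) = r * upper x"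
proof -
  have c: "x \<in> carrier A" using x hermD by blast
  have n: "nrm A (complex_of_real r \<odot> x) = r * nrm A x" using c assms(2) by (simp add: nrm_smult)
  have "complex_of_real r \<odot> x \<oplus> scal (r * nrm A x) = complex_of_real r \<odot> (x \<oplus> scal (nrm A x))"
    using c by (simp add: smult_add_right)
  then show ?thesis
    unfolding upper_def n using c assms(2) nrm_smult[of "x \<oplus> scal (nrm A x)" r] by (simp add: algebra_simps)
qed

lemma upper_scal:
  assumes "\<one> \<noteq> \<zero>"
  shows "upper (scal r) = r"
proof -
  have e: "scal r \<oplus> scal \<bar>r\<bar> = scal (r + \<bar>r\<bar>)" by (simp add: smult_add_left)
  have n: "nrm A (scal s) = \<bar>s\<bar>" for s using nrm_one[OF assms] by (simp add: nrm_smult)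
  show ?thesis unfolding upper_def n e n by simp
qed

lemma upper_le_nrm:
  assumes "\<one> \<noteq> \<zero>" "x \<in> herm"
  shows "upper x \<le> nrm A x"
  using nrm_triangle[of x "scal (nrm A x)"] nrm_scal_le[of "nrm A x"] hermD(1)[OF assms(2)] nrm_nonneg[of x]
  by (simp add: upper_def)

lemma upper_minus_psd:
  assumes "psd x"
  shows "upper (\<ominus> x) \<le> 0"
proof -
  have "\<ominus> x \<oplus> scal (nrm A x) = scal (nrm A x) \<ominus> x"
    using psd_in[OF assms] by (simp add: M.minus_eq M.a_comm)
  then show ?thesis
    using psd_nrm[OF assms] psd_in[OF assms] by (simp add: upper_def)
qed

lemma psd_upper_diff:
  assumes x: "x \<in> herm"
  shows "psd (scal (upper x) \<ominus> x)"
proof -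
  have c: "x \<in> carrier A" using x hermD by blast
  obtain F where F: "frame \<one> x x x F" using frame_exists c by blast
  have "psd (scal (nrm A (x \<oplus> scal (nrm A x))) \<ominus> (x \<oplus> scal (nrm A x)))"
    by (rule psd_scal_diff) (simp_all add: herm_add x)
  moreover define r where "r = nrm A (x \<oplus> scal (nrm A x))"
  moreover define t where "t = nrm A x"
  moreover have "scal r \<ominus> (x \<oplus> scal t) = scal (r - t) \<ominus> x"
    by (simp add: frameD[OF F])
  ultimately show ?thesis by (simp add: upper_def)
qed

text \<open>The hypotheses place \<open>x\<close> between \<open>- c\<close> and \<open>c\<close> in
  the order, and \<open>nrm_le_of_psd_diff_add\<close> turns this into a norm bound. That
  \<open>c\<close> is nonnegative follows because the two positive differences add up to
  \<open>2 * c\<close>.\<close>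

lemma nrm_le_upper:
  assumes nz: "\<one> \<noteq> \<zero>" and x: "x \<in> herm" and "upper x \<le> c" "upper (\<ominus> x) \<le> c"
  shows "nrm A x \<le> c"
proof -
  have c: "x \<in> carrier A" using x hermD by blast
  have mx: "\<ominus> x \<in> herm" using herm_smult[OF x, of "-1"] c by (simp add: a_inv_smult)
  obtain F where F: "frame \<one> x x x F" using frame_exists c by blast
  have e1: "scal c \<ominus> x = scal (c - upper x) \<oplus> (scal (upper x) \<ominus> x)"
    by (simp add: frameD[OF F])
  have 1: "psd (scal c \<ominus> x)"
    unfolding e1 by (intro psd_add psd_scal psd_upper_diff x) (use assms(3) in simp)
  have e2: "scal c \<oplus> x = scal (c - upper (\<ominus> x)) \<oplus> (scal (upper (\<ominus> x)) \<ominus> \<ominus> x)"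
    by (simp add: frameD[OF F])
  have 2: "psd (scal c \<oplus> x)"
    unfolding e2 by (intro psd_add psd_scal psd_upper_diff mx) (use assms(4) in simp)
  have "(scal c \<ominus> x) \<oplus> (scal c \<oplus> x) = scal (2 * c)"
    by (simp add: frameD[OF F])
  then have "0 \<le> 2 * c" using psd_add[OF 1 2] psd_scalD[OF nz, of "2 * c"] by simp
  then show ?thesis using nrm_le_of_psd_diff_add[OF x 1 2] by simp
qed

end

section \<open>A Hahn-Banach theorem with cone constraints\<close>

context unital_cstar_algebra
begin

definition real_subspace :: "'a set \<Rightarrow> bool"
  where "real_subspace S \<longleftrightarrow> S \<subseteq> carrier A \<and> \<zero> \<in> S \<and> (\<forall>x\<in>S. \<forall>y\<in>S. x \<oplus> y \<in> S) \<and>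
    (\<forall>r. \<forall>x\<in>S. complex_of_real r \<odot> x \<in> S)"

lemma real_subspaceD:
  assumes "real_subspace S"
  shows "\<zero> \<in> S" "x \<in> S \<Longrightarrow> x \<in> carrier A" "\<lbrakk>x \<in> S; y \<in> S\<rbrakk> \<Longrightarrow> x \<oplus> y \<in> S"
    "x \<in> S \<Longrightarrow> complex_of_real r \<odot> x \<in> S" "x \<in> S \<Longrightarrow> \<ominus> x \<in> S" "\<lbrakk>x \<in> S; y \<in> S\<rbrakk> \<Longrightarrow> x \<ominus> y \<in> S"
proof -
  show *: "\<zero> \<in> S" "x \<in> S \<Longrightarrow> x \<in> carrier A" "\<lbrakk>x \<in> S; y \<in> S\<rbrakk> \<Longrightarrow> x \<oplus> y \<in> S"
    "x \<in> S \<Longrightarrow> complex_of_real r \<odot> x \<in> S" for x y r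
    using assms unfolding real_subspace_def by blast+
  show m: "x \<in> S \<Longrightarrow> \<ominus> x \<in> S" for x
    using *(4)[of x "-1"] *(2)[of x] by (simp add: a_inv_smult)
  show "\<lbrakk>x \<in> S; y \<in> S\<rbrakk> \<Longrightarrow> x \<ominus> y \<in> S"
    using *(3)[of x "\<ominus> y"] m by (simp add: M.minus_eq)
qed

definition sublinear_on :: "'a set \<Rightarrow> ('a \<Rightarrow> real) \<Rightarrow> bool"
  where "sublinear_on S p \<longleftrightarrow> (\<forall>x\<in>S. \<forall>y\<in>S. p (x \<oplus> y) \<le> p x + p y) \<and>
    (\<forall>r\<ge>0. \<forall>x\<in>S. p (complex_of_real r \<odot> x) = r * p x)"

definition linear_on :: "'a set \<Rightarrow> ('a \<Rightarrow> real) \<Rightarrow> bool"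
  where "linear_on S f \<longleftrightarrow> (\<forall>x\<in>S. \<forall>y\<in>S. f (x \<oplus> y) = f x + f y) \<and>
    (\<forall>r. \<forall>x\<in>S. f (complex_of_real r \<odot> x) = r * f x)"

text \<open>A pair \<open>(x, s)\<close> in a cone stands for the constraint \<open>f x \<le> s\<close> on a functional \<open>f\<close>.\<close>

definition convex_cone :: "'a set \<Rightarrow> ('a \<times> real) set \<Rightarrow> bool"
  where "convex_cone S G \<longleftrightarrow> G \<subseteq> S \<times> UNIV \<and> (\<zero>, 0) \<in> G \<and>
    (\<forall>x s y t. (x, s) \<in> G \<longrightarrow> (y, t) \<in> G \<longrightarrow> (x \<oplus> y, s + t) \<in> G) \<and>
    (\<forall>r>0. \<forall>x s. (x, s) \<in> G \<longrightarrow> (complex_of_real r \<odot> x, r * s) \<in> G)"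

lemma sublinear_on_zero:
  assumes "real_subspace S" "sublinear_on S p"
  shows "p \<zero> = 0"
proof -
  have "p (complex_of_real 0 \<odot> \<zero>) = 0 * p \<zero>"
    using assms(2) real_subspaceD(1)[OF assms(1)] unfolding sublinear_on_def by blast
  then show ?thesis by simp
qed

lemma sublinear_on_minus:
  assumes S: "real_subspace S" and p: "sublinear_on S p" and x: "x \<in> S"
  shows "- p (\<ominus> x) \<le> p x"
proof -
  have "p (x \<oplus> \<ominus> x) \<le> p x + p (\<ominus> x)"
    using p x real_subspaceD(5)[OF S x] unfolding sublinear_on_def by blast
  then show ?thesis
    using sublinear_on_zero[OF S p] real_subspaceD(2)[OF S x] by (simp add: M.r_neg)
qed

text \<open>The infimal convolution of \<open>p\<close> with the constraints is the greatest
  sublinear functional that is below \<open>p\<close> and meets them. \<open>bound\<close> is the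
  compatibility condition: any linear solution forces it, and it keeps the infimum finite.\<close>

lemma sublinear_inf_convolution:
  assumes S: "real_subspace S" and p: "sublinear_on S p" and G: "convex_cone S G"
    and bound: "\<And>x s. (x, s) \<in> G \<Longrightarrow> 0 \<le> p (\<ominus> x) + s"
  obtains q where "sublinear_on S q" "\<And>x. x \<in> S \<Longrightarrow> q x \<le> p x" "\<And>x s. (x, s) \<in> G \<Longrightarrow> q x \<le> s"
proof -
  define q where "q y = (INF (x, s)\<in>G. p (y \<ominus> x) + s)" for y
  note Sc = real_subspaceD[OF S]
  have padd: "p (x \<oplus> y) \<le> p x + p y" if "x \<in> S" "y \<in> S" for x y
    using p that unfolding sublinear_on_def by blast
  have pmul: "p (complex_of_real r \<odot> x) = r * p x" if "x \<in> S" "0 \<le> r" for x r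
    using p that unfolding sublinear_on_def by blast
  have p0: "p \<zero> = 0" by (rule sublinear_on_zero[OF S p])
  have GS: "x \<in> S" if "(x, s) \<in> G" for x s
    using G that unfolding convex_cone_def by blast
  have G0: "(\<zero>, 0) \<in> G" using G unfolding convex_cone_def by blast
  have Gadd: "(x \<oplus> y, s + t) \<in> G" if "(x, s) \<in> G" "(y, t) \<in> G" for x y s t
    using G that unfolding convex_cone_def by blast
  have Gmul: "(complex_of_real r \<odot> x, r * s) \<in> G" if "(x, s) \<in> G" "0 < r" for x s r
    using G that unfolding convex_cone_def by blast
  \<comment> \<open>An infimum of reals is meaningful only over a set that is bounded below;
    \<open>bound\<close> supplies \<open>- p (\<ominus> y)\<close>.\<close>
  have lb: "- p (\<ominus> y) \<le> p (y \<ominus> x) + s" if y: "y \<in> S" and xs: "(x, s) \<in> G" for x y s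
  proof -
    have x: "x \<in> S" using GS xs by blast
    have c: "x \<in> carrier A" "y \<in> carrier A" using Sc(2) x y by blast+
    obtain F where F: "frame x y y y F" by (rule frame_exists[OF c c(2) c(2)])
    have "\<ominus> x = (y \<ominus> x) \<oplus> \<ominus> y" by (simp add: frameD[OF F])
    then have "p (\<ominus> x) \<le> p (y \<ominus> x) + p (\<ominus> y)" using padd[of "y \<ominus> x" "\<ominus> y"] Sc x y by simp
    then show ?thesis using bound[OF xs] by simp
  qed
  have bdd: "bdd_below ((\<lambda>(x, s). p (y \<ominus> x) + s) ` G)" if "y \<in> S" for y
    using lb[OF that] by (intro bdd_belowI[of _ "- p (\<ominus> y)"]) auto
  have qle: "q y \<le> p (y \<ominus> x) + s" if "y \<in> S" "(x, s) \<in> G" for x y s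
    unfolding q_def using cINF_lower[OF bdd[OF that(1)] that(2)] by simp
  have qge: "c \<le> q y" if "\<And>x s. (x, s) \<in> G \<Longrightarrow> c \<le> p (y \<ominus> x) + s" for c y
    unfolding q_def using that G0 by (intro cINF_greatest) auto
  have qp: "q x \<le> p x" if "x \<in> S" for x
    using qle[OF that G0] Sc(2)[OF that] by (simp add: M.minus_eq)
  have qG: "q x \<le> s" if "(x, s) \<in> G" for x s
    using qle[OF GS[OF that] that] Sc(2)[OF GS[OF that]] p0 by (simp add: M.minus_eq M.r_neg)
  have qadd: "q (x \<oplus> y) \<le> q x + q y" if xy: "x \<in> S" "y \<in> S" for x y
  proof -
    have *: "q (x \<oplus> y) \<le> (p (x \<ominus> a) + s) + (p (y \<ominus> b) + t)" if ab: "(a, s) \<in> G" "(b, t) \<in> G" for a b s t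
    proof -
      have c: "a \<in> S" "b \<in> S" using GS ab by blast+
      obtain F where F: "frame x y a b F"
        by (rule frame_exists[OF xy[THEN Sc(2)] c[THEN Sc(2)]])
      have "(x \<oplus> y) \<ominus> (a \<oplus> b) = (x \<ominus> a) \<oplus> (y \<ominus> b)" by (simp add: frameD[OF F])
      then show ?thesis
        using qle[OF Sc(3)[OF xy] Gadd[OF ab]] padd[OF Sc(6)[OF xy(1) c(1)] Sc(6)[OF xy(2) c(2)]] by simp
    qed
    have "q (x \<oplus> y) - (p (x \<ominus> a) + s) \<le> q y" if "(a, s) \<in> G" for a s
      using *[OF that] by (intro qge) (simp add: algebra_simps)
    then have "q (x \<oplus> y) - q y \<le> q x" by (intro qge) (simp add: algebra_simps)
    then show ?thesis by simp
  qed
  have qle_mul: "q (complex_of_real r \<odot> x) \<le> r * q x" if "x \<in> S" "0 < r" for x r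
  proof -
    have "q (complex_of_real r \<odot> x) / r \<le> q x"
    proof (rule qge)
      fix a s assume a: "(a, s) \<in> G"
      have c: "a \<in> carrier A" "x \<in> carrier A" "x \<ominus> a \<in> S" using GS a that Sc by auto
      have "complex_of_real r \<odot> x \<ominus> complex_of_real r \<odot> a = complex_of_real r \<odot> (x \<ominus> a)"
        using c by (simp add: M.minus_eq smult_add_right a_inv_smult)
      then have "q (complex_of_real r \<odot> x) \<le> r * p (x \<ominus> a) + r * s"
        using qle[OF Sc(4)[OF that(1), of r] Gmul[OF a that(2)]] pmul[OF c(3), of r] that by simp
      then show "q (complex_of_real r \<odot> x) / r \<le> p (x \<ominus> a) + s"
        using that by (simp add: divide_le_eq algebra_simps)
    qed
    then show ?thesis using that by (simp add: divide_le_eq algebra_simps)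
  qed
  have qmul: "q (complex_of_real r \<odot> x) = r * q x" if x: "x \<in> S" and r: "0 \<le> r" for x r
  proof (cases "r = 0")
    case True
    have "0 \<le> q \<zero>" using bound Sc(2)[OF GS] by (intro qge) (simp add: M.minus_eq)
    then show ?thesis using True x Sc qp[OF Sc(1)] p0 by simp
  next
    case False
    have "complex_of_real (1 / r) \<odot> (complex_of_real r \<odot> x) = x" using False Sc(2)[OF x] by simp
    then have "q x \<le> (1 / r) * q (complex_of_real r \<odot> x)"
      using qle_mul[OF Sc(4)[OF x, of r], of "1 / r"] r False by simp
    then have "r * q x \<le> q (complex_of_real r \<odot> x)" using r False by (simp add: field_simps)
    then show ?thesis using qle_mul[OF x, of r] r False by simp
  qed
  show thesis
    using that qadd qmul qp qG unfolding sublinear_on_def by blast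
qed

lemma minimal_sublinear_exists:
  assumes S: "real_subspace S" and p: "sublinear_on S p"
  obtains q where "sublinear_on S q" "\<And>x. x \<in> S \<Longrightarrow> q x \<le> p x"
    "\<And>q' x. \<lbrakk>sublinear_on S q'; \<And>x. x \<in> S \<Longrightarrow> q' x \<le> q x; x \<in> S\<rbrakk> \<Longrightarrow> q' x = q x"
proof -
  note Sc = real_subspaceD[OF S]
  \<comment> \<open>Functions are fixed to 0 outside \<open>S\<close>, so that being below on
    \<open>S\<close> coincides with being below as a function.\<close>
  define Q where "Q = {q. sublinear_on S q \<and> (\<forall>x\<in>S. q x \<le> p x) \<and> (\<forall>x. x \<notin> S \<longrightarrow> q x = 0)}"
  have sub_cong: "sublinear_on S q'" if "sublinear_on S q" "\<And>x. x \<in> S \<Longrightarrow> q' x = q x" for q q'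
    using that Sc unfolding sublinear_on_def by simp
  have "\<exists>m\<in>Q. \<forall>q\<in>Q. q \<le> m \<longrightarrow> q = m"
  proof (rule predicate_Zorn)
    show "partial_order_on Q (relation_of (\<lambda>q q'. q' \<le> q) Q)"
      by (auto simp: partial_order_on_def preorder_on_def refl_on_def trans_def antisym_def relation_of_def)
    fix C assume C: "C \<in> Chains (relation_of (\<lambda>q q'. q' \<le> q) Q)"
    then have CQ: "C \<subseteq> Q" by (auto simp: Chains_def relation_of_def)
    have tot: "q \<le> q' \<or> q' \<le> q" if "q \<in> C" "q' \<in> C" for q q'
      using C that by (auto simp: Chains_def relation_of_def)
    show "\<exists>u\<in>Q. \<forall>q\<in>C. u \<le> q"
    proof (cases "C = {}")
      case True
      have "(\<lambda>x. if x \<in> S then p x else 0) \<in> Q"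
        using sub_cong[OF p] by (simp add: Q_def)
      with True show ?thesis by blast
    next
      case False
      define u where "u x = (if x \<in> S then INF q\<in>C. q x else 0)" for x
      have bdd: "bdd_below ((\<lambda>q. q x) ` C)" if "x \<in> S" for x
      proof (rule bdd_belowI)
        fix y assume "y \<in> (\<lambda>q. q x) ` C"
        then obtain q where q: "q \<in> Q" "y = q x" using CQ by blast
        then have "- q (\<ominus> x) \<le> q x" "q (\<ominus> x) \<le> p (\<ominus> x)"
          using sublinear_on_minus[OF S _ that] Sc(5)[OF that] by (auto simp: Q_def)
        then show "- p (\<ominus> x) \<le> y" using q by simp
      qed
      have ule: "u x \<le> q x" if "q \<in> C" "x \<in> S" for q x
        unfolding u_def using cINF_lower[OF bdd[OF that(2)] that(1)] that by simp
      have uge: "c \<le> u x" if "\<And>q. q \<in> C \<Longrightarrow> c \<le> q x" "x \<in> S" for c x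
        unfolding u_def using that False by (auto intro: cINF_greatest)
      have add: "u (x \<oplus> y) \<le> u x + u y" if xy: "x \<in> S" "y \<in> S" for x y
      proof -
        have *: "u (x \<oplus> y) \<le> q x + q' y" if q: "q \<in> C" "q' \<in> C" for q q'
        proof -
          \<comment> \<open>The chain provides one functional below both; an infimum over an
            arbitrary family of sublinear functionals need not be subadditive.\<close>
          obtain m where m: "m \<in> C" "m \<le> q" "m \<le> q'" using tot q by blast
          then have "m (x \<oplus> y) \<le> m x + m y" using CQ xy by (auto simp: Q_def sublinear_on_def)
          then show ?thesis
            using ule[OF m(1) Sc(3)[OF xy]] le_funD[OF m(2), of x] le_funD[OF m(3), of y] by linarith
        qed
        have "u (x \<oplus> y) - q x \<le> u y" if "q \<in> C" for q
          using *[OF that] xy by (intro uge) (simp add: algebra_simps)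
        then have "u (x \<oplus> y) - u y \<le> u x" using xy by (intro uge) (simp add: algebra_simps)
        then show ?thesis by simp
      qed
      have mul: "u (complex_of_real r \<odot> x) = r * u x" if x: "x \<in> S" and r: "0 \<le> r" for x r
      proof -
        have e: "q (complex_of_real r \<odot> x) = r * q x" if "q \<in> C" for q
          using that CQ x r by (auto simp: Q_def sublinear_on_def)
        have 1: "r * u x \<le> u (complex_of_real r \<odot> x)"
          using ule[OF _ x] r Sc(4)[OF x] by (intro uge) (simp_all add: e mult_left_mono)
        show ?thesis
        proof (cases "r = 0")
          case True
          obtain q where q: "q \<in> C" using False by blast
          have "u (complex_of_real r \<odot> x) \<le> 0" using ule[OF q Sc(4)[OF x, of r]] e[OF q] True by simp
          then show ?thesis using 1 True by simp
        next
          case nz: False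
          have "u (complex_of_real r \<odot> x) / r \<le> u x"
            using e ule[OF _ Sc(4)[OF x, of r]] r nz x
            by (intro uge) (auto simp: divide_le_eq mult.commute)
          then show ?thesis using 1 r nz by (simp add: divide_le_eq mult.commute)
        qed
      qed
      have "u x \<le> p x" if "x \<in> S" for x
      proof -
        obtain q where "q \<in> C" using False by blast
        then show ?thesis using ule[OF _ that, of q] CQ that by (force simp: Q_def)
      qed
      then have "u \<in> Q" using add mul by (auto simp: Q_def sublinear_on_def u_def)
      moreover have "u \<le> q" if "q \<in> C" for q
        using ule[OF that] that CQ by (auto simp: le_fun_def Q_def u_def)
      ultimately show ?thesis by blast
    qed
  qed
  then obtain q where q: "q \<in> Q" and min: "\<And>q'. \<lbrakk>q' \<in> Q; q' \<le> q\<rbrakk> \<Longrightarrow> q' = q" by blast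
  show thesis
  proof (rule that)
    show "sublinear_on S q" "\<And>x. x \<in> S \<Longrightarrow> q x \<le> p x" using q by (auto simp: Q_def)
    fix q' x assume q': "sublinear_on S q'" "\<And>x. x \<in> S \<Longrightarrow> q' x \<le> q x" "x \<in> S"
    define q'' where "q'' = (\<lambda>x. if x \<in> S then q' x else 0)"
    have "q'' \<in> Q" using q' q sub_cong[OF q'(1), of q''] unfolding Q_def q''_def
      by (auto intro: order_trans)
    moreover have "q'' \<le> q" using q' q by (auto simp: q''_def le_fun_def Q_def)
    ultimately have "q'' = q" by (rule min)
    then show "q' x = q x" using q'(3) by (auto simp: q''_def)
  qed
qed

text \<open>A minimal sublinear functional \<open>q\<close> is linear: its infimal convolution with the constraint
  \<open>f (- x) \<le> - q x\<close> is again sublinear, hence equal to \<open>q\<close>.\<close>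

lemma linear_below_sublinear:
  assumes S: "real_subspace S" and p: "sublinear_on S p"
  obtains f where "linear_on S f" "\<And>x. x \<in> S \<Longrightarrow> f x \<le> p x"
proof -
  note Sc = real_subspaceD[OF S]
  obtain q where q: "sublinear_on S q" "\<And>x. x \<in> S \<Longrightarrow> q x \<le> p x"
    and min: "\<And>q' x. \<lbrakk>sublinear_on S q'; \<And>x. x \<in> S \<Longrightarrow> q' x \<le> q x; x \<in> S\<rbrakk> \<Longrightarrow> q' x = q x"
    using minimal_sublinear_exists[OF S p] by metis
  have add: "q (x \<oplus> y) \<le> q x + q y" if "x \<in> S" "y \<in> S" for x y
    using q that unfolding sublinear_on_def by blast
  have mul: "q (complex_of_real r \<odot> x) = r * q x" if "x \<in> S" "0 \<le> r" for x r
    using q that unfolding sublinear_on_def by blast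
  have odd: "q (\<ominus> x) = - q x" if x: "x \<in> S" for x
  proof -
    \<comment> \<open>The ray spanned by the constraint \<open>(\<ominus> x, - q x)\<close>; on it
      the compatibility condition reads \<open>q (r x) - r * q x \<ge> 0\<close> and holds with
      equality.\<close>
    define G where "G = (\<lambda>r. (\<ominus> (complex_of_real r \<odot> x), - r * q x)) ` {0..}"
    have xc: "x \<in> carrier A" using Sc x by blast
    obtain F where F: "frame x x x x F" using frame_exists xc by blast
    have "convex_cone S G" unfolding convex_cone_def
    proof (intro conjI allI impI)
      show "G \<subseteq> S \<times> UNIV" using Sc x by (auto simp: G_def)
      show "(\<zero>, 0) \<in> G" unfolding G_def using xc by (intro image_eqI[of _ _ 0]) auto
    next
      fix a s b t assume "(a, s) \<in> G" "(b, t) \<in> G"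
      then obtain r r' where r: "r \<ge> 0" "r' \<ge> 0" "a = \<ominus> (complex_of_real r \<odot> x)" "s = - r * q x"
        "b = \<ominus> (complex_of_real r' \<odot> x)" "t = - r' * q x" unfolding G_def by auto
      have "a \<oplus> b = \<ominus> (complex_of_real (r + r') \<odot> x)" unfolding r by (simp add: frameD[OF F])
      then show "(a \<oplus> b, s + t) \<in> G" unfolding G_def r
        using r(1,2) by (intro image_eqI[of _ _ "r + r'"]) (auto simp: algebra_simps)
    next
      fix r a s assume r: "(0::real) < r" and "(a, s) \<in> G"
      then obtain r' where r': "r' \<ge> 0" "a = \<ominus> (complex_of_real r' \<odot> x)" "s = - r' * q x"
        unfolding G_def by auto
      have "complex_of_real r \<odot> a = \<ominus> (complex_of_real (r * r') \<odot> x)" unfolding r' by (simp add: frameD[OF F])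
      then show "(complex_of_real r \<odot> a, r * s) \<in> G" unfolding G_def r'
        using r r'(1) by (intro image_eqI[of _ _ "r * r'"]) auto
    qed
    moreover have "0 \<le> q (\<ominus> a) + s" if "(a, s) \<in> G" for a s
      using that mul[OF x] xc by (auto simp: G_def)
    ultimately obtain q' where q': "sublinear_on S q'" "\<And>x. x \<in> S \<Longrightarrow> q' x \<le> q x"
        "\<And>x s. (x, s) \<in> G \<Longrightarrow> q' x \<le> s"
      using sublinear_inf_convolution[OF S q(1)] by metis
    have "(\<ominus> x, - q x) \<in> G" unfolding G_def using xc by (intro image_eqI[of _ _ 1]) auto
    then have "q (\<ominus> x) \<le> - q x" using q'(3) min[OF q'(1,2) Sc(5)[OF x]] by fastforce
    then show ?thesis using sublinear_on_minus[OF S q(1) x] by simp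
  qed
  have "q (x \<oplus> y) = q x + q y" if xy: "x \<in> S" "y \<in> S" for x y
  proof -
    have "q (\<ominus> x \<oplus> \<ominus> y) \<le> q (\<ominus> x) + q (\<ominus> y)" by (rule add[OF xy[THEN Sc(5)]])
    moreover have "\<ominus> x \<oplus> \<ominus> y = \<ominus> (x \<oplus> y)" using xy Sc(2) by (simp add: M.minus_add)
    ultimately show ?thesis using odd[OF Sc(3)[OF xy]] xy[THEN odd] add[OF xy] by simp
  qed
  moreover have "q (complex_of_real r \<odot> x) = r * q x" if x: "x \<in> S" for x r
  proof (cases "0 \<le> r")
    case False
    have "complex_of_real r \<odot> x = \<ominus> (complex_of_real (- r) \<odot> x)"
      using Sc(2)[OF x] minus_smult[of x "complex_of_real r"] by simp
    then show ?thesis using odd[OF Sc(4)[OF x, of "- r"]] mul[OF x, of "-r"] False by simp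
  qed (use mul x in blast)
  ultimately have "linear_on S q" unfolding linear_on_def by blast
  then show thesis using that q by blast
qed

theorem hahn_banach_cone:
  assumes S: "real_subspace S" and p: "sublinear_on S p" and G: "convex_cone S G"
    and bound: "\<And>x s. (x, s) \<in> G \<Longrightarrow> 0 \<le> p (\<ominus> x) + s"
  obtains f where "linear_on S f" "\<And>x. x \<in> S \<Longrightarrow> f x \<le> p x" "\<And>x s. (x, s) \<in> G \<Longrightarrow> f x \<le> s"
proof -
  obtain q where q: "sublinear_on S q" "\<And>x. x \<in> S \<Longrightarrow> q x \<le> p x" "\<And>x s. (x, s) \<in> G \<Longrightarrow> q x \<le> s"
    using sublinear_inf_convolution[OF S p G bound] by metis
  obtain f where f: "linear_on S f" "\<And>x. x \<in> S \<Longrightarrow> f x \<le> q x"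
    using linear_below_sublinear[OF S q(1)] by metis
  have GS: "x \<in> S" if "(x, s) \<in> G" for x s using G that unfolding convex_cone_def by blast
  show thesis
  proof (rule that[OF f(1)])
    show "f x \<le> p x" if "x \<in> S" for x using f(2)[OF that] q(2)[OF that] by simp
    show "f x \<le> s" if "(x, s) \<in> G" for x s using f(2)[OF GS[OF that]] q(3)[OF that] by simp
  qed
qed

end

section \<open>States and the metric of a Lipschitz semi-norm\<close>

context unital_cstar_algebra
begin

lemma states_iff:
  "\<mu> \<in> states A V \<longleftrightarrow> \<mu> \<in> extensional (sa A V) \<and> linear_on (sa A V) \<mu> \<and>
    (\<forall>x\<in>sa A V. positive A x \<longrightarrow> 0 \<le> \<mu> x) \<and> \<mu> \<one> = 1"
  by (auto simp: states_def linear_on_def)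

end

text \<open>A nonzero unit excludes the zero algebra, which has no states.\<close>

locale unital_subspace = unital_cstar_algebra +
  fixes V
  assumes nonzero: "\<one> \<noteq> \<zero>" and subspace: "unital_selfadjoint_subspace A V"
begin

abbreviation S where "S \<equiv> sa A V"

lemma V_in: "x \<in> V \<Longrightarrow> x \<in> carrier A"
  using subspace submoduleE(1) by (auto simp: unital_selfadjoint_subspace_def)

lemma V_add: "\<lbrakk>x \<in> V; y \<in> V\<rbrakk> \<Longrightarrow> x \<oplus> y \<in> V"
  using subspace submoduleE(5) by (auto simp: unital_selfadjoint_subspace_def)

lemma V_smult: "x \<in> V \<Longrightarrow> c \<odot> x \<in> V"
  using subspace submoduleE(4)[of V c x] by (auto simp: unital_selfadjoint_subspace_def complex_field_def)

lemma V_star: "x \<in> V \<Longrightarrow> star A x \<in> V"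
  using subspace by (auto simp: unital_selfadjoint_subspace_def)

lemma V_diff: "\<lbrakk>x \<in> V; y \<in> V\<rbrakk> \<Longrightarrow> x \<ominus> y \<in> V"
  using V_add[of x "(- 1) \<odot> y"] V_smult[of y "-1"] V_in by (simp add: M.minus_eq a_inv_smult)

lemma V_one: "\<one> \<in> V"
  using subspace by (simp add: unital_selfadjoint_subspace_def)

lemma S_herm: "x \<in> S \<Longrightarrow> x \<in> herm"
  using V_in by (auto simp: sa_def)

lemma S_in: "x \<in> S \<Longrightarrow> x \<in> carrier A"
  using V_in by (auto simp: sa_def)

lemma S_V: "x \<in> S \<Longrightarrow> x \<in> V"
  by (simp add: sa_def)

lemma S_real_subspace: "real_subspace S"
proof -
  have "\<zero> \<in> V" using V_smult[OF V_one, of 0] by simp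
  then show ?thesis
    using V_in V_add V_smult
    by (auto simp: real_subspace_def sa_def star_add star_smult)
qed

lemmas S_zero = real_subspaceD(1)[OF S_real_subspace]
  and S_add = real_subspaceD(3)[OF S_real_subspace]
  and S_smult = real_subspaceD(4)[OF S_real_subspace]
  and S_minus = real_subspaceD(5)[OF S_real_subspace]
  and S_diff = real_subspaceD(6)[OF S_real_subspace]

lemma S_one [simp]: "\<one> \<in> S"
  using V_one by (simp add: sa_def)

lemma S_scal [simp]: "scal r \<in> S"
  by (rule S_smult) simp

section \<open>Existence and values of states\<close>

lemma state_add: "\<lbrakk>\<mu> \<in> states A V; x \<in> S; y \<in> S\<rbrakk> \<Longrightarrow> \<mu> (x \<oplus> y) = \<mu> x + \<mu> y"
  and state_smult: "\<lbrakk>\<mu> \<in> states A V; x \<in> S\<rbrakk> \<Longrightarrow> \<mu> (complex_of_real r \<odot> x) = r * \<mu> x"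
  and state_one: "\<mu> \<in> states A V \<Longrightarrow> \<mu> \<one> = 1"
  and state_positive: "\<lbrakk>\<mu> \<in> states A V; x \<in> S; positive A x\<rbrakk> \<Longrightarrow> 0 \<le> \<mu> x"
  by (simp_all add: states_def)

lemma state_minus: "\<lbrakk>\<mu> \<in> states A V; x \<in> S\<rbrakk> \<Longrightarrow> \<mu> (\<ominus> x) = - \<mu> x"
  using state_smult[of \<mu> x "-1"] S_in by (simp add: a_inv_smult)

lemma state_diff: "\<lbrakk>\<mu> \<in> states A V; x \<in> S; y \<in> S\<rbrakk> \<Longrightarrow> \<mu> (x \<ominus> y) = \<mu> x - \<mu> y"
  by (simp add: M.minus_eq state_add S_minus state_minus)

lemma state_scal: "\<mu> \<in> states A V \<Longrightarrow> \<mu> (scal r) = r"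
  by (simp add: state_smult state_one)

lemma state_le_upper:
  assumes "\<mu> \<in> states A V" "x \<in> S"
  shows "\<mu> x \<le> upper x"
proof -
  have "positive A (scal (upper x) \<ominus> x)"
    unfolding positive_iff_psd using S_herm[OF assms(2)] by (rule psd_upper_diff)
  then have "0 \<le> \<mu> (scal (upper x) \<ominus> x)"
    using assms by (intro state_positive S_diff) auto
  then show ?thesis using assms by (simp add: state_diff state_scal)
qed

lemma state_abs_le:
  assumes "\<mu> \<in> states A V" "x \<in> S"
  shows "\<bar>\<mu> x\<bar> \<le> nrm A x"
  using state_le_upper[OF assms(1) assms(2)] state_le_upper[OF assms(1) S_minus[OF assms(2)]]
    upper_le_nrm[OF nonzero S_herm[OF assms(2)]] upper_le_nrm[OF nonzero S_herm[OF S_minus[OF assms(2)]]]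
    state_minus[OF assms] S_in[OF assms(2)] by simp

lemma upper_sublinear: "sublinear_on S upper"
  unfolding sublinear_on_def
  using upper_add[OF nonzero S_herm S_herm] upper_smult[OF S_herm] by blast

text \<open>Domination by \<open>upper\<close> contains the order and the unit: \<open>upper\<close>
  is at most 0 at negatives of positive elements, and its values 1 and -1 at \<open>\<one>\<close>
  and \<open>scal (-1)\<close> pin down \<open>f \<one>\<close>.\<close>

lemma state_of_linear:
  assumes f: "linear_on S f" "\<And>x. x \<in> S \<Longrightarrow> f x \<le> upper x"
  shows "restrict f S \<in> states A V"
proof -
  have add: "f (x \<oplus> y) = f x + f y" if "x \<in> S" "y \<in> S" for x y
    using f(1) that unfolding linear_on_def by blast
  have mul: "f (complex_of_real r \<odot> x) = r * f x" if "x \<in> S" for x r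
    using f(1) that unfolding linear_on_def by blast
  have m: "f (\<ominus> x) = - f x" if "x \<in> S" for x
    using mul[OF that, of "-1"] S_in[OF that] by (simp add: a_inv_smult)
  have "linear_on S (restrict f S)"
    unfolding linear_on_def using add mul S_add S_smult by simp
  moreover have "0 \<le> f x" if "x \<in> S" "positive A x" for x
    using f(2)[OF S_minus[OF that(1)]] m[OF that(1)] upper_minus_psd[of x] that(2)
    unfolding positive_iff_psd by simp
  moreover have "f \<one> = 1"
    using f(2)[OF S_one] f(2)[OF S_scal[of "-1"]] upper_scal[OF nonzero, of 1]
      upper_scal[OF nonzero, of "-1"] mul[OF S_one, of "-1"] by simp
  ultimately show ?thesis by (simp add: states_iff)
qed

lemma state_exists_cone:
  assumes G: "convex_cone S G" and bound: "\<And>x s. (x, s) \<in> G \<Longrightarrow> 0 \<le> upper (\<ominus> x) + s"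
  obtains \<mu> where "\<mu> \<in> states A V" "\<forall>(x, s)\<in>G. \<mu> x \<le> s"
proof -
  obtain f where f: "linear_on S f" "\<And>x. x \<in> S \<Longrightarrow> f x \<le> upper x" "\<And>x s. (x, s) \<in> G \<Longrightarrow> f x \<le> s"
    using hahn_banach_cone[OF S_real_subspace upper_sublinear G bound] by metis
  have "x \<in> S" if "(x, s) \<in> G" for x s using G that unfolding convex_cone_def by blast
  then have "\<forall>(x, s)\<in>G. restrict f S x \<le> s" using f(3) by auto
  then show thesis using that[OF state_of_linear[OF f(1,2)]] by blast
qed

lemma convex_cone_ray:
  assumes "x \<in> S"
  shows "convex_cone S ((\<lambda>r. (complex_of_real r \<odot> x, r * c)) ` {0..})"
  unfolding convex_cone_def
proof (intro conjI allI impI)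
  let ?G = "(\<lambda>r. (complex_of_real r \<odot> x, r * c)) ` {0..}"
  have xc: "x \<in> carrier A" using S_in assms by blast
  show "?G \<subseteq> S \<times> UNIV" using S_smult[OF assms] by auto
  show "(\<zero>, 0) \<in> ?G" using xc by (intro image_eqI[of _ _ 0]) auto
  fix a s b t assume "(a, s) \<in> ?G" "(b, t) \<in> ?G"
  then obtain r r' where "r \<ge> 0" "r' \<ge> 0" "a = complex_of_real r \<odot> x" "s = r * c"
    "b = complex_of_real r' \<odot> x" "t = r' * c" by auto
  then show "(a \<oplus> b, s + t) \<in> ?G"
    using xc by (intro image_eqI[of _ _ "r + r'"]) (simp_all add: distrib_right smult_add_left)
next
  let ?G = "(\<lambda>r. (complex_of_real r \<odot> x, r * c)) ` {0..}"
  fix r a s assume "(0::real) < r" "(a, s) \<in> ?G"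
  then obtain r' where "r' \<ge> 0" "a = complex_of_real r' \<odot> x" "s = r' * c" by auto
  then show "(complex_of_real r \<odot> a, r * s) \<in> ?G"
    using \<open>0 < r\<close> S_in[OF assms] by (intro image_eqI[of _ _ "r * r'"]) auto
qed

text \<open>Prescribe \<open>f (\<ominus> x) \<le> - upper x\<close> along the ray through
  \<open>\<ominus> x\<close>; the compatibility condition holds there with equality, and the reverse
  inequality is \<open>state_le_upper\<close>.\<close>

lemma state_attains_upper:
  assumes x: "x \<in> S"
  obtains \<mu> where "\<mu> \<in> states A V" "\<mu> x = upper x"
proof -
  have xc: "x \<in> carrier A" using S_in x by blast
  let ?G = "(\<lambda>r. (complex_of_real r \<odot> (\<ominus> x), r * (- upper x))) ` {0..}"
  have cone: "convex_cone S ?G" by (rule convex_cone_ray[OF S_minus[OF x]])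
  have bound: "0 \<le> upper (\<ominus> a) + s" if "(a, s) \<in> ?G" for a s
  proof -
    from that obtain r where "(a, s) = (complex_of_real r \<odot> (\<ominus> x), r * (- upper x))" "r \<in> {0..}"
      by (rule imageE)
    then have r: "0 \<le> r" "a = complex_of_real r \<odot> (\<ominus> x)" "s = r * (- upper x)" by simp_all
    have "\<ominus> a = complex_of_real r \<odot> x" using xc by (simp add: r a_inv_smult)
    then show ?thesis using upper_smult[OF S_herm[OF x] r(1)] r(3) by simp
  qed
  obtain \<mu> where \<mu>: "\<mu> \<in> states A V" "\<forall>(a, s)\<in>?G. \<mu> a \<le> s"
    by (rule state_exists_cone[OF cone bound])
  have "(\<ominus> x, - upper x) \<in> ?G" using xc by (intro image_eqI[of _ _ 1]) auto
  then have "\<mu> (\<ominus> x) \<le> - upper x" using \<mu>(2) by fast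
  then have "\<mu> x = upper x" using state_minus[OF \<mu>(1) x] state_le_upper[OF \<mu>(1) x] by simp
  then show thesis using that \<mu>(1) by blast
qed

lemma states_nonempty: "states A V \<noteq> {}"
  using state_attains_upper[OF S_one] by blast

lemma nrm_le_states:
  assumes x: "x \<in> S" and "\<And>\<mu>. \<mu> \<in> states A V \<Longrightarrow> \<bar>\<mu> x\<bar> \<le> c"
  shows "nrm A x \<le> c"
proof (rule nrm_le_upper[OF nonzero S_herm[OF x]])
  show "upper x \<le> c" using state_attains_upper[OF x] assms(2) by (metis abs_le_D1)
  show "upper (\<ominus> x) \<le> c" using state_attains_upper[OF S_minus[OF x]] assms(2) state_minus[OF _ x]
    by (metis abs_le_D1 abs_minus_cancel)
qed

text \<open>The scalar is the value at \<open>x\<close> of one fixed state; every other state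
  differs from it by at most the diameter, twice the radius, and states detect the norm.\<close>

lemma radius_bound:
  assumes "radius A V L \<le> ennreal r" "0 \<le> r" "x \<in> S" "L x \<le> 1"
  obtains c where "nrm A (x \<ominus> scal c) \<le> 2 * r"
proof -
  obtain \<nu> where \<nu>: "\<nu> \<in> states A V" using states_nonempty by blast
  have "\<bar>\<mu> x - \<nu> x\<bar> \<le> 2 * r" if \<mu>: "\<mu> \<in> states A V" for \<mu>
  proof -
    have "ennreal \<bar>\<mu> x - \<nu> x\<bar> \<le> rho A V L \<mu> \<nu>"
      unfolding rho_def using assms by (intro SUP_upper) auto
    also have "\<dots> \<le> (SUP \<mu>\<in>states A V. SUP \<nu>\<in>states A V. rho A V L \<mu> \<nu>)"
      using \<mu> \<nu> by (meson SUP_upper SUP_upper2)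
    also have "\<dots> = 2 * radius A V L"
      unfolding radius_def by (simp add: ennreal_times_divide mult.commute[of 2] mult_divide_eq_ennreal)
    also have "\<dots> \<le> ennreal (2 * r)"
      using assms(1,2) by (simp add: ennreal_mult mult_left_mono)
    finally show ?thesis using assms(2) by simp
  qed
  then have "nrm A (x \<ominus> scal (\<nu> x)) \<le> 2 * r"
    using assms(3) by (intro nrm_le_states S_diff) (auto simp: state_diff state_scal)
  then show thesis using that by blast
qed

section \<open>Weak star compactness and Lipschitz balls\<close>

lemma closedin_states: "closedin (powertop_real S) (states A V)"
proof -
  let ?X = "powertop_real S"
  have cm: "continuous_map ?X euclideanreal (\<lambda>\<mu>. \<mu> x)" if "x \<in> S" for x
    using that by (rule continuous_map_product_projection)
  have eq: "closedin ?X {\<mu> \<in> topspace ?X. f \<mu> = g \<mu>}"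
    if "continuous_map ?X euclideanreal f" "continuous_map ?X euclideanreal g" for f g
    using closedin_continuous_map_preimage[OF continuous_map_diff[OF that], of "{0}"] by simp
  have le: "closedin ?X {\<mu> \<in> topspace ?X. 0 \<le> \<mu> x}" if "x \<in> S" for x
    using closedin_continuous_map_preimage[OF cm[OF that], of "{0..}"] by simp
  have "states A V =
    {\<mu> \<in> topspace ?X. \<mu> \<one> = 1} \<inter>
    (\<Inter>x\<in>S. \<Inter>y\<in>S. {\<mu> \<in> topspace ?X. \<mu> (x \<oplus> y) = \<mu> x + \<mu> y}) \<inter>
    (\<Inter>r\<in>UNIV. \<Inter>x\<in>S. {\<mu> \<in> topspace ?X. \<mu> (complex_of_real r \<odot> x) = r * \<mu> x}) \<inter>
    (\<Inter>x\<in>S. {\<mu> \<in> topspace ?X. positive A x \<longrightarrow> 0 \<le> \<mu> x})"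
    using S_one by (auto simp: states_def PiE_UNIV_domain PiE_def extensional_def)
  moreover have "closedin ?X {\<mu> \<in> topspace ?X. \<mu> \<one> = 1}"
    by (intro eq cm S_one) simp
  moreover have "closedin ?X {\<mu> \<in> topspace ?X. \<mu> (x \<oplus> y) = \<mu> x + \<mu> y}"
    if "x \<in> S" "y \<in> S" for x y
    using that by (intro eq cm continuous_map_add S_add)
  moreover have "closedin ?X {\<mu> \<in> topspace ?X. \<mu> (complex_of_real r \<odot> x) = r * \<mu> x}"
    if "x \<in> S" for x r
    using that by (intro eq cm continuous_map_real_mult_left S_smult)
  moreover have "closedin ?X {\<mu> \<in> topspace ?X. positive A x \<longrightarrow> 0 \<le> \<mu> x}" if "x \<in> S" for x
    using le[OF that] closedin_topspace[of ?X] by (cases "positive A x") simp_all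
  moreover have "S \<noteq> {}" using S_one by blast
  ultimately show ?thesis
    by (simp only:) (intro closedin_Int closedin_INT; simp)
qed

text \<open>The Banach-Alaoglu argument: the states are a closed part of a product of compact
  intervals.\<close>

lemma compactin_states: "compactin (powertop_real S) (states A V)"
proof (rule closed_compactin)
  show "compactin (powertop_real S) (PiE S (\<lambda>x. {- nrm A x..nrm A x}))"
    by (simp add: compactin_PiE)
  show "states A V \<subseteq> PiE S (\<lambda>x. {- nrm A x..nrm A x})"
  proof
    fix \<mu> assume \<mu>: "\<mu> \<in> states A V"
    show "\<mu> \<in> PiE S (\<lambda>x. {- nrm A x..nrm A x})"
    proof (rule PiE_I)
      show "\<mu> x \<in> {- nrm A x..nrm A x}" if "x \<in> S" for x
        using state_abs_le[OF \<mu> that] by (simp add: abs_le_iff minus_le_iff)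
      show "\<mu> x = undefined" if "x \<notin> S" for x
        using \<mu> that by (simp add: states_iff extensional_def)
    qed
  qed
qed (rule closedin_states)

lemma finite_choice_of_representatives:
  assumes "finite (f ` K)"
  obtains F where "finite F" "F \<subseteq> K" "\<And>x. x \<in> K \<Longrightarrow> \<exists>w\<in>F. f x = f w"
proof -
  obtain F where F: "F \<subseteq> K" "finite F" "f ` K = f ` F"
    using finite_subset_image[OF assms order_refl] by blast
  then have "\<exists>w\<in>F. f x = f w" if "x \<in> K" for x
    using that by (metis imageE imageI)
  then show thesis using that F by blast
qed

text \<open>For finitely many states \<open>\<mu>\<close> that are dense up to \<open>e\<close>, an element of the ball is determined
  up to \<open>3 e\<close> by the integer parts of the values \<open>\<mu> x / e\<close>, of which there are finitely many.\<close>

lemma lip_ball_totally_bounded: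
  assumes m: "metrizes_states A V L" and e: "e > 0"
  obtains F where "finite F" "F \<subseteq> {x \<in> S. L x \<le> 1 \<and> nrm A x \<le> R}"
    "\<forall>x\<in>S. L x \<le> 1 \<longrightarrow> nrm A x \<le> R \<longrightarrow> (\<exists>w\<in>F. nrm A (x \<ominus> w) \<le> e)"
proof -
  define K where "K = {x \<in> S. L x \<le> 1 \<and> nrm A x \<le> R}"
  \<comment> \<open>One \<open>d\<close> for equal integer parts, and one each for replacing the
    given state by a net point at \<open>x\<close> and at \<open>w\<close>.\<close>
  define d where "d = e / 3"
  have d: "d > 0" using e by (simp add: d_def)
  let ?d = "\<lambda>\<mu> \<nu>. enn2real (rho A V L \<mu> \<nu>)"
  interpret M: Metric_space "states A V" ?d using m by (simp add: metrizes_states_def)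
  \<comment> \<open>Metrization enters here: weak star compactness becomes total boundedness for
    \<open>rho\<close>.\<close>
  have "compact_space (weak_star_topology A V)"
    unfolding weak_star_topology_def using compactin_states by (rule compact_space_subtopology)
  then have "compact_space M.mtopology" using m by (simp add: metrizes_states_def)
  then have "compactin M.mtopology (states A V)" by (simp add: compact_space_def)
  then have "M.mtotally_bounded (states A V)" by (rule M.compactin_imp_mtotally_bounded)
  then have "\<exists>N. finite N \<and> N \<subseteq> states A V \<and> states A V \<subseteq> (\<Union>\<mu>\<in>N. M.mball \<mu> d)"
    using d unfolding M.mtotally_bounded_def by simp
  then obtain N where N: "finite N" "N \<subseteq> states A V" "states A V \<subseteq> (\<Union>\<mu>\<in>N. M.mball \<mu> d)"
    by (elim exE conjE)
  define f where "f x = (\<lambda>\<mu>\<in>N. \<lfloor>\<mu> x / d\<rfloor>)" for x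
  have "f ` K \<subseteq> (\<Pi>\<^sub>E \<mu>\<in>N. {\<lfloor>- R / d\<rfloor>..\<lfloor>R / d\<rfloor>})"
  proof (rule image_subsetI)
    fix x assume x: "x \<in> K"
    show "f x \<in> (\<Pi>\<^sub>E \<mu>\<in>N. {\<lfloor>- R / d\<rfloor>..\<lfloor>R / d\<rfloor>})"
    proof (rule PiE_I)
      fix \<mu> assume \<mu>: "\<mu> \<in> N"
      have "\<bar>\<mu> x\<bar> \<le> R" using state_abs_le[of \<mu> x] x \<mu> N(2) by (auto simp: K_def)
      then have "- R / d \<le> \<mu> x / d" "\<mu> x / d \<le> R / d"
        using d divide_right_mono[of "- R" "\<mu> x" d] divide_right_mono[of "\<mu> x" R d]
        by (simp_all add: abs_le_iff)
      then show "f x \<mu> \<in> {\<lfloor>- R / d\<rfloor>..\<lfloor>R / d\<rfloor>}"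
        using \<mu> floor_mono[of "- R / d" "\<mu> x / d"] floor_mono[of "\<mu> x / d" "R / d"]
        unfolding f_def by simp
    qed (simp add: f_def)
  qed
  then have "finite (f ` K)" by (rule finite_subset) (simp add: N(1) finite_PiE)
  then obtain F where F: "finite F" "F \<subseteq> K" "\<And>x. x \<in> K \<Longrightarrow> \<exists>w\<in>F. f x = f w"
    by (rule finite_choice_of_representatives) blast
  have "\<exists>w\<in>F. nrm A (x \<ominus> w) \<le> e" if x: "x \<in> K" for x
  proof -
    obtain w where w: "w \<in> F" "f x = f w" using F(3) x by blast
    have xw: "x \<in> S" "w \<in> S" "L x \<le> 1" "L w \<le> 1" using x w(1) F(2) by (auto simp: K_def)
    have "\<bar>\<nu> (x \<ominus> w)\<bar> \<le> e" if \<nu>: "\<nu> \<in> states A V" for \<nu>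
    proof -
      obtain \<mu> where \<mu>: "\<mu> \<in> N" "\<nu> \<in> M.mball \<mu> d" using N(3) \<nu> by blast
      have \<mu>s: "\<mu> \<in> states A V" using \<mu>(1) N(2) by blast
      have close: "\<bar>\<mu> z - \<nu> z\<bar> \<le> d" if "z \<in> S" "L z \<le> 1" for z
      proof -
        have "ennreal \<bar>\<mu> z - \<nu> z\<bar> \<le> rho A V L \<mu> \<nu>"
          unfolding rho_def using that by (intro SUP_upper) auto
        moreover have "rho A V L \<mu> \<nu> = ennreal (?d \<mu> \<nu>)"
          using m \<mu>s \<nu> by (simp add: metrizes_states_def)
        moreover have "?d \<mu> \<nu> < d" using \<mu>(2) by simp
        ultimately have "\<bar>\<mu> z - \<nu> z\<bar> \<le> ?d \<mu> \<nu>"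
          by (metis ennreal_le_iff enn2real_nonneg)
        then show ?thesis using \<open>?d \<mu> \<nu> < d\<close> by simp
      qed
      have "\<lfloor>\<mu> x / d\<rfloor> = \<lfloor>\<mu> w / d\<rfloor>"
        using fun_cong[OF w(2), of \<mu>] \<mu>(1) by (simp add: f_def)
      then have "\<bar>\<mu> x / d - \<mu> w / d\<bar> < 1"
        using floor_correct[of "\<mu> x / d"] floor_correct[of "\<mu> w / d"] by linarith
      then have "\<bar>\<mu> x - \<mu> w\<bar> < d"
        using d by (simp add: divide_less_eq flip: diff_divide_distrib)
      then show ?thesis
        using close[OF xw(1,3)] close[OF xw(2,4)] state_diff[OF \<nu> xw(1,2)] unfolding d_def by linarith
    qed
    then have "nrm A (x \<ominus> w) \<le> e" using xw by (intro nrm_le_states S_diff)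
    with w(1) show ?thesis by blast
  qed
  then show thesis using that[OF F(1)] F(2) unfolding K_def by blast
qed

text \<open>Rieffel's criterion: up to \<open>2 * e\<close>, the difference of two states on the
  Lipschitz ball is seen on a finite set, since states agree on scalars. So \<open>rho\<close> is
  finite and weak star neighbourhoods fit into \<open>rho\<close>-balls; conversely each evaluation
  is Lipschitz for \<open>rho\<close>.\<close>

lemma metrizes_states_of_totally_bounded:
  assumes L: "seminorm_on \<real> A S L"
    and tb: "\<And>e. e > 0 \<Longrightarrow> \<exists>F. finite F \<and> F \<subseteq> S \<and>
      (\<forall>x\<in>S. L x \<le> 1 \<longrightarrow> (\<exists>w\<in>F. \<exists>c. nrm A (x \<ominus> scal c \<ominus> w) \<le> e))"
  shows "metrizes_states A V L"
proof -
  let ?X = "weak_star_topology A V"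
  define d where "d \<mu> \<nu> = enn2real (rho A V L \<mu> \<nu>)" for \<mu> \<nu>
  have net: "\<exists>F. finite F \<and> F \<subseteq> S \<and> (\<forall>\<mu>\<in>states A V. \<forall>\<nu>\<in>states A V. \<forall>x\<in>S. L x \<le> 1 \<longrightarrow>
      (\<exists>w\<in>F. \<bar>\<mu> x - \<nu> x\<bar> \<le> 2 * e + \<bar>\<mu> w - \<nu> w\<bar>))" if e: "e > 0" for e
  proof -
    obtain F where F: "finite F" "F \<subseteq> S"
      "\<And>x. \<lbrakk>x \<in> S; L x \<le> 1\<rbrakk> \<Longrightarrow> \<exists>w\<in>F. \<exists>c. nrm A (x \<ominus> scal c \<ominus> w) \<le> e"
      using tb[OF e] by blast
    have "\<exists>w\<in>F. \<bar>\<mu> x - \<nu> x\<bar> \<le> 2 * e + \<bar>\<mu> w - \<nu> w\<bar>"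
      if st: "\<mu> \<in> states A V" "\<nu> \<in> states A V" and x: "x \<in> S" "L x \<le> 1" for \<mu> \<nu> x
    proof -
      obtain w c where w: "w \<in> F" "nrm A (x \<ominus> scal c \<ominus> w) \<le> e" using F(3) x by blast
      have ws: "w \<in> S" using w F by blast
      then have z: "x \<ominus> scal c \<ominus> w \<in> S" using x by (intro S_diff) auto
      have "\<bar>\<kappa> (x \<ominus> scal c \<ominus> w)\<bar> \<le> e" "\<kappa> (x \<ominus> scal c \<ominus> w) = \<kappa> x - c - \<kappa> w" if "\<kappa> \<in> states A V" for \<kappa>
        using state_abs_le[OF that z] w(2) that x ws by (simp_all add: state_diff state_scal S_diff)
      from this[OF st(1)] this[OF st(2)] have "\<bar>\<mu> x - \<nu> x\<bar> \<le> 2 * e + \<bar>\<mu> w - \<nu> w\<bar>" by linarith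
      with w(1) show ?thesis by blast
    qed
    with F(1,2) show ?thesis by blast
  qed
  have fin: "rho A V L \<mu> \<nu> < \<infinity>" if st: "\<mu> \<in> states A V" "\<nu> \<in> states A V" for \<mu> \<nu>
  proof -
    obtain F where F: "finite F" "\<And>x. \<lbrakk>x \<in> S; L x \<le> 1\<rbrakk> \<Longrightarrow> \<exists>w\<in>F. \<bar>\<mu> x - \<nu> x\<bar> \<le> 2 * 1 + \<bar>\<mu> w - \<nu> w\<bar>"
      using net[of 1] st by (metis zero_less_one)
    have "rho A V L \<mu> \<nu> \<le> ennreal (2 + (\<Sum>w\<in>F. \<bar>\<mu> w - \<nu> w\<bar>))"
      unfolding rho_def
    proof (rule SUP_least)
      fix x assume "x \<in> {x \<in> S. L x \<le> 1}"
      then obtain w where w: "w \<in> F" "\<bar>\<mu> x - \<nu> x\<bar> \<le> 2 + \<bar>\<mu> w - \<nu> w\<bar>" using F(2) by auto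
      have "\<bar>\<mu> w - \<nu> w\<bar> \<le> (\<Sum>w\<in>F. \<bar>\<mu> w - \<nu> w\<bar>)"
        using F(1) w(1) by (intro member_le_sum) auto
      then show "ennreal \<bar>\<mu> x - \<nu> x\<bar> \<le> ennreal (2 + (\<Sum>w\<in>F. \<bar>\<mu> w - \<nu> w\<bar>))"
        using w(2) by (intro ennreal_leI) linarith
    qed
    then show ?thesis by (rule le_less_trans) simp
  qed
  have le_d: "\<bar>\<mu> x - \<nu> x\<bar> \<le> d \<mu> \<nu>" if "\<mu> \<in> states A V" "\<nu> \<in> states A V" "x \<in> S" "L x \<le> 1" for \<mu> \<nu> x
  proof -
    have "ennreal \<bar>\<mu> x - \<nu> x\<bar> \<le> rho A V L \<mu> \<nu>"
      unfolding rho_def using that by (intro SUP_upper) auto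
    moreover have "rho A V L \<mu> \<nu> = ennreal (d \<mu> \<nu>)" using fin[OF that(1,2)] by (simp add: d_def)
    ultimately show ?thesis by (metis ennreal_le_iff enn2real_nonneg d_def)
  qed
  have d_le: "d \<mu> \<nu> \<le> c" if "0 \<le> c" "\<And>x. \<lbrakk>x \<in> S; L x \<le> 1\<rbrakk> \<Longrightarrow> \<bar>\<mu> x - \<nu> x\<bar> \<le> c" for \<mu> \<nu> c
  proof -
    have "rho A V L \<mu> \<nu> \<le> ennreal c"
      unfolding rho_def using that by (intro SUP_least ennreal_leI) auto
    then show ?thesis unfolding d_def using that(1) by (simp add: enn2real_leI)
  qed
  have Lpos: "0 \<le> L x" if "x \<in> S" for x using L that by (simp add: seminorm_on_def)
  have lip: "\<bar>\<mu> x - \<nu> x\<bar> \<le> (L x + 1) * d \<mu> \<nu>" if st: "\<mu> \<in> states A V" "\<nu> \<in> states A V" and x: "x \<in> S" for \<mu> \<nu> x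
  proof -
    \<comment> \<open>The added 1 avoids dividing by zero when \<open>L x = 0\<close>.\<close>
    define r where "r = L x + 1"
    have r: "r > 0" "L x \<le> r" using Lpos[OF x] by (simp_all add: r_def)
    let ?y = "complex_of_real (1 / r) \<odot> x"
    have "L ?y = cmod (complex_of_real (1 / r)) * L x"
      using L x unfolding seminorm_on_def by (metis Reals_of_real)
    then have "L ?y \<le> 1" using r by (simp add: norm_divide)
    then have "\<bar>\<mu> ?y - \<nu> ?y\<bar> \<le> d \<mu> \<nu>" by (intro le_d st S_smult x)
    moreover have "\<mu> ?y - \<nu> ?y = (\<mu> x - \<nu> x) / r"
      using state_smult[OF st(1) x, of "1 / r"] state_smult[OF st(2) x, of "1 / r"]
      by (simp add: diff_divide_distrib)
    ultimately show ?thesis using r by (simp add: r_def divide_le_eq mult.commute)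
  qed
  have M: "Metric_space (states A V) d"
  proof
    show "0 \<le> d \<mu> \<nu>" for \<mu> \<nu> by (simp add: d_def)
    show "d \<mu> \<nu> = d \<nu> \<mu>" for \<mu> \<nu> by (simp add: d_def rho_def abs_minus_commute)
    show "(d \<mu> \<nu> = 0) = (\<mu> = \<nu>)" if st: "\<mu> \<in> states A V" "\<nu> \<in> states A V" for \<mu> \<nu>
    proof
      assume "d \<mu> \<nu> = 0"
      then have "\<mu> x = \<nu> x" if "x \<in> S" for x using lip[OF st that] by simp
      then show "\<mu> = \<nu>" using st by (intro extensionalityI[of _ S]) (auto simp: states_def)
    next
      assume "\<mu> = \<nu>"
      then show "d \<mu> \<nu> = 0" using d_le[of 0 \<mu> \<nu>] by (simp add: d_def order_antisym)
    qed
    show "d \<mu> \<kappa> \<le> d \<mu> \<nu> + d \<nu> \<kappa>"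
      if st: "\<mu> \<in> states A V" "\<nu> \<in> states A V" "\<kappa> \<in> states A V" for \<mu> \<nu> \<kappa>
    proof (rule d_le)
      show "0 \<le> d \<mu> \<nu> + d \<nu> \<kappa>" by (simp add: d_def)
      show "\<bar>\<mu> x - \<kappa> x\<bar> \<le> d \<mu> \<nu> + d \<nu> \<kappa>" if "x \<in> S" "L x \<le> 1" for x
        using le_d[OF st(1,2) that] le_d[OF st(2,3) that] by linarith
    qed
  qed
  interpret M: Metric_space "states A V" d by (rule M)
  have topX: "topspace ?X = states A V"
    using closedin_subset[OF closedin_states] by (auto simp: weak_star_topology_def)
  have ext: "states A V \<subseteq> extensional S" by (auto simp: states_def)
  have "M.mtopology = ?X"
  proof (rule topology_eq[THEN iffD2], intro allI iffI)
    fix U assume U: "openin ?X U"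
    have "continuous_map M.mtopology euclideanreal (\<lambda>\<mu>. \<mu> x)" if x: "x \<in> S" for x
      unfolding M.continuous_map_from_metric
    proof (intro conjI ballI allI impI)
      fix \<mu> W assume \<mu>: "\<mu> \<in> states A V" and W: "openin euclideanreal W \<and> \<mu> x \<in> W"
      then obtain e where e: "e > 0" "\<And>s. \<bar>s - \<mu> x\<bar> < e \<Longrightarrow> s \<in> W"
        unfolding open_openin[symmetric] open_dist dist_real_def by blast
      show "\<exists>r>0. \<forall>\<nu>. \<nu> \<in> states A V \<and> d \<mu> \<nu> < r \<longrightarrow> \<nu> x \<in> W"
      proof (intro exI conjI allI impI)
        show "e / (L x + 1) > 0" using e Lpos[OF x] by simp
        fix \<nu> assume \<nu>: "\<nu> \<in> states A V \<and> d \<mu> \<nu> < e / (L x + 1)"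
        then have "(L x + 1) * d \<mu> \<nu> < e" using Lpos[OF x] by (simp add: less_divide_eq mult.commute)
        then show "\<nu> x \<in> W" using lip[OF \<mu> _ x, of \<nu>] \<nu> by (intro e(2)) simp
      qed
    qed auto
    then have "continuous_map M.mtopology (powertop_real S) (\<lambda>\<mu>. \<mu>)"
      unfolding continuous_map_componentwise using ext by auto
    then have "continuous_map M.mtopology ?X (\<lambda>\<mu>. \<mu>)"
      unfolding weak_star_topology_def by (intro continuous_map_into_subtopology) auto
    then have "openin M.mtopology {\<mu> \<in> topspace M.mtopology. \<mu> \<in> U}"
      using U by (rule openin_continuous_map_preimage)
    moreover have "{\<mu> \<in> topspace M.mtopology. \<mu> \<in> U} = U"
      using openin_subset[OF U] topX by auto
    ultimately show "openin M.mtopology U" by simp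
  next
    fix U assume U: "openin M.mtopology U"
    have ev: "continuous_map ?X euclideanreal (\<lambda>\<nu>. \<nu> w)" if "w \<in> S" for w
      unfolding weak_star_topology_def using that
      by (intro continuous_map_from_subtopology continuous_map_product_projection)
    show "openin ?X U"
    proof (subst openin_subopen, rule ballI)
      fix \<mu> assume \<mu>: "\<mu> \<in> U"
      then have \<mu>s: "\<mu> \<in> states A V" using openin_subset[OF U] by auto
      obtain r where r: "r > 0" "M.mball \<mu> r \<subseteq> U"
        using U \<mu> unfolding M.openin_mtopology by blast
      \<comment> \<open>The net costs \<open>2 * e\<close> and the finitely many evaluations another
        \<open>e\<close>, which stays below \<open>r\<close>.\<close>
      define e where "e = r / 4"
      have e: "e > 0" using r by (simp add: e_def)
      obtain F where F: "finite F" "F \<subseteq> S" "\<forall>\<mu>\<in>states A V. \<forall>\<nu>\<in>states A V. \<forall>x\<in>S. L x \<le> 1 \<longrightarrow>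
        (\<exists>w\<in>F. \<bar>\<mu> x - \<nu> x\<bar> \<le> 2 * e + \<bar>\<mu> w - \<nu> w\<bar>)"
        using net[OF e] by (elim exE conjE)
      define T where "T = {\<nu> \<in> topspace ?X. \<forall>w\<in>F. \<nu> w \<in> ball (\<mu> w) e}"
      have "openin ?X T" unfolding T_def using F(1,2)
      proof (induction F rule: finite_induct)
        case (insert w F)
        have "openin ?X {\<nu> \<in> topspace ?X. \<nu> w \<in> ball (\<mu> w) e}"
          using insert.prems by (intro openin_continuous_map_preimage[OF ev]) auto
        moreover have "{\<nu> \<in> topspace ?X. \<forall>w\<in>insert w F. \<nu> w \<in> ball (\<mu> w) e} =
          {\<nu> \<in> topspace ?X. \<nu> w \<in> ball (\<mu> w) e} \<inter> {\<nu> \<in> topspace ?X. \<forall>w\<in>F. \<nu> w \<in> ball (\<mu> w) e}"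
          by blast
        ultimately show ?case using insert by (simp add: openin_Int)
      qed simp
      moreover have "\<mu> \<in> T" using \<mu>s e by (simp add: T_def topX)
      moreover have "T \<subseteq> U"
      proof
        fix \<nu> assume "\<nu> \<in> T"
        then have \<nu>: "\<nu> \<in> states A V" "\<And>w. w \<in> F \<Longrightarrow> \<bar>\<mu> w - \<nu> w\<bar> < e"
          by (auto simp: T_def topX dist_real_def)
        have "d \<mu> \<nu> \<le> 3 * e"
        proof (rule d_le)
          fix x assume x: "x \<in> S" "L x \<le> 1"
          then obtain w where "w \<in> F" "\<bar>\<mu> x - \<nu> x\<bar> \<le> 2 * e + \<bar>\<mu> w - \<nu> w\<bar>"
            using F(3) \<mu>s \<nu>(1) by blast
          then show "\<bar>\<mu> x - \<nu> x\<bar> \<le> 3 * e" using \<nu>(2)[of w] by simp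
        qed (use e in simp)
        then have "d \<mu> \<nu> < r" using r(1) by (simp add: e_def)
        then show "\<nu> \<in> U" using r(2) \<mu>s \<nu>(1) by auto
      qed
      ultimately show "\<exists>T. openin ?X T \<and> \<mu> \<in> T \<and> T \<subseteq> U" by blast
    qed
  qed
  then show ?thesis using fin M unfolding metrizes_states_def d_def by blast
qed

end

section \<open>Direct sums and quotients\<close>

text \<open>Ring facts about \<open>RDirProd\<close> and \<open>Quot\<close> concern plain ring
  records; this carries them to the C*-records built from the same operations.\<close>

lemma ring_cong:
  assumes "ring R" "carrier S = carrier R" "mult S = mult R" "one S = one R" "zero S = zero R"
    "add S = add R"
  shows "ring S"
proof -
  interpret R: ring R by fact
  have "abelian_group S"
  proof (rule abelian_groupI)
    show "\<exists>y\<in>carrier S. y \<oplus>\<^bsub>S\<^esub> x = \<zero>\<^bsub>S\<^esub>" if "x \<in> carrier S" for x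
      using that by (intro bexI[of _ "\<ominus>\<^bsub>R\<^esub> x"]) (simp_all add: assms(2-6) R.l_neg)
  qed (simp_all add: assms(2-6) R.a_ac)
  then show ?thesis
    by (rule ringI) (auto intro: monoidI simp: assms(2-6) R.m_assoc R.l_distr R.r_distr)
qed

section \<open>Direct sums of C*-algebras\<close>

lemma direct_sum_simps [simp]:
  "carrier (direct_sum A B) = carrier A \<times> carrier B"
  "(a, b) \<otimes>\<^bsub>direct_sum A B\<^esub> (c, d) = (a \<otimes>\<^bsub>A\<^esub> c, b \<otimes>\<^bsub>B\<^esub> d)"
  "(a, b) \<oplus>\<^bsub>direct_sum A B\<^esub> (c, d) = (a \<oplus>\<^bsub>A\<^esub> c, b \<oplus>\<^bsub>B\<^esub> d)"
  "\<one>\<^bsub>direct_sum A B\<^esub> = (\<one>\<^bsub>A\<^esub>, \<one>\<^bsub>B\<^esub>)" "\<zero>\<^bsub>direct_sum A B\<^esub> = (\<zero>\<^bsub>A\<^esub>, \<zero>\<^bsub>B\<^esub>)"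
  "r \<odot>\<^bsub>direct_sum A B\<^esub> (a, b) = (r \<odot>\<^bsub>A\<^esub> a, r \<odot>\<^bsub>B\<^esub> b)"
  "star (direct_sum A B) (a, b) = (star A a, star B b)"
  "nrm (direct_sum A B) (a, b) = max (nrm A a) (nrm B b)"
  by (simp_all add: direct_sum_def RDirProd_def DirProd_def monoid.defs)

lemma
  assumes "unital_cstar_algebra A" "unital_cstar_algebra B"
  shows unital_cstar_algebra_direct_sum: "unital_cstar_algebra (direct_sum A B)"
    and direct_sum_diff: "\<And>a b c d. \<lbrakk>a \<in> carrier A; b \<in> carrier B; c \<in> carrier A; d \<in> carrier B\<rbrakk> \<Longrightarrow>
      (a, b) \<ominus>\<^bsub>direct_sum A B\<^esub> (c, d) = (a \<ominus>\<^bsub>A\<^esub> c, b \<ominus>\<^bsub>B\<^esub> d)"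
proof -
  let ?D = "direct_sum A B"
  interpret A: unital_cstar_algebra A by fact
  interpret B: unital_cstar_algebra B by fact
  interpret D: ring ?D
    by (rule ring_cong[OF RDirProd_ring[OF A.ring_axioms B.ring_axioms]])
      (simp_all add: direct_sum_def)
  have minus: "\<ominus>\<^bsub>?D\<^esub> (a, b) = (\<ominus>\<^bsub>A\<^esub> a, \<ominus>\<^bsub>B\<^esub> b)" if "a \<in> carrier A" "b \<in> carrier B" for a b
    using that by (intro D.minus_equality) (auto simp: A.M.l_neg B.M.l_neg)
  show diff: "(a, b) \<ominus>\<^bsub>?D\<^esub> (c, d) = (a \<ominus>\<^bsub>A\<^esub> c, b \<ominus>\<^bsub>B\<^esub> d)"
    if "a \<in> carrier A" "b \<in> carrier B" "c \<in> carrier A" "d \<in> carrier B" for a b c d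
    using that by (simp add: D.minus_eq minus A.M.minus_eq B.M.minus_eq)
  have mod: "module complex_field ?D"
    by (rule moduleI[OF A.R.is_cring D.is_abelian_group])
      (auto simp: complex_field_def A.smult_add_left A.smult_add_right B.smult_add_left B.smult_add_right)
  have nonneg: "0 \<le> nrm ?D x" if "x \<in> carrier ?D" for x
    using that A.nrm_nonneg by (cases x) (auto simp: le_max_iff_disj)
  have zero: "nrm ?D x = 0 \<longleftrightarrow> x = \<zero>\<^bsub>?D\<^esub>" if "x \<in> carrier ?D" for x
    using that A.nrm_nonneg[of "fst x"] B.nrm_nonneg[of "snd x"] A.nrm_eq_zero_iff[of "fst x"]
      B.nrm_eq_zero_iff[of "snd x"] by (cases x) (auto simp: max_def split: if_splits)
  have triangle: "nrm ?D (x \<oplus>\<^bsub>?D\<^esub> y) \<le> nrm ?D x + nrm ?D y" if "x \<in> carrier ?D" "y \<in> carrier ?D" for x y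
  proof -
    obtain a b c d where "x = (a, b)" "y = (c, d)" by (cases x; cases y)
    then show ?thesis using that A.nrm_triangle[of a c] B.nrm_triangle[of b d] by (simp; linarith)
  qed
  \<comment> \<open>Completeness is one of the axioms being established, so the metric is obtained
    from the norm axioms alone.\<close>
  interpret M: Metric_space "carrier ?D" "cdist ?D"
    using nonneg zero triangle
    by (intro cdist_Metric_space D.is_abelian_group) (auto simp: minus)
  have complete: "M.mcomplete"
    unfolding M.mcomplete_def
  proof (intro allI impI)
    fix s :: "nat \<Rightarrow> 'a \<times> 'b" assume s: "M.MCauchy s"
    define a b where "a n = fst (s n)" and "b n = snd (s n)" for n
    have sab: "s n = (a n, b n)" for n by (simp add: a_def b_def)
    have "range s \<subseteq> carrier A \<times> carrier B" using s[unfolded M.MCauchy_def] by simp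
    then have c: "a n \<in> carrier A" "b n \<in> carrier B" for n
      unfolding a_def b_def by (metis mem_Times_iff rangeI subsetD)+
    have d: "cdist ?D (a m, b m) (x, y) = max (nrm A (a m \<ominus>\<^bsub>A\<^esub> x)) (nrm B (b m \<ominus>\<^bsub>B\<^esub> y))"
      if "x \<in> carrier A" "y \<in> carrier B" for m x y
      using c that by (simp add: cdist_def diff)
    have "\<exists>N. \<forall>m\<ge>N. \<forall>n\<ge>N. max (nrm A (a m \<ominus>\<^bsub>A\<^esub> a n)) (nrm B (b m \<ominus>\<^bsub>B\<^esub> b n)) < e" if "e > 0" for e
    proof -
      have "\<exists>N. \<forall>m n. N \<le> m \<longrightarrow> N \<le> n \<longrightarrow> cdist ?D (s m) (s n) < e"
        using s[unfolded M.MCauchy_def] \<open>e > 0\<close> by simp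
      then show ?thesis unfolding sab d[OF c] by simp
    qed
    then have "\<And>e. e > 0 \<Longrightarrow> \<exists>N. \<forall>m\<ge>N. \<forall>n\<ge>N. nrm A (a m \<ominus>\<^bsub>A\<^esub> a n) < e"
      "\<And>e. e > 0 \<Longrightarrow> \<exists>N. \<forall>m\<ge>N. \<forall>n\<ge>N. nrm B (b m \<ominus>\<^bsub>B\<^esub> b n) < e"
      unfolding max_less_iff_conj by blast+
    then obtain x y where x: "x \<in> carrier A" "A.conv a x" and y: "y \<in> carrier B" "B.conv b y"
      using A.complete_conv[of a, OF c(1)] B.complete_conv[of b, OF c(2)] by metis
    have "(\<lambda>n. cdist ?D (s n) (x, y)) \<longlonglongrightarrow> 0"
      unfolding sab d[OF x(1) y(1)] using tendsto_max[OF x(2) y(2)] by simp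
    then have "limitin M.mtopology s (x, y) sequentially"
      unfolding M.limitin_metric_dist_null using x y c by (auto simp: sab)
    then show "\<exists>z. limitin M.mtopology s z sequentially" by blast
  qed
  have max2: "max (x\<^sup>2) (y\<^sup>2) = (max x y)\<^sup>2" if "0 \<le> x" "0 \<le> y" for x y :: real
    using that power_mono[of x y 2] power_mono[of y x 2] by (auto simp: max_def)
  show "unital_cstar_algebra ?D"
  proof (intro unital_cstar_algebra.intro mod D.ring_axioms unital_cstar_algebra_axioms.intro
      nonneg zero triangle complete)
    show "nrm ?D (x \<otimes>\<^bsub>?D\<^esub> y) \<le> nrm ?D x * nrm ?D y" if "x \<in> carrier ?D" "y \<in> carrier ?D" for x y
    proof -
      obtain a b c d where xy: "x = (a, b)" "y = (c, d)" by (cases x; cases y)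
      then have "nrm A a * nrm A c \<le> max (nrm A a) (nrm B b) * max (nrm A c) (nrm B d)"
        "nrm B b * nrm B d \<le> max (nrm A a) (nrm B b) * max (nrm A c) (nrm B d)"
        using that by (auto intro!: mult_mono A.nrm_nonneg B.nrm_nonneg simp: le_max_iff_disj)
      then show ?thesis
        using xy that A.nrm_mult[of a c] B.nrm_mult[of b d] by simp
    qed
    show "nrm ?D (c \<odot>\<^bsub>?D\<^esub> x) = cmod c * nrm ?D x" if "x \<in> carrier ?D" for c x
      using that by (cases x) (auto simp: A.nrm_smult B.nrm_smult max_mult_distrib_left)
    show "nrm ?D (star ?D x \<otimes>\<^bsub>?D\<^esub> x) = (nrm ?D x)\<^sup>2" if "x \<in> carrier ?D" for x
      using that by (cases x) (auto simp: A.cstar_identity B.cstar_identity max2 A.nrm_nonneg B.nrm_nonneg)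
  qed (auto simp: A.smult_mult_left B.smult_mult_left A.smult_mult_right B.smult_mult_right
      A.star_add B.star_add A.star_smult B.star_smult A.star_mult B.star_mult)
qed

text \<open>Multiplying a representative by an element \<open>u\<close> of the approximate unit does not change its
  class, but makes a given element of the ideal small; this yields the C*-identity of the quotient norm.\<close>

locale central_quotient = unital_cstar_algebra + ideal I A for I +
  assumes closed_ideal: "closedin (norm_topology A) I"
    and star_ideal: "x \<in> I \<Longrightarrow> star A x \<in> I"
    and approximate_unit: "\<lbrakk>x \<in> I; e > 0\<rbrakk> \<Longrightarrow>
      \<exists>u\<in>herm. u \<in> centre A \<and> nrm A u \<le> 1 \<and> \<one> \<ominus> u \<in> I \<and> nrm A (u \<otimes> x) \<le> e"
begin

abbreviation coset :: "'a \<Rightarrow> 'a set" where "coset x \<equiv> I +> x"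

abbreviation Q where "Q \<equiv> quotient_cstar A I"

section \<open>Quotients by an ideal with a central approximate unit\<close>

lemma I_in: "x \<in> I \<Longrightarrow> x \<in> carrier A"
  by (rule Icarr)

lemma zero_in_I: "\<zero> \<in> I"
  by (rule additive_subgroup.zero_closed[OF additive_subgroup_axioms])

lemma I_smult: "x \<in> I \<Longrightarrow> c \<odot> x \<in> I"
  using I_l_closed[of x "c \<odot> \<one>"] I_in by (simp add: smult_mult_left)

lemma coset_eq_iff: "\<lbrakk>x \<in> carrier A; y \<in> carrier A\<rbrakk> \<Longrightarrow> coset x = coset y \<longleftrightarrow> x \<ominus> y \<in> I"
  using quotient_eq_iff_same_a_r_cos[OF ideal_axioms] by blast

lemma coset_elems: "coset x = (\<lambda>i. i \<oplus> x) ` I"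
  by (auto simp: a_r_coset_def')

lemma Q_carrier: "carrier Q = coset ` carrier A"
  by (auto simp: quotient_cstar_def FactRing_def A_RCOSETS_def')

lemma Q_ring: "ring Q"
  by (rule ring_cong[OF quotient_is_ring]) (simp_all add: quotient_cstar_def)

lemma Q_add: "\<lbrakk>x \<in> carrier A; y \<in> carrier A\<rbrakk> \<Longrightarrow> coset x \<oplus>\<^bsub>Q\<^esub> coset y = coset (x \<oplus> y)"
  and Q_mult: "\<lbrakk>x \<in> carrier A; y \<in> carrier A\<rbrakk> \<Longrightarrow> coset x \<otimes>\<^bsub>Q\<^esub> coset y = coset (x \<otimes> y)"
  and Q_one: "\<one>\<^bsub>Q\<^esub> = coset \<one>"
  using ring_hom_add[OF rcos_ring_hom, of x y] ring_hom_mult[OF rcos_ring_hom, of x y]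
    ring_hom_one[OF rcos_ring_hom]
  by (simp_all add: quotient_cstar_def)

lemma Q_zero: "\<zero>\<^bsub>Q\<^esub> = coset \<zero>"
proof -
  interpret Q: ring Q by (rule Q_ring)
  have c: "coset \<zero> \<in> carrier Q" by (simp add: Q_carrier)
  have "coset \<zero> \<oplus>\<^bsub>Q\<^esub> coset \<zero> = coset \<zero>" by (simp add: Q_add)
  then have "coset \<zero> \<ominus>\<^bsub>Q\<^esub> coset \<zero> = coset \<zero>"
    using c by (metis Q.add.inv_solve_right Q.minus_eq Q.r_neg Q.add.r_cancel_one)
  then show ?thesis using c by (simp add: Q.minus_eq Q.r_neg)
qed

text \<open>Operations on cosets are unions over representatives; such a union is a single coset
  once all its members agree and the index set is nonempty.\<close>

lemma coset_Union_const:
  assumes x: "x \<in> carrier A" and f: "\<And>i. i \<in> I \<Longrightarrow> f (i \<oplus> x) \<in> carrier A \<and> f (i \<oplus> x) \<ominus> f x \<in> I"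
    and fx: "f x \<in> carrier A"
  shows "(\<Union>y\<in>coset x. coset (f y)) = coset (f x)"
proof -
  have "coset (f y) = coset (f x)" if y: "y \<in> coset x" for y
  proof -
    obtain i where "i \<in> I" "y = i \<oplus> x" using y unfolding coset_elems by blast
    then show ?thesis using f[of i] coset_eq_iff[OF _ fx, of "f y"] by simp
  qed
  moreover have "coset x \<noteq> {}" using zero_in_I unfolding coset_elems by blast
  ultimately show ?thesis by simp
qed

lemma Q_smult:
  assumes "x \<in> carrier A"
  shows "c \<odot>\<^bsub>Q\<^esub> coset x = coset (c \<odot> x)"
proof -
  have "c \<odot> (i \<oplus> x) \<ominus> c \<odot> x = c \<odot> i" if "i \<in> I" for i
    using assms I_in[OF that] by (simp add: smult_add_right M.minus_eq M.a_assoc M.r_neg)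
  then have "(\<Union>y\<in>coset x. coset (c \<odot> y)) = coset (c \<odot> x)"
    using assms I_in I_smult by (intro coset_Union_const) auto
  then show ?thesis by (simp add: quotient_cstar_def)
qed

lemma Q_star:
  assumes "x \<in> carrier A"
  shows "star Q (coset x) = coset (star A x)"
proof -
  have "star A (i \<oplus> x) \<ominus> star A x = star A i" if "i \<in> I" for i
    using assms I_in[OF that] by (simp add: star_add M.minus_eq M.a_assoc M.r_neg)
  then have "(\<Union>y\<in>coset x. coset (star A y)) = coset (star A x)"
    using assms I_in star_ideal by (intro coset_Union_const) auto
  then show ?thesis by (simp add: quotient_cstar_def)
qed

lemma Q_nrm_le:
  assumes "x \<in> carrier A" "i \<in> I"
  shows "nrm Q (coset x) \<le> nrm A (i \<oplus> x)"
  unfolding quotient_cstar_def using assms I_in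
  by (auto simp: coset_elems intro!: cINF_lower2 bdd_belowI[of _ 0] nrm_nonneg)

lemma Q_nrm_le_nrm: "x \<in> carrier A \<Longrightarrow> nrm Q (coset x) \<le> nrm A x"
  using Q_nrm_le[of x \<zero>] zero_in_I by simp

lemma le_Q_nrm:
  assumes "x \<in> carrier A" "\<And>i. i \<in> I \<Longrightarrow> c \<le> nrm A (i \<oplus> x)"
  shows "c \<le> nrm Q (coset x)"
proof -
  have "coset x \<noteq> {}" using zero_in_I unfolding coset_elems by blast
  then have "c \<le> Inf (nrm A ` coset x)"
    using assms(2) by (intro cINF_greatest) (auto simp: coset_elems)
  then show ?thesis by (simp add: quotient_cstar_def)
qed

lemma Q_nrm_approx:
  assumes "x \<in> carrier A" "e > 0"
  obtains i where "i \<in> I" "nrm A (i \<oplus> x) < nrm Q (coset x) + e"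
proof -
  have "\<exists>i\<in>I. nrm A (i \<oplus> x) < nrm Q (coset x) + e"
  proof (rule ccontr)
    assume "\<not> (\<exists>i\<in>I. nrm A (i \<oplus> x) < nrm Q (coset x) + e)"
    then have "nrm Q (coset x) + e \<le> nrm Q (coset x)"
      using assms by (intro le_Q_nrm) (auto simp: not_less)
    then show False using assms by simp
  qed
  then show thesis using that by blast
qed

lemma Q_cstar: "unital_cstar_algebra Q"
proof -
  interpret Q: ring Q by (rule Q_ring)
  have ex: "\<exists>x\<in>carrier A. X = coset x" if "X \<in> carrier Q" for X
    using that by (auto simp: Q_carrier)
  have cc: "coset x \<in> carrier Q" if "x \<in> carrier A" for x
    using that by (simp add: Q_carrier)
  have minus: "\<ominus>\<^bsub>Q\<^esub> coset x = coset (\<ominus> x)" if "x \<in> carrier A" for x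
    using that by (intro Q.minus_equality) (simp_all add: Q_add Q_zero cc M.l_neg)
  have diff: "coset x \<ominus>\<^bsub>Q\<^esub> coset y = coset (x \<ominus> y)" if "x \<in> carrier A" "y \<in> carrier A" for x y
    using that by (simp add: Q.minus_eq minus Q_add M.minus_eq)
  have mod: "module complex_field Q"
  proof (rule moduleI[OF R.is_cring Q.is_abelian_group])
  qed (auto dest!: ex simp: complex_field_def Q_smult cc Q_add smult_add_left smult_add_right)
  have nonneg: "0 \<le> nrm Q X" if X: "X \<in> carrier Q" for X
  proof -
    obtain x where "x \<in> carrier A" "X = coset x" using ex[OF X] by blast
    then show ?thesis using I_in by (auto intro!: le_Q_nrm nrm_nonneg)
  qed
  have zero: "nrm Q X = 0 \<longleftrightarrow> X = \<zero>\<^bsub>Q\<^esub>" if X: "X \<in> carrier Q" for X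
  proof -
    obtain x where x: "x \<in> carrier A" "X = coset x" using ex[OF X] by blast
    show ?thesis
    proof
      assume "X = \<zero>\<^bsub>Q\<^esub>"
      then show "nrm Q X = 0" using Q_nrm_le_nrm[of \<zero>] nonneg[OF X] by (simp add: Q_zero)
    next
      assume 0: "nrm Q X = 0"
      \<comment> \<open>Norm zero gives elements of \<open>I\<close> arbitrarily close to
        \<open>x\<close>, and \<open>I\<close> is closed.\<close>
      have "x \<in> I"
      proof (rule ccontr)
        assume "x \<notin> I"
        then have "x \<in> carrier A - I" using x by simp
        then obtain r where r: "r > 0" "disjnt I (mball x r)"
          using closed_ideal unfolding norm_topology_def closedin_metric by blast
        obtain i where i: "i \<in> I" "nrm A (i \<oplus> x) < r"
          using Q_nrm_approx[OF x(1) r(1)] 0 x(2) by auto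
        have ic: "i \<in> carrier A" using I_in[OF i(1)] .
        then have "cdist A x (\<ominus> i) < r"
          using i x(1) by (simp add: cdist_def M.minus_eq M.a_comm)
        then have "\<ominus> i \<in> mball x r" using ic x(1) by simp
        moreover have "\<ominus> i \<in> I" using I_smult[OF i(1), of "-1"] ic by (simp add: a_inv_smult)
        ultimately show False using r(2) by (auto simp: disjnt_def)
      qed
      then have "x \<ominus> \<zero> \<in> I" using x by (simp add: M.minus_eq)
      then show "X = \<zero>\<^bsub>Q\<^esub>" using coset_eq_iff[OF x(1), of \<zero>] x(2) by (simp add: Q_zero)
    qed
  qed
  have triangle: "nrm Q (X \<oplus>\<^bsub>Q\<^esub> Y) \<le> nrm Q X + nrm Q Y" if XY: "X \<in> carrier Q" "Y \<in> carrier Q" for X Y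
  proof (rule field_le_epsilon)
    fix e :: real assume "e > 0"
    then have e: "e / 2 > 0" by simp
    obtain x where x: "x \<in> carrier A" "X = coset x" using ex[OF XY(1)] by blast
    obtain y where y: "y \<in> carrier A" "Y = coset y" using ex[OF XY(2)] by blast
    obtain i where i: "i \<in> I" "nrm A (i \<oplus> x) < nrm Q X + e / 2" using Q_nrm_approx[OF x(1) e] x by blast
    obtain k where k: "k \<in> I" "nrm A (k \<oplus> y) < nrm Q Y + e / 2" using Q_nrm_approx[OF y(1) e] y by blast
    note c = x(1) y(1) I_in[OF i(1)] I_in[OF k(1)]
    have "(i \<oplus> k) \<oplus> (x \<oplus> y) = (i \<oplus> x) \<oplus> (k \<oplus> y)" using c by (simp add: M.a_ac)
    then have "nrm Q (coset (x \<oplus> y)) \<le> nrm A (i \<oplus> x) + nrm A (k \<oplus> y)"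
      using Q_nrm_le[of "x \<oplus> y" "i \<oplus> k"] nrm_triangle[of "i \<oplus> x" "k \<oplus> y"] c a_closed[OF i(1) k(1)] by simp
    then show "nrm Q (X \<oplus>\<^bsub>Q\<^esub> Y) \<le> nrm Q X + nrm Q Y + e" using i k x y by (simp add: Q_add)
  qed
  have mult: "nrm Q (X \<otimes>\<^bsub>Q\<^esub> Y) \<le> nrm Q X * nrm Q Y" if XY: "X \<in> carrier Q" "Y \<in> carrier Q" for X Y
  proof -
    obtain x where x: "x \<in> carrier A" "X = coset x" using ex[OF XY(1)] by blast
    obtain y where y: "y \<in> carrier A" "Y = coset y" using ex[OF XY(2)] by blast
    \<comment> \<open>Representatives that nearly attain both infima are multiplied; the slack
      \<open>e\<close> is removed by a limit below.\<close>
    have le: "nrm Q (X \<otimes>\<^bsub>Q\<^esub> Y) \<le> (nrm Q X + e) * (nrm Q Y + e)" if e: "e > 0" for e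
    proof -
      obtain i where i: "i \<in> I" "nrm A (i \<oplus> x) < nrm Q X + e" using Q_nrm_approx[OF x(1) e] x by blast
      obtain k where k: "k \<in> I" "nrm A (k \<oplus> y) < nrm Q Y + e" using Q_nrm_approx[OF y(1) e] y by blast
      note c = x(1) y(1) I_in[OF i(1)] I_in[OF k(1)]
      have "coset (i \<oplus> x) = X" "coset (k \<oplus> y) = Y"
        using c i k x y coset_eq_iff[of "i \<oplus> x" x] coset_eq_iff[of "k \<oplus> y" y]
        by (simp_all add: M.minus_eq M.a_assoc M.r_neg)
      then have "X \<otimes>\<^bsub>Q\<^esub> Y = coset ((i \<oplus> x) \<otimes> (k \<oplus> y))" using c Q_mult[of "i \<oplus> x" "k \<oplus> y"] by simp
      then have "nrm Q (X \<otimes>\<^bsub>Q\<^esub> Y) \<le> nrm A (i \<oplus> x) * nrm A (k \<oplus> y)"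
        using Q_nrm_le_nrm[of "(i \<oplus> x) \<otimes> (k \<oplus> y)"] nrm_mult[of "i \<oplus> x" "k \<oplus> y"] c by simp
      also have "\<dots> \<le> (nrm Q X + e) * (nrm Q Y + e)"
        using i k c nrm_nonneg[of "k \<oplus> y"] nonneg[OF XY(1)] e by (intro mult_mono) auto
      finally show ?thesis .
    qed
    have "((\<lambda>e. (nrm Q X + e) * (nrm Q Y + e)) \<longlongrightarrow> (nrm Q X + 0) * (nrm Q Y + 0)) (at_right 0)"
      by (intro tendsto_intros)
    then show ?thesis
      using tendsto_lowerbound[of _ _ "at_right (0::real)" "nrm Q (X \<otimes>\<^bsub>Q\<^esub> Y)"] le
      by (force simp: eventually_at_right_less intro: eventually_mono[OF eventually_at_right_less[of 0]])
  qed
  have smult: "nrm Q (c \<odot>\<^bsub>Q\<^esub> X) = cmod c * nrm Q X" if X: "X \<in> carrier Q" for c X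
  proof -
    obtain x where x: "x \<in> carrier A" "X = coset x" using ex[OF X] by blast
    have le: "nrm Q (coset (c \<odot> x)) \<le> cmod c * nrm Q (coset x)" if x: "x \<in> carrier A" for c x
    proof (cases "c = 0")
      case True
      then show ?thesis using x Q_nrm_le_nrm[of \<zero>] by simp
    next
      case False
      have "nrm Q (coset (c \<odot> x)) / cmod c \<le> nrm Q (coset x)"
      proof (rule le_Q_nrm[OF x])
        fix i assume i: "i \<in> I"
        have "nrm Q (coset (c \<odot> x)) \<le> nrm A (c \<odot> i \<oplus> c \<odot> x)"
          using x I_smult[OF i] by (intro Q_nrm_le) auto
        also have "\<dots> = cmod c * nrm A (i \<oplus> x)"
          using x I_in[OF i] nrm_smult[of "i \<oplus> x" c] by (simp add: smult_add_right)
        finally show "nrm Q (coset (c \<odot> x)) / cmod c \<le> nrm A (i \<oplus> x)"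
          using False by (simp add: divide_le_eq mult.commute)
      qed
      then show ?thesis using False by (simp add: divide_le_eq mult.commute)
    qed
    show ?thesis
    proof (cases "c = 0")
      case True
      then show ?thesis using zero[of "coset \<zero>"] x cc by (simp add: Q_smult Q_zero)
    next
      case False
      have "nrm Q (coset x) \<le> cmod (1 / c) * nrm Q (coset (c \<odot> x))"
        using le[of "c \<odot> x" "1 / c"] x False by simp
      then have "cmod c * nrm Q (coset x) \<le> nrm Q (coset (c \<odot> x))"
        using False by (simp add: norm_divide field_simps)
      then show ?thesis using le[OF x(1), of c] x by (simp add: Q_smult)
    qed
  qed
  have star: "nrm Q (star Q X) \<le> nrm Q X" if X: "X \<in> carrier Q" for X
  proof -
    obtain x where x: "x \<in> carrier A" "X = coset x" using ex[OF X] by blast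
    have "nrm Q (coset (star A x)) \<le> nrm Q (coset x)"
    proof (rule le_Q_nrm[OF x(1)])
      fix i assume i: "i \<in> I"
      have "nrm Q (coset (star A x)) \<le> nrm A (star A i \<oplus> star A x)"
        using x star_ideal[OF i] by (intro Q_nrm_le) auto
      also have "\<dots> = nrm A (i \<oplus> x)"
        using x I_in[OF i] nrm_star[of "i \<oplus> x"] by (simp add: star_add)
      finally show "nrm Q (coset (star A x)) \<le> nrm A (i \<oplus> x)" .
    qed
    then show ?thesis using x by (simp add: Q_star)
  qed
  have cstar: "nrm Q (star Q X \<otimes>\<^bsub>Q\<^esub> X) = (nrm Q X)\<^sup>2" if X: "X \<in> carrier Q" for X
  proof (rule antisym)
    obtain x where x: "x \<in> carrier A" "X = coset x" using ex[OF X] by blast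
    have "nrm Q (star Q X \<otimes>\<^bsub>Q\<^esub> X) \<le> nrm Q (star Q X) * nrm Q X"
      using x by (intro mult X) (simp add: Q_star cc)
    also have "\<dots> \<le> (nrm Q X)\<^sup>2"
      using star[OF X] nonneg[OF X] by (simp add: power2_eq_square mult_right_mono)
    finally show "nrm Q (star Q X \<otimes>\<^bsub>Q\<^esub> X) \<le> (nrm Q X)\<^sup>2" .
    have sx: "star A x \<otimes> x \<in> carrier A" using x by simp
    have "(nrm Q X)\<^sup>2 \<le> nrm Q (coset (star A x \<otimes> x))"
    proof (rule le_Q_nrm[OF sx], rule field_le_epsilon)
      fix i and e :: real assume i: "i \<in> I" and e: "e > 0"
      obtain u where u: "u \<in> herm" "u \<in> centre A" "nrm A u \<le> 1" "\<one> \<ominus> u \<in> I" "nrm A (u \<otimes> i) \<le> e"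
        using approximate_unit[OF i e] by blast
      have uc: "u \<in> carrier A" "star A u = u" and com: "\<And>y. y \<in> carrier A \<Longrightarrow> u \<otimes> y = y \<otimes> u"
        using u(1,2) hermD by (auto simp: centre_def)
      note c = x(1) uc I_in[OF i]
      have n: "nrm A (u \<otimes> y) \<le> nrm A y" if "y \<in> carrier A" for y
        using nrm_mult[OF uc(1) that] u(3) nrm_nonneg[OF that] mult_right_mono[of "nrm A u" 1 "nrm A y"]
        by simp
      have "x \<ominus> u \<otimes> x = (\<one> \<ominus> u) \<otimes> x" using c by (simp add: mult_diff_left)
      then have "X = coset (u \<otimes> x)"
        using coset_eq_iff[of x "u \<otimes> x"] I_r_closed[OF u(4) x(1)] c x(2) by simp
      then have "(nrm Q X)\<^sup>2 \<le> (nrm A (u \<otimes> x))\<^sup>2"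
        using Q_nrm_le_nrm[of "u \<otimes> x"] c nonneg[OF X] by (simp add: power_mono)
      also have "\<dots> = nrm A (star A (u \<otimes> x) \<otimes> (u \<otimes> x))" using c by (simp add: cstar_identity)
      also have "star A (u \<otimes> x) \<otimes> (u \<otimes> x) = u \<otimes> (u \<otimes> (star A x \<otimes> x))"
        using c by (simp add: star_mult) (metis com m_assoc m_closed star_closed)
      also have "nrm A (u \<otimes> (u \<otimes> (star A x \<otimes> x))) \<le> nrm A (u \<otimes> (star A x \<otimes> x))"
        using c by (intro n) auto
      \<comment> \<open>Brings back the given representative
        \<open>i \<oplus> star A x \<otimes> x\<close>; the subtracted term
        \<open>u \<otimes> i\<close> is small by the choice of \<open>u\<close>.\<close>
      also have "u \<otimes> (star A x \<otimes> x) = u \<otimes> (i \<oplus> star A x \<otimes> x) \<ominus> u \<otimes> i"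
      proof -
        have "u \<otimes> (i \<oplus> star A x \<otimes> x) \<ominus> u \<otimes> i = (u \<otimes> (star A x \<otimes> x) \<oplus> u \<otimes> i) \<oplus> \<ominus> (u \<otimes> i)"
          using c by (simp add: r_distr M.minus_eq M.a_comm)
        then show ?thesis using c by (simp add: M.a_assoc M.r_neg)
      qed
      also have "nrm A (u \<otimes> (i \<oplus> star A x \<otimes> x) \<ominus> u \<otimes> i) \<le> nrm A (u \<otimes> (i \<oplus> star A x \<otimes> x)) + nrm A (u \<otimes> i)"
        using c by (intro nrm_triangle_diff) auto
      also have "\<dots> \<le> nrm A (i \<oplus> star A x \<otimes> x) + e"
        using n[of "i \<oplus> star A x \<otimes> x"] c u(5) by simp
      finally show "(nrm Q X)\<^sup>2 \<le> nrm A (i \<oplus> star A x \<otimes> x) + e" .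
    qed
    then show "(nrm Q X)\<^sup>2 \<le> nrm Q (star Q X \<otimes>\<^bsub>Q\<^esub> X)" using x by (simp add: Q_star Q_mult)
  qed
  interpret M: Metric_space "carrier Q" "cdist Q"
  proof (rule cdist_Metric_space[OF Q.is_abelian_group nonneg zero _ triangle])
    fix X assume X: "X \<in> carrier Q"
    obtain x where x: "x \<in> carrier A" "X = coset x" using ex[OF X] by blast
    then have "\<ominus>\<^bsub>Q\<^esub> X = (- 1) \<odot>\<^bsub>Q\<^esub> X" by (simp add: minus Q_smult a_inv_smult)
    then show "nrm Q (\<ominus>\<^bsub>Q\<^esub> X) = nrm Q X" using smult[OF X, of "-1"] by simp
  qed
  have complete: "M.mcomplete"
    unfolding M.mcomplete_def
  proof (intro allI impI)
    fix s assume s: "M.MCauchy s"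
    have sc: "s n \<in> carrier Q" for n using s[unfolded M.MCauchy_def] by blast
    have cauchy: "\<forall>e>0. \<exists>N. \<forall>m n. N \<le> m \<longrightarrow> N \<le> n \<longrightarrow> cdist Q (s m) (s n) < e"
      using s[unfolded M.MCauchy_def] by (rule conjunct2)
    have "\<forall>k. \<exists>N. \<forall>m n. N \<le> m \<longrightarrow> N \<le> n \<longrightarrow> cdist Q (s m) (s n) < (1/2) ^ k"
      by (intro allI cauchy[rule_format]) simp
    from choice[OF this] obtain N where
      N: "\<forall>k m n. N k \<le> m \<longrightarrow> N k \<le> n \<longrightarrow> cdist Q (s m) (s n) < (1/2) ^ k" by (rule exE)
    \<comment> \<open>The summand \<open>k\<close> makes the indices strictly increasing, and the
      sum keeps them beyond \<open>N k\<close>.\<close>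
    define r where "r k = k + (\<Sum>i\<le>k. N i)" for k
    have mono: "strict_mono r" unfolding strict_mono_Suc_iff by (simp add: r_def)
    have rN: "N k \<le> r k" for k unfolding r_def using member_le_sum[of k "{..k}" N] by simp
    have close: "cdist Q (s (r (Suc k))) (s (r k)) < (1/2) ^ k" for k
      using N[rule_format, of k "r (Suc k)" "r k"] rN[of k] strict_mono_less_eq[OF mono, of k "Suc k"] by simp
    \<comment> \<open>Representatives are lifted one after the other, each within
      \<open>(1/2) ^ k\<close> of the last, so that they form a Cauchy sequence in
      \<open>A\<close>.\<close>
    have step: "\<exists>y\<in>carrier A. coset y = s (r (Suc k)) \<and> nrm A (y \<ominus> x) < (1/2) ^ k"
      if x: "x \<in> carrier A" "coset x = s (r k)" for x k
    proof -
      obtain z where z: "z \<in> carrier A" "s (r (Suc k)) = coset z" using ex[OF sc[of "r (Suc k)"]] by blast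
      have "cdist Q (coset z) (coset x) < (1/2) ^ k" using close[of k] unfolding x(2) z(2) .
      then have "nrm Q (coset (z \<ominus> x)) < (1/2) ^ k" using x(1) z(1) by (simp add: cdist_def diff cc)
      then have "(1/2) ^ k - nrm Q (coset (z \<ominus> x)) > 0" by simp
      then obtain i where i: "i \<in> I" "nrm A (i \<oplus> (z \<ominus> x)) < (1/2) ^ k"
        using Q_nrm_approx[of "z \<ominus> x" "(1/2) ^ k - nrm Q (coset (z \<ominus> x))"] x z by auto
      note c = I_in[OF i(1)] x(1) z(1)
      have "coset (i \<oplus> z) = coset z"
        using c i coset_eq_iff[of "i \<oplus> z" z] by (simp add: M.minus_eq M.a_assoc M.r_neg)
      moreover have "i \<oplus> z \<ominus> x = i \<oplus> (z \<ominus> x)" using c by (simp add: M.minus_eq M.a_assoc)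
      ultimately show ?thesis using c i z by (intro bexI[of _ "i \<oplus> z"]) auto
    qed
    obtain x0 where x0: "x0 \<in> carrier A" "s (r 0) = coset x0" using ex[OF sc[of "r 0"]] by blast
    have "\<exists>a. \<forall>k. (a k \<in> carrier A \<and> coset (a k) = s (r k)) \<and> nrm A (a (Suc k) \<ominus> a k) < (1/2) ^ k"
    proof (rule dependent_nat_choice)
      show "\<exists>x. x \<in> carrier A \<and> coset x = s (r 0)" using x0 by metis
      fix x k assume "x \<in> carrier A \<and> coset x = s (r k)"
      then show "\<exists>y. (y \<in> carrier A \<and> coset y = s (r (Suc k))) \<and> nrm A (y \<ominus> x) < (1/2) ^ k"
        using step[of x k] by blast
    qed
    then obtain a where a0: "\<forall>k. (a k \<in> carrier A \<and> coset (a k) = s (r k)) \<and>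
        nrm A (a (Suc k) \<ominus> a k) < (1/2) ^ k" by (rule exE)
    have a: "a k \<in> carrier A" "coset (a k) = s (r k)" "nrm A (a (Suc k) \<ominus> a k) < (1/2) ^ k" for k
      using a0 by blast+
    have tail: "nrm A (a n \<ominus> a m) \<le> 2 * (1/2) ^ m - 2 * (1/2) ^ n" if "m \<le> n" for m n
      using that
    proof (induction n rule: dec_induct)
      case (step n)
      then show ?case
        using nrm_diff_triangle[OF a(1) a(1) a(1), of "Suc n" m n] a(3)[of n] by simp
    qed (simp add: M.minus_eq M.r_neg a)
    have cau: "\<exists>N. \<forall>m\<ge>N. \<forall>n\<ge>N. nrm A (a m \<ominus> a n) < e" if e: "e > 0" for e
    proof -
      obtain N where N: "(1/2) ^ N < e / 2" using real_arch_pow_inv[of "e/2" "1/2"] e by auto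
      have "nrm A (a m \<ominus> a n) < e" if mn: "m \<ge> N" "n \<ge> N" for m n
      proof -
        have p: "(1/2) ^ m \<le> ((1/2) ^ N :: real)" "(1/2) ^ n \<le> ((1/2) ^ N :: real)"
          "0 < ((1/2) ^ m :: real)" "0 < ((1/2) ^ n :: real)"
          using mn by (simp_all add: power_decreasing)
        show ?thesis
        proof (cases "m \<le> n")
          case True
          then show ?thesis using tail[OF True] nrm_diff_commute[OF a(1) a(1), of m n] p N by linarith
        next
          case False
          then show ?thesis using tail[of n m] p N by linarith
        qed
      qed
      then show ?thesis by blast
    qed
    obtain l where l: "l \<in> carrier A" "conv a l" by (rule complete_conv[OF a(1) cau])
    have "(\<lambda>k. cdist Q ((s \<circ> r) k) (coset l)) \<longlonglongrightarrow> 0"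
    proof (rule tendsto_sandwich[OF _ _ tendsto_const l(2)])
      have "cdist Q ((s \<circ> r) k) (coset l) = nrm Q (coset (a k \<ominus> l))" for k
        using l(1) a(1)[of k] a(2)[of k, symmetric] by (simp add: cdist_def diff cc)
      then show "\<forall>\<^sub>F k in sequentially. cdist Q ((s \<circ> r) k) (coset l) \<le> nrm A (a k \<ominus> l)"
        using Q_nrm_le_nrm l a by simp
    qed simp
    then have "limitin M.mtopology (s \<circ> r) (coset l) sequentially"
      unfolding M.limitin_metric_dist_null using cc[OF l(1)] sc by simp
    then have "limitin M.mtopology s (coset l) sequentially"
      by (rule M.MCauchy_convergent_subsequence[OF s mono])
    then show "\<exists>z. limitin M.mtopology s z sequentially" by blast
  qed
  show ?thesis
  proof (intro unital_cstar_algebra.intro mod Q.ring_axioms unital_cstar_algebra_axioms.intro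
      nonneg zero triangle mult smult cstar complete)
  qed (auto dest!: ex simp: Q_smult Q_star Q_add Q_mult cc smult_mult_left smult_mult_right
      star_add star_smult star_mult)
qed

end

section \<open>The fibres of a field\<close>

locale cstar_field = unital_cstar_algebra A for A :: "'a cstar" (structure) +
  fixes j :: "('t::topological_space \<Rightarrow> complex) \<Rightarrow> 'a"
  assumes hom: "j \<in> unital_star_hom continuous_functions A"
    and central: "j ` carrier continuous_functions \<subseteq> centre A"
begin

abbreviation cont :: "('t \<Rightarrow> complex) \<Rightarrow> bool" where "cont f \<equiv> continuous_on UNIV f"

lemma j_in: "cont f \<Longrightarrow> j f \<in> carrier A"
  and j_mult: "\<lbrakk>cont f; cont g\<rbrakk> \<Longrightarrow> j (\<lambda>x. f x * g x) = j f \<otimes> j g"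
  and j_add: "\<lbrakk>cont f; cont g\<rbrakk> \<Longrightarrow> j (\<lambda>x. f x + g x) = j f \<oplus> j g"
  and j_one: "j (\<lambda>x. 1) = \<one>"
  and j_smult: "cont f \<Longrightarrow> j (\<lambda>x. c * f x) = c \<odot> j f"
  and j_star: "cont f \<Longrightarrow> j (\<lambda>x. cnj (f x)) = star A (j f)"
  using hom
  by (auto simp: unital_star_hom_def ring_hom_def continuous_functions_def Pi_iff)

lemma j_commute: "\<lbrakk>cont f; x \<in> carrier A\<rbrakk> \<Longrightarrow> j f \<otimes> x = x \<otimes> j f"
  using central by (force simp: centre_def continuous_functions_def)

definition jr :: "('t \<Rightarrow> real) \<Rightarrow> 'a"
  where "jr f = j (\<lambda>x. complex_of_real (f x))"

lemma jr_in: "continuous_on UNIV f \<Longrightarrow> jr f \<in> carrier A"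
  unfolding jr_def by (intro j_in continuous_intros)

lemma jr_herm: "continuous_on UNIV f \<Longrightarrow> jr f \<in> herm"
  using j_star[of "\<lambda>x. complex_of_real (f x)"] jr_in[of f]
  by (simp add: herm_iff jr_def continuous_on_of_real)

lemma jr_mult:
  "\<lbrakk>continuous_on UNIV f; continuous_on UNIV g\<rbrakk> \<Longrightarrow> jr (\<lambda>x. f x * g x) = jr f \<otimes> jr g"
  using j_mult[of "\<lambda>x. complex_of_real (f x)" "\<lambda>x. complex_of_real (g x)"]
  by (simp add: jr_def continuous_on_of_real)

lemma jr_add:
  "\<lbrakk>continuous_on UNIV f; continuous_on UNIV g\<rbrakk> \<Longrightarrow> jr (\<lambda>x. f x + g x) = jr f \<oplus> jr g"
  using j_add[of "\<lambda>x. complex_of_real (f x)" "\<lambda>x. complex_of_real (g x)"]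
  by (simp add: jr_def continuous_on_of_real)

lemma jr_const: "jr (\<lambda>x. c) = scal c"
  using j_smult[of "\<lambda>x. 1" "complex_of_real c"] by (simp add: jr_def j_one)

lemma jr_commute: "\<lbrakk>continuous_on UNIV f; x \<in> carrier A\<rbrakk> \<Longrightarrow> jr f \<otimes> x = x \<otimes> jr f"
  unfolding jr_def by (intro j_commute continuous_intros)

text \<open>With \<open>g = sqrt (e\<^sup>2 - f\<^sup>2)\<close> the squares of the commuting images
  add up to the scalar \<open>e\<^sup>2\<close>, so \<open>nrm_square_le_sum\<close>
  applies.\<close>

lemma nrm_jr_le:
  assumes f: "continuous_on UNIV f" and e: "0 \<le> e" "\<And>x. \<bar>f x\<bar> \<le> e"
  shows "nrm A (jr f) \<le> e"
proof -
  define g where "g x = sqrt (e\<^sup>2 - (f x)\<^sup>2)" for x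
  have g: "continuous_on UNIV g" unfolding g_def by (intro continuous_intros f)
  have sq: "(f x)\<^sup>2 \<le> e\<^sup>2" for x using e(2)[of x] e(1) by (simp add: abs_le_square_iff[symmetric])
  have "(\<lambda>x. f x * f x + g x * g x) = (\<lambda>x. e\<^sup>2)"
    using sq by (auto simp: g_def power2_eq_square[symmetric])
  then have "scal (e\<^sup>2) = jr f \<otimes> jr f \<oplus> jr g \<otimes> jr g"
    using f g by (metis jr_const jr_add jr_mult continuous_on_mult)
  then have "(nrm A (jr f))\<^sup>2 \<le> e\<^sup>2"
    using nrm_square_le_sum[OF jr_herm[OF f] jr_herm[OF g]] jr_commute[OF f jr_in[OF g]]
      nrm_scal_le[of "e\<^sup>2"] by simp
  then show ?thesis using e(1) by (rule power2_le_imp_le)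
qed

text \<open>The C*-identity reduces a complex function to the real function
  \<open>(cmod (f x))\<^sup>2\<close>.\<close>

lemma nrm_j_le:
  assumes f: "cont f" and e: "0 \<le> e" "\<And>x. cmod (f x) \<le> e"
  shows "nrm A (j f) \<le> e"
proof -
  have "(nrm A (j f))\<^sup>2 = nrm A (j (\<lambda>x. cnj (f x) * f x))"
    using cstar_identity[OF j_in[OF f]] j_mult[of "\<lambda>x. cnj (f x)" f] j_star[OF f] f
    by (simp add: continuous_on_cnj)
  also have "j (\<lambda>x. cnj (f x) * f x) = jr (\<lambda>x. (cmod (f x))\<^sup>2)"
    unfolding jr_def complex_norm_square by (simp add: mult.commute)
  also have "nrm A \<dots> \<le> e\<^sup>2"
    using e by (intro nrm_jr_le continuous_intros f) (auto intro: power_mono)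
  finally show ?thesis using e(1) by (rule power2_le_imp_le)
qed

section \<open>The ideal of a fibre\<close>

definition cutoffs :: "'t \<Rightarrow> ('t \<Rightarrow> real) set"
  where "cutoffs t = {f. continuous_on UNIV f \<and> (\<forall>x. 0 \<le> f x \<and> f x \<le> 1) \<and> f t = 1}"

lemma cutoff_mult: "\<lbrakk>f \<in> cutoffs t; g \<in> cutoffs t\<rbrakk> \<Longrightarrow> (\<lambda>x. f x * g x) \<in> cutoffs t"
  by (auto simp: cutoffs_def intro: continuous_on_mult mult_le_one)

lemma cutoff_nrm:
  assumes "f \<in> cutoffs t"
  shows "nrm A (jr f) \<le> 1"
  using assms by (intro nrm_jr_le) (auto simp: cutoffs_def)

lemma cutoff_nrm_mult:
  assumes "f \<in> cutoffs t" "x \<in> carrier A"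
  shows "nrm A (jr f \<otimes> x) \<le> nrm A x"
proof -
  have "jr f \<in> carrier A" using assms jr_in by (simp add: cutoffs_def)
  then show ?thesis
    using nrm_mult[OF _ assms(2)] cutoff_nrm[OF assms(1)] nrm_nonneg[OF assms(2)]
      mult_right_mono[of "nrm A (jr f)" 1 "nrm A x"] by fastforce
qed

text \<open>An explicit form of the ideal of the fibre at \<open>t\<close>
  (\<open>fibre_ideal_eq\<close>): localizing near \<open>t\<close> makes the element small. The
  cutoffs then provide the approximate unit that \<open>central_quotient\<close> requires.\<close>

definition vanishing :: "'t \<Rightarrow> 'a set"
  where "vanishing t = {x \<in> carrier A. \<forall>e>0. \<exists>f\<in>cutoffs t. nrm A (jr f \<otimes> x) \<le> e}"

lemma vanishingD: "\<lbrakk>x \<in> vanishing t; e > 0\<rbrakk> \<Longrightarrow> \<exists>f\<in>cutoffs t. nrm A (jr f \<otimes> x) \<le> e"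
  unfolding vanishing_def by blast

lemma vanishing_ideal: "ideal (vanishing t) A"
proof (rule idealI)
  show "ring A" by (rule ring_axioms)
  have one: "(\<lambda>x. 1) \<in> cutoffs t" by (simp add: cutoffs_def)
  have jc: "jr f \<in> carrier A" if "f \<in> cutoffs t" for f using that jr_in by (simp add: cutoffs_def)
  have com: "jr f \<otimes> x = x \<otimes> jr f" if "f \<in> cutoffs t" "x \<in> carrier A" for f x
    using that jr_commute by (simp add: cutoffs_def)
  have mul: "jr (\<lambda>x. f x * g x) = jr f \<otimes> jr g" if "f \<in> cutoffs t" "g \<in> cutoffs t" for f g
    using that jr_mult by (simp add: cutoffs_def)
  have add: "x \<oplus> y \<in> vanishing t" if x: "x \<in> vanishing t" and y: "y \<in> vanishing t" for x y
  proof -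
    have c: "x \<in> carrier A" "y \<in> carrier A" using x y by (simp_all add: vanishing_def)
    have "\<exists>f\<in>cutoffs t. nrm A (jr f \<otimes> (x \<oplus> y)) \<le> e" if "e > 0" for e
    proof -
      have "e / 2 > 0" using \<open>e > 0\<close> by simp
      then obtain f g where f: "f \<in> cutoffs t" "nrm A (jr f \<otimes> x) \<le> e / 2"
        and g: "g \<in> cutoffs t" "nrm A (jr g \<otimes> y) \<le> e / 2"
        using x y unfolding vanishing_def by blast
      \<comment> \<open>The product of the two cutoffs serves both summands, since cutoffs are
        central of norm at most 1.\<close>
      have "jr (\<lambda>x. f x * g x) \<otimes> (x \<oplus> y) = jr g \<otimes> (jr f \<otimes> x) \<oplus> jr f \<otimes> (jr g \<otimes> y)"
        using f g c jc com[OF g(1) jc[OF f(1)]] by (simp add: mul r_distr m_assoc[symmetric])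
      also have "nrm A \<dots> \<le> nrm A (jr f \<otimes> x) + nrm A (jr g \<otimes> y)"
        using nrm_triangle[of "jr g \<otimes> (jr f \<otimes> x)" "jr f \<otimes> (jr g \<otimes> y)"] c jc f(1) g(1)
          cutoff_nrm_mult[OF f(1), of "jr g \<otimes> y"] cutoff_nrm_mult[OF g(1), of "jr f \<otimes> x"] by simp
      finally show ?thesis using f(2) g(2) cutoff_mult[OF f(1) g(1)] by force
    qed
    then show ?thesis using c by (simp add: vanishing_def)
  qed
  have lm: "a \<otimes> x \<in> vanishing t" if x: "x \<in> vanishing t" and a: "a \<in> carrier A" for a x
  proof -
    have c: "x \<in> carrier A" using x by (simp add: vanishing_def)
    have "\<exists>f\<in>cutoffs t. nrm A (jr f \<otimes> (a \<otimes> x)) \<le> e" if "e > 0" for e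
    proof -
      have na: "nrm A a + 1 > 0" using nrm_nonneg[OF a] by simp
      then have "e / (nrm A a + 1) > 0" using \<open>e > 0\<close> by simp
      then obtain f where f: "f \<in> cutoffs t" "nrm A (jr f \<otimes> x) \<le> e / (nrm A a + 1)"
        using x unfolding vanishing_def by blast
      have "jr f \<otimes> (a \<otimes> x) = a \<otimes> (jr f \<otimes> x)"
        using c a jc[OF f(1)] com[OF f(1) a] by (simp add: m_assoc[symmetric])
      then have "nrm A (jr f \<otimes> (a \<otimes> x)) \<le> nrm A a * nrm A (jr f \<otimes> x)"
        using nrm_mult[OF a, of "jr f \<otimes> x"] c jc[OF f(1)] by simp
      also have "\<dots> \<le> (nrm A a + 1) * (e / (nrm A a + 1))"
        using f(2) nrm_nonneg[OF a] c jc[OF f(1)] by (intro mult_mono) (auto intro: nrm_nonneg)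
      finally show ?thesis using f(1) na by auto
    qed
    then show ?thesis using c a by (simp add: vanishing_def)
  qed
  then show "a \<otimes> x \<in> vanishing t" if "x \<in> vanishing t" "a \<in> carrier A" for a x
    using that by blast
  show "x \<otimes> a \<in> vanishing t" if x: "x \<in> vanishing t" and a: "a \<in> carrier A" for a x
  proof -
    have c: "x \<in> carrier A" using x by (simp add: vanishing_def)
    have "\<exists>f\<in>cutoffs t. nrm A (jr f \<otimes> (x \<otimes> a)) \<le> e" if "e > 0" for e
    proof -
      have na: "nrm A a + 1 > 0" using nrm_nonneg[OF a] by simp
      then have "e / (nrm A a + 1) > 0" using \<open>e > 0\<close> by simp
      then obtain f where f: "f \<in> cutoffs t" "nrm A (jr f \<otimes> x) \<le> e / (nrm A a + 1)"
        using x unfolding vanishing_def by blast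
      have "nrm A (jr f \<otimes> (x \<otimes> a)) \<le> nrm A (jr f \<otimes> x) * nrm A a"
        using nrm_mult[of "jr f \<otimes> x" a] a c jc[OF f(1)] by (simp add: m_assoc)
      also have "\<dots> \<le> (e / (nrm A a + 1)) * (nrm A a + 1)"
        using f(2) nrm_nonneg[OF a] na \<open>e > 0\<close> by (intro mult_mono) auto
      finally show ?thesis using f(1) na by auto
    qed
    then show ?thesis using c a by (simp add: vanishing_def)
  qed
  show "subgroup (vanishing t) (add_monoid A)"
  proof
    show "vanishing t \<subseteq> carrier (add_monoid A)" by (auto simp: vanishing_def)
    show "\<one>\<^bsub>add_monoid A\<^esub> \<in> vanishing t"
      using one jr_in[of "\<lambda>x. 1"] by (auto simp: vanishing_def intro!: bexI[of _ "\<lambda>x. 1"])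
    show "x \<otimes>\<^bsub>add_monoid A\<^esub> y \<in> vanishing t" if "x \<in> vanishing t" "y \<in> vanishing t" for x y
      using add[OF that] by simp
    show "inv\<^bsub>add_monoid A\<^esub> x \<in> vanishing t" if x: "x \<in> vanishing t" for x
    proof -
      have c: "x \<in> carrier A" using x by (simp add: vanishing_def)
      have "(\<ominus> \<one>) \<otimes> x = \<ominus> x" using c by (simp add: l_minus)
      then show ?thesis using lm[OF x, of "\<ominus> \<one>"] by (simp add: a_inv_def)
    qed
  qed
qed

lemma vanishing_closed: "closedin (norm_topology A) (vanishing t)"
  unfolding norm_topology_def closedin_metric
proof (intro conjI allI impI)
  show "vanishing t \<subseteq> carrier A" by (auto simp: vanishing_def)
  fix x assume x: "x \<in> carrier A - vanishing t"
  then obtain e where e: "e > 0" "\<And>f. f \<in> cutoffs t \<Longrightarrow> nrm A (jr f \<otimes> x) > e"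
    by (auto simp: vanishing_def not_le)
  have "y \<notin> vanishing t" if y: "y \<in> carrier A" "nrm A (x \<ominus> y) < e / 2" for y
  proof
    assume "y \<in> vanishing t"
    then obtain f where f: "f \<in> cutoffs t" "nrm A (jr f \<otimes> y) \<le> e / 2"
      using vanishingD[OF _ half_gt_zero[OF e(1)]] by blast
    have jc: "jr f \<in> carrier A" using f(1) jr_in by (simp add: cutoffs_def)
    have xc: "x \<in> carrier A" using x by blast
    have "x = (x \<ominus> y) \<oplus> y" using xc y(1) by (simp add: M.minus_eq M.a_assoc M.l_neg)
    then have "nrm A (jr f \<otimes> x) \<le> nrm A (jr f \<otimes> (x \<ominus> y)) + nrm A (jr f \<otimes> y)"
      using xc y(1) jc nrm_triangle[of "jr f \<otimes> (x \<ominus> y)" "jr f \<otimes> y"] r_distr[of "x \<ominus> y" y "jr f"] by simp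
    also have "\<dots> \<le> e"
      using f(2) y(2) cutoff_nrm_mult[OF f(1), of "x \<ominus> y"] xc y(1) by simp
    finally show False using e(2)[OF f(1)] by simp
  qed
  then have "disjnt (vanishing t) (mball x (e / 2))"
    using x by (auto simp: disjnt_def mball_def cdist_def)
  then show "\<exists>r>0. disjnt (vanishing t) (mball x r)" using e(1) half_gt_zero by blast
qed

lemma j_vanishing:
  assumes f: "cont f" "f t = 0"
  shows "j f \<in> vanishing t"
proof -
  have "\<exists>g\<in>cutoffs t. nrm A (jr g \<otimes> j f) \<le> e" if e: "e > 0" for e
  proof -
    \<comment> \<open>This cutoff vanishes where \<open>cmod (f x)\<close> is at least
      \<open>e\<close>, so its product with \<open>f\<close> is at most \<open>e\<close>
      everywhere.\<close>
    define g where "g x = max 0 (1 - cmod (f x) / e)" for x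
    have gc: "continuous_on UNIV g" unfolding g_def using f(1) e by (intro continuous_intros) auto
    have g: "g \<in> cutoffs t" using gc e f(2) by (auto simp: cutoffs_def g_def)
    have "jr g \<otimes> j f = j (\<lambda>x. complex_of_real (g x) * f x)"
      unfolding jr_def using f gc by (simp add: j_mult continuous_on_of_real)
    also have "nrm A \<dots> \<le> e"
    proof (rule nrm_j_le)
      show "cont (\<lambda>x. complex_of_real (g x) * f x)" by (intro continuous_intros gc f)
      show "cmod (complex_of_real (g x) * f x) \<le> e" for x
      proof (cases "cmod (f x) \<le> e")
        case True
        have "\<bar>g x\<bar> \<le> 1" using g by (auto simp: cutoffs_def)
        then show ?thesis using True mult_mono[of "\<bar>g x\<bar>" 1 "cmod (f x)" e] by (simp add: norm_mult)
      next
        case False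
        then have "g x = 0" using e by (simp add: g_def field_simps)
        then show ?thesis using e by simp
      qed
    qed (use e in simp)
    finally show ?thesis using g by blast
  qed
  then show ?thesis using j_in[OF f(1)] by (simp add: vanishing_def)
qed

lemma cutoff_complement:
  assumes "f \<in> cutoffs t"
  shows "\<one> \<ominus> jr f = j (\<lambda>x. 1 - complex_of_real (f x))" "cont (\<lambda>x. 1 - complex_of_real (f x))"
proof -
  have f: "continuous_on UNIV f" using assms by (simp add: cutoffs_def)
  then show "cont (\<lambda>x. 1 - complex_of_real (f x))" by (intro continuous_intros)
  have "j (\<lambda>x. 1 + (-1) * complex_of_real (f x)) = \<one> \<oplus> (-1) \<odot> jr f"
    using f j_add[of "\<lambda>x. 1" "\<lambda>x. (-1) * complex_of_real (f x)"]
      j_smult[of "\<lambda>x. complex_of_real (f x)" "-1"]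
    by (simp add: jr_def j_one continuous_intros)
  then show "\<one> \<ominus> jr f = j (\<lambda>x. 1 - complex_of_real (f x))"
    using jr_in[OF f] by (simp add: M.minus_eq a_inv_smult)
qed

text \<open>An element \<open>x\<close> of \<open>vanishing t\<close> is approximated by
  \<open>(\<one> \<ominus> jr f) \<otimes> x\<close>, which lies in every ideal containing the
  images of functions that vanish at \<open>t\<close>; closedness does the rest.\<close>

lemma fibre_ideal_eq: "fibre_ideal A j t = vanishing t"
proof
  have "j ` {f \<in> carrier continuous_functions. f t = 0} \<subseteq> vanishing t"
    using j_vanishing by (auto simp: continuous_functions_def)
  then show "fibre_ideal A j t \<subseteq> vanishing t"
    using vanishing_ideal vanishing_closed unfolding fibre_ideal_def closed_ideal_generated_def by blast
  show "vanishing t \<subseteq> fibre_ideal A j t"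
    unfolding fibre_ideal_def closed_ideal_generated_def
  proof (intro Inter_greatest subsetI)
    fix J x
    assume J: "J \<in> {I. ideal I A \<and> closedin (norm_topology A) I \<and>
      j ` {f \<in> carrier continuous_functions. f t = 0} \<subseteq> I}" and x: "x \<in> vanishing t"
    interpret J: ideal J A using J by blast
    have xc: "x \<in> carrier A" using x by (simp add: vanishing_def)
    show "x \<in> J"
    proof (rule ccontr)
      assume "x \<notin> J"
      then obtain r where r: "r > 0" "disjnt J (mball x r)"
        using J xc unfolding norm_topology_def closedin_metric by blast
      obtain f where f: "f \<in> cutoffs t" "nrm A (jr f \<otimes> x) \<le> r / 2"
        using vanishingD[OF x half_gt_zero[OF r(1)]] by blast
      have jc: "jr f \<in> carrier A" using f(1) jr_in by (simp add: cutoffs_def)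
      have "\<one> \<ominus> jr f \<in> J"
        using J cutoff_complement[OF f(1)] f(1) by (auto simp: cutoffs_def continuous_functions_def)
      then have 1: "(\<one> \<ominus> jr f) \<otimes> x \<in> J" using xc by (rule J.I_r_closed)
      have "x \<ominus> (\<one> \<ominus> jr f) \<otimes> x = jr f \<otimes> x"
      proof -
        define q where "q = jr f \<otimes> x"
        have q: "q \<in> carrier A" using xc jc by (simp add: q_def)
        obtain F where F: "frame x q q q F" by (rule frame_exists[OF xc q q q])
        have "(\<one> \<ominus> jr f) \<otimes> x = x \<ominus> q" using xc jc by (simp add: mult_diff_left q_def)
        then show ?thesis unfolding q_def[symmetric] by (simp add: frameD[OF F])
      qed
      then have "(\<one> \<ominus> jr f) \<otimes> x \<in> mball x r"
        using xc jc f(2) r(1) by (simp add: mball_def cdist_def)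
      then show False using 1 r(2) by (auto simp: disjnt_def)
    qed
  qed
qed

lemma central_quotient_fibre: "central_quotient A (fibre_ideal A j t)"
  unfolding fibre_ideal_eq
proof (intro central_quotient.intro unital_cstar_algebra_axioms vanishing_ideal
    central_quotient_axioms.intro vanishing_closed)
  have jc: "jr f \<in> herm" if "f \<in> cutoffs t" for f using that jr_herm by (simp add: cutoffs_def)
  show "star A x \<in> vanishing t" if x: "x \<in> vanishing t" for x
  proof -
    have c: "x \<in> carrier A" using x by (simp add: vanishing_def)
    have "nrm A (jr f \<otimes> star A x) = nrm A (jr f \<otimes> x)" if f: "f \<in> cutoffs t" for f
    proof -
      have "star A (jr f \<otimes> x) = jr f \<otimes> star A x"
        using f c hermD[OF jc[OF f]] jr_commute[of f "star A x"] by (simp add: star_mult cutoffs_def)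
      then show ?thesis using nrm_star[of "jr f \<otimes> x"] c hermD[OF jc[OF f]] by simp
    qed
    then show ?thesis using x by (auto simp: vanishing_def)
  qed
  fix x and e :: real assume "x \<in> vanishing t" "e > 0"
  then obtain f where f: "f \<in> cutoffs t" "nrm A (jr f \<otimes> x) \<le> e" unfolding vanishing_def by blast
  have "jr f \<in> centre A" using hermD[OF jc[OF f(1)]] jr_commute f(1) by (simp add: centre_def cutoffs_def)
  moreover have "\<one> \<ominus> jr f \<in> vanishing t"
    using cutoff_complement[OF f(1)] f(1) j_vanishing by (simp add: cutoffs_def)
  ultimately show "\<exists>u\<in>herm. u \<in> centre A \<and> nrm A u \<le> 1 \<and> \<one> \<ominus> u \<in> vanishing t \<and> nrm A (u \<otimes> x) \<le> e"
    using f jc cutoff_nrm by blast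
qed

lemma fibre_cstar: "unital_cstar_algebra (fibre A j t)"
  unfolding fibre_def by (rule central_quotient.Q_cstar[OF central_quotient_fibre])

lemma
  assumes "x \<in> carrier A"
  shows ev_in: "ev A j t x \<in> carrier (fibre A j t)"
    and ev_smult: "ev A j t (c \<odot> x) = c \<odot>\<^bsub>fibre A j t\<^esub> ev A j t x"
    and ev_star: "ev A j t (star A x) = star (fibre A j t) (ev A j t x)"
    and ev_add: "y \<in> carrier A \<Longrightarrow> ev A j t (x \<oplus> y) = ev A j t x \<oplus>\<^bsub>fibre A j t\<^esub> ev A j t y"
    and ev_one: "ev A j t \<one> = \<one>\<^bsub>fibre A j t\<^esub>"
    and ev_zero: "ev A j t \<zero> = \<zero>\<^bsub>fibre A j t\<^esub>"
proof -
  interpret central_quotient A "fibre_ideal A j t" by (rule central_quotient_fibre)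
  show "ev A j t x \<in> carrier (fibre A j t)" "ev A j t (c \<odot> x) = c \<odot>\<^bsub>fibre A j t\<^esub> ev A j t x"
    "ev A j t (star A x) = star (fibre A j t) (ev A j t x)"
    "y \<in> carrier A \<Longrightarrow> ev A j t (x \<oplus> y) = ev A j t x \<oplus>\<^bsub>fibre A j t\<^esub> ev A j t y"
    "ev A j t \<one> = \<one>\<^bsub>fibre A j t\<^esub>" "ev A j t \<zero> = \<zero>\<^bsub>fibre A j t\<^esub>"
    using assms unfolding fibre_def ev_def
    by (simp_all add: Q_carrier Q_smult Q_star Q_add Q_one Q_zero)
qed

end

section \<open>Bridging two order unit spaces\<close>

text \<open>The requirements \<open>f (h y) \<le> g y + s y\<close> form a cone of constraints;
  inserting \<open>\<ominus> y\<close> gives the lower estimate, as \<open>s\<close> is even.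
  \<open>bound\<close> is the compatibility condition of the Hahn-Banach theorem. The map
  \<open>h\<close> is the identity in one application and the real part \<open>re\<close> in the
  other, so one lemma moves states in both directions.\<close>

lemma (in unital_subspace) state_near:
  fixes B :: "'b cstar"
  assumes "unital_cstar_algebra B" and T: "unital_cstar_algebra.real_subspace B T"
    and h: "\<And>y. y \<in> T \<Longrightarrow> h y \<in> S"
      "\<And>y z. \<lbrakk>y \<in> T; z \<in> T\<rbrakk> \<Longrightarrow> h (y \<oplus>\<^bsub>B\<^esub> z) = h y \<oplus> h z"
      "\<And>r y. y \<in> T \<Longrightarrow> h (complex_of_real r \<odot>\<^bsub>B\<^esub> y) = complex_of_real r \<odot> h y"
    and g: "\<And>y z. \<lbrakk>y \<in> T; z \<in> T\<rbrakk> \<Longrightarrow> g (y \<oplus>\<^bsub>B\<^esub> z) = g y + g z"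
      "\<And>r y. y \<in> T \<Longrightarrow> g (complex_of_real r \<odot>\<^bsub>B\<^esub> y) = r * g y"
    and s: "\<And>y z. \<lbrakk>y \<in> T; z \<in> T\<rbrakk> \<Longrightarrow> s (y \<oplus>\<^bsub>B\<^esub> z) \<le> s y + s z"
      "\<And>r y. y \<in> T \<Longrightarrow> s (complex_of_real r \<odot>\<^bsub>B\<^esub> y) = \<bar>r\<bar> * (s y :: real)"
    and bound: "\<And>y. y \<in> T \<Longrightarrow> g y \<le> upper (h y) + s y"
  obtains f where "f \<in> states A V" "\<forall>y\<in>T. \<bar>f (h y) - g y\<bar> \<le> s y"
proof -
  interpret B: unital_cstar_algebra B by fact
  note Tc = B.real_subspaceD[OF T]
  define G where "G = {(h y, r) | y r. y \<in> T \<and> g y + s y \<le> r}"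
  have GI: "(h y, r) \<in> G" if "y \<in> T" "g y + s y \<le> r" for y r
    using that unfolding G_def by blast
  have Gmem: "(h y, g y + s y) \<in> G" if "y \<in> T" for y using that by (intro GI) auto
  have hm: "h (\<ominus>\<^bsub>B\<^esub> y) = \<ominus> h y" "g (\<ominus>\<^bsub>B\<^esub> y) = - g y" "s (\<ominus>\<^bsub>B\<^esub> y) = s y" if y: "y \<in> T" for y
    using h(3)[OF y, of "-1"] g(2)[OF y, of "-1"] s(2)[OF y, of "-1"] S_in[OF h(1)[OF y]] Tc(2)[OF y]
    by (simp_all add: a_inv_smult B.a_inv_smult)
  have h0: "h \<zero>\<^bsub>B\<^esub> = \<zero>" "g \<zero>\<^bsub>B\<^esub> = 0" "s \<zero>\<^bsub>B\<^esub> = 0"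
    using h(3)[OF Tc(1), of 0] g(2)[OF Tc(1), of 0] s(2)[OF Tc(1), of 0] S_in[OF h(1)[OF Tc(1)]]
    by simp_all
  have cone: "convex_cone S G"
    unfolding convex_cone_def
  proof (intro conjI allI impI)
    show "G \<subseteq> S \<times> UNIV" using h(1) by (auto simp: G_def)
    show "(\<zero>, 0) \<in> G" using Gmem[OF Tc(1)] h0 by simp
  next
    fix x r z t assume "(x, r) \<in> G" "(z, t) \<in> G"
    then obtain y y' where y: "y \<in> T" "y' \<in> T" "x = h y" "z = h y'" "g y + s y \<le> r" "g y' + s y' \<le> t"
      by (auto simp: G_def)
    then have "g (y \<oplus>\<^bsub>B\<^esub> y') + s (y \<oplus>\<^bsub>B\<^esub> y') \<le> r + t" using g(1)[of y y'] s(1)[of y y'] by simp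
    then show "(x \<oplus> z, r + t) \<in> G"
      using GI[of "y \<oplus>\<^bsub>B\<^esub> y'" "r + t"] y h(2)[of y y'] Tc(3)[of y y'] by simp
  next
    fix c x r assume c: "(0::real) < c" and "(x, r) \<in> G"
    then obtain y where y: "y \<in> T" "x = h y" "g y + s y \<le> r" by (auto simp: G_def)
    have "g (complex_of_real c \<odot>\<^bsub>B\<^esub> y) + s (complex_of_real c \<odot>\<^bsub>B\<^esub> y) = c * (g y + s y)"
      using c g(2)[OF y(1)] s(2)[OF y(1)] by (simp add: distrib_left)
    also have "\<dots> \<le> c * r" using c y(3) by simp
    finally show "(complex_of_real c \<odot> x, c * r) \<in> G"
      using GI[OF Tc(4)[OF y(1), of c], of "c * r"] y h(3)[OF y(1), of c] by simp
  qed
  have G: "0 \<le> upper (\<ominus> x) + r" if xr: "(x, r) \<in> G" for x r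
  proof -
    obtain y where y: "y \<in> T" "x = h y" "g y + s y \<le> r" using xr by (auto simp: G_def)
    show ?thesis using bound[OF Tc(5)[OF y(1)]] hm[OF y(1)] y by simp
  qed
  obtain f where f: "f \<in> states A V" "\<forall>(x, r)\<in>G. f x \<le> r"
    by (rule state_exists_cone[OF cone G])
  have "\<bar>f (h y) - g y\<bar> \<le> s y" if y: "y \<in> T" for y
  proof -
    have "f (h y) \<le> g y + s y" using f(2) Gmem[OF y] by blast
    moreover have "f (\<ominus> h y) \<le> - g y + s y" using f(2) Gmem[OF Tc(5)[OF y]] hm[OF y] by auto
    ultimately show ?thesis using state_minus[OF f(1) h(1)[OF y]] by simp
  qed
  then show thesis using that f(1) by blast
qed

text \<open>\<open>k\<close> and \<open>k'\<close> respect the complex structure and the unit, but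
  not necessarily involution and order; \<open>star_close\<close> and \<open>nrm_close\<close>
  measure the defect on the part of the Lipschitz ball with norm at most \<open>R\<close>. The shift
  \<open>D * R\<close> dominates the norms of such \<open>y\<close> and of \<open>k' y\<close>. The
  number \<open>d\<close> is at once the tolerance of all approximations and the inverse of the
  multiple of the norm in \<open>bridge_seminorm\<close>.\<close>

locale bridge =
  A: unital_subspace A V + B: unital_subspace B W
  for A :: "'a cstar" and V and B :: "'b cstar" and W +
  fixes k :: "'a \<Rightarrow> 'b" and k' :: "'b \<Rightarrow> 'a" and L :: "'a \<Rightarrow> real" and M :: "'b \<Rightarrow> real"
    and D R d :: real
  assumes k_in: "x \<in> V \<Longrightarrow> k x \<in> W" and k'_in: "y \<in> W \<Longrightarrow> k' y \<in> V"
    and k_k': "y \<in> W \<Longrightarrow> k (k' y) = y" and k'_k: "x \<in> V \<Longrightarrow> k' (k x) = x"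
    and k_add: "\<lbrakk>x \<in> V; z \<in> V\<rbrakk> \<Longrightarrow> k (x \<oplus>\<^bsub>A\<^esub> z) = k x \<oplus>\<^bsub>B\<^esub> k z"
    and k_smult: "x \<in> V \<Longrightarrow> k (c \<odot>\<^bsub>A\<^esub> x) = c \<odot>\<^bsub>B\<^esub> k x"
    and k_one: "k \<one>\<^bsub>A\<^esub> = \<one>\<^bsub>B\<^esub>"
    and D: "0 \<le> D" "1 \<le> D" and R: "0 < R" and d: "0 < d"
    and k_nrm: "x \<in> V \<Longrightarrow> nrm B (k x) \<le> D * nrm A x"
    and k'_nrm: "y \<in> W \<Longrightarrow> nrm A (k' y) \<le> D * nrm B y"
    and L: "order_unit_cqms A V L" and M: "order_unit_cqms B W M"
    and L_radius: "radius A V L \<le> ennreal (R / 2)" and M_radius: "radius B W M \<le> ennreal (R / 2)"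
    and L_approx: "\<lbrakk>x \<in> sa A V; L x \<le> 1\<rbrakk> \<Longrightarrow> \<exists>y\<in>sa B W. M y \<le> 1 \<and> nrm B (k x \<ominus>\<^bsub>B\<^esub> y) \<le> d"
    and M_approx: "\<lbrakk>y \<in> sa B W; M y \<le> 1\<rbrakk> \<Longrightarrow> \<exists>x\<in>sa A V. L x \<le> 1 \<and> nrm B (k x \<ominus>\<^bsub>B\<^esub> y) \<le> d"
    and nrm_close: "\<lbrakk>y \<in> sa B W; M y \<le> 1; nrm B y \<le> R\<rbrakk> \<Longrightarrow>
      \<bar>nrm A (k' y \<oplus>\<^bsub>A\<^esub> A.scal (D * R)) - nrm B (y \<oplus>\<^bsub>B\<^esub> B.scal (D * R))\<bar> \<le> d"
    and star_close: "\<lbrakk>y \<in> sa B W; M y \<le> 1; nrm B y \<le> R\<rbrakk> \<Longrightarrow>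
      nrm A (star A (k' y) \<ominus>\<^bsub>A\<^esub> k' y) \<le> d"
begin

section \<open>Transport of elements, norms and states\<close>

lemma k'_add: "\<lbrakk>y \<in> W; z \<in> W\<rbrakk> \<Longrightarrow> k' (y \<oplus>\<^bsub>B\<^esub> z) = k' y \<oplus>\<^bsub>A\<^esub> k' z"
  by (metis k'_k k_add k_k' k'_in A.V_add)

lemma k'_smult: "y \<in> W \<Longrightarrow> k' (c \<odot>\<^bsub>B\<^esub> y) = c \<odot>\<^bsub>A\<^esub> k' y"
  by (metis k'_k k_smult k_k' k'_in A.V_smult)

lemma k_diff: "\<lbrakk>x \<in> V; z \<in> V\<rbrakk> \<Longrightarrow> k (x \<ominus>\<^bsub>A\<^esub> z) = k x \<ominus>\<^bsub>B\<^esub> k z"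
  using k_add[of x "(-1) \<odot>\<^bsub>A\<^esub> z"] k_smult[of z "-1"] A.V_in[of z] B.V_in[OF k_in[of z]] A.V_smult[of z "-1"]
  by (simp add: A.M.minus_eq B.M.minus_eq A.a_inv_smult B.a_inv_smult)

lemma k'_diff: "\<lbrakk>y \<in> W; z \<in> W\<rbrakk> \<Longrightarrow> k' (y \<ominus>\<^bsub>B\<^esub> z) = k' y \<ominus>\<^bsub>A\<^esub> k' z"
  by (metis k'_k k_diff k_k' k'_in A.V_diff)

text \<open>\<open>k' y\<close> need not be self-adjoint in \<open>A\<close>; its real part is, and
  it still depends real-linearly on \<open>y\<close>.\<close>

definition re :: "'b \<Rightarrow> 'a"
  where "re y = (1/2) \<odot>\<^bsub>A\<^esub> (k' y \<oplus>\<^bsub>A\<^esub> star A (k' y))"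

lemma re_in: "y \<in> B.S \<Longrightarrow> re y \<in> A.S"
proof -
  assume y: "y \<in> B.S"
  have v: "k' y \<in> V" using k'_in B.S_V y by blast
  then have "re y \<in> V" unfolding re_def by (intro A.V_smult A.V_add A.V_star)
  then show "re y \<in> A.S"
    using A.V_in[OF v] by (simp add: sa_def re_def A.star_smult A.star_add A.M.a_comm)
qed

lemma re_add:
  assumes "y \<in> B.S" "z \<in> B.S"
  shows "re (y \<oplus>\<^bsub>B\<^esub> z) = re y \<oplus>\<^bsub>A\<^esub> re z"
proof -
  have c: "k' y \<in> carrier A" "k' z \<in> carrier A" using assms A.V_in k'_in B.S_V by blast+
  show ?thesis
    using c by (simp add: re_def k'_add B.S_V assms A.star_add A.smult_add_right A.M.a_ac)
qed

lemma re_smult: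
  assumes "y \<in> B.S"
  shows "re (complex_of_real r \<odot>\<^bsub>B\<^esub> y) = complex_of_real r \<odot>\<^bsub>A\<^esub> re y"
proof -
  have c: "k' y \<in> carrier A" using assms A.V_in k'_in B.S_V by blast
  show ?thesis
    using c by (simp add: re_def k'_smult B.S_V assms A.star_smult A.smult_add_right mult.commute)
qed

lemma nrm_half: "x \<in> carrier A \<Longrightarrow> nrm A ((1/2) \<odot>\<^bsub>A\<^esub> (x \<oplus>\<^bsub>A\<^esub> star A x)) \<le> nrm A x"
  using A.nrm_triangle[of x "star A x"] by (simp add: A.nrm_smult)

text \<open>As \<open>x\<close> is self-adjoint, \<open>x \<ominus> re y\<close> is the real part of
  \<open>x \<ominus> k' y = k' (k x \<ominus> y)\<close>, and taking real parts does not increase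
  the norm.\<close>

lemma nrm_diff_re:
  assumes x: "x \<in> A.S" and y: "y \<in> B.S"
  shows "nrm A (x \<ominus>\<^bsub>A\<^esub> re y) \<le> D * nrm B (k x \<ominus>\<^bsub>B\<^esub> y)"
proof -
  have c: "x \<in> carrier A" "k' y \<in> carrier A" "star A x = x" "x \<in> V" "y \<in> W"
    using A.S_in[OF x] A.V_in[OF k'_in[OF B.S_V[OF y]]] A.hermD(2)[OF A.S_herm[OF x]]
      A.S_V[OF x] B.S_V[OF y] by simp_all
  define z where "z = star A (k' y)"
  have z: "z \<in> carrier A" using c by (simp add: z_def)
  obtain F where F: "A.frame x (k' y) z x F" by (rule A.frame_exists[OF c(1,2) z c(1)])
  have "x \<ominus>\<^bsub>A\<^esub> re y = (1/2) \<odot>\<^bsub>A\<^esub> ((x \<ominus>\<^bsub>A\<^esub> k' y) \<oplus>\<^bsub>A\<^esub> (x \<ominus>\<^bsub>A\<^esub> z))"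
    unfolding re_def z_def[symmetric] by (simp add: A.frameD[OF F])
  also have "x \<ominus>\<^bsub>A\<^esub> z = star A (x \<ominus>\<^bsub>A\<^esub> k' y)" using c by (simp add: z_def A.star_diff)
  finally have "nrm A (x \<ominus>\<^bsub>A\<^esub> re y) \<le> nrm A (x \<ominus>\<^bsub>A\<^esub> k' y)" using nrm_half c by simp
  also have "x \<ominus>\<^bsub>A\<^esub> k' y = k' (k x \<ominus>\<^bsub>B\<^esub> y)" using c by (simp add: k'_diff k_in k'_k)
  also have "nrm A \<dots> \<le> D * nrm B (k x \<ominus>\<^bsub>B\<^esub> y)"
    using c by (intro k'_nrm B.V_diff k_in)
  finally show ?thesis .
qed

lemma Lsemi: "seminorm_on \<real> A A.S L" and L1: "L \<one>\<^bsub>A\<^esub> = 0"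
  and Msemi: "seminorm_on \<real> B B.S M" and M1: "M \<one>\<^bsub>B\<^esub> = 0"
  and Lmet: "metrizes_states A V L" and Mmet: "metrizes_states B W M"
  using L M by (simp_all add: order_unit_cqms_def)

lemma L_add: "\<lbrakk>x \<in> A.S; z \<in> A.S\<rbrakk> \<Longrightarrow> L (x \<oplus>\<^bsub>A\<^esub> z) \<le> L x + L z"
  and L_mul: "\<lbrakk>c \<in> \<real>; x \<in> A.S\<rbrakk> \<Longrightarrow> L (c \<odot>\<^bsub>A\<^esub> x) = cmod c * L x"
  and L_nonneg: "x \<in> A.S \<Longrightarrow> 0 \<le> L x"
  and M_add: "\<lbrakk>y \<in> B.S; w \<in> B.S\<rbrakk> \<Longrightarrow> M (y \<oplus>\<^bsub>B\<^esub> w) \<le> M y + M w"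
  and M_mul: "\<lbrakk>c \<in> \<real>; y \<in> B.S\<rbrakk> \<Longrightarrow> M (c \<odot>\<^bsub>B\<^esub> y) = cmod c * M y"
  and M_nonneg: "y \<in> B.S \<Longrightarrow> 0 \<le> M y"
  using Lsemi Msemi by (simp_all add: seminorm_on_def)

lemma L_shift: "x \<in> A.S \<Longrightarrow> L (x \<ominus>\<^bsub>A\<^esub> A.scal r) \<le> L x"
proof -
  assume x: "x \<in> A.S"
  have "x \<ominus>\<^bsub>A\<^esub> A.scal r = x \<oplus>\<^bsub>A\<^esub> A.scal (- r)" by (simp add: A.M.minus_eq A.minus_smult)
  then show ?thesis using L_add[OF x A.S_scal[of "-r"]] L_mul[of "complex_of_real (- r)" "\<one>\<^bsub>A\<^esub>"] L1 by simp
qed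

lemma M_shift: "y \<in> B.S \<Longrightarrow> M (y \<ominus>\<^bsub>B\<^esub> B.scal r) \<le> M y"
proof -
  assume y: "y \<in> B.S"
  have "y \<ominus>\<^bsub>B\<^esub> B.scal r = y \<oplus>\<^bsub>B\<^esub> B.scal (- r)" by (simp add: B.M.minus_eq B.minus_smult)
  then show ?thesis using M_add[OF y B.S_scal[of "-r"]] M_mul[of "complex_of_real (- r)" "\<one>\<^bsub>B\<^esub>"] M1 by simp
qed

lemma k_shift:
  assumes "x \<in> A.S" "y \<in> B.S"
  shows "k (x \<ominus>\<^bsub>A\<^esub> A.scal r) \<ominus>\<^bsub>B\<^esub> (y \<ominus>\<^bsub>B\<^esub> B.scal r) = k x \<ominus>\<^bsub>B\<^esub> y"
proof -
  have c: "x \<in> V" "y \<in> carrier B" "k x \<in> carrier B" "A.scal r \<in> V"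
    using A.S_V[OF assms(1)] B.S_in[OF assms(2)] B.V_in[OF k_in[OF A.S_V[OF assms(1)]]]
      A.V_smult[OF A.V_one] by simp_all
  obtain F where F: "B.frame (k x) y \<one>\<^bsub>B\<^esub> y F" by (rule B.frame_exists[OF c(3,2) B.one_closed c(2)])
  have "k (x \<ominus>\<^bsub>A\<^esub> A.scal r) = k x \<ominus>\<^bsub>B\<^esub> B.scal r" using c by (simp add: k_diff k_smult k_one A.V_one)
  then show ?thesis by (simp add: B.frameD[OF F])
qed

text \<open>On self-adjoint elements a norm whose unit ball is the set on which
  \<open>nrm_close\<close> and \<open>star_close\<close> are assumed.\<close>

definition size :: "'b \<Rightarrow> real"
  where "size y = max (M y) (nrm B y / R)"

lemma size_add:
  assumes "y \<in> B.S" "z \<in> B.S"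
  shows "size (y \<oplus>\<^bsub>B\<^esub> z) \<le> size y + size z"
proof -
  have "nrm B (y \<oplus>\<^bsub>B\<^esub> z) / R \<le> nrm B y / R + nrm B z / R"
    using B.nrm_triangle[OF B.S_in B.S_in] assms R by (simp add: divide_right_mono flip: add_divide_distrib)
  then show ?thesis using M_add[OF assms] unfolding size_def by linarith
qed

lemma size_smult:
  assumes "y \<in> B.S"
  shows "size (complex_of_real r \<odot>\<^bsub>B\<^esub> y) = \<bar>r\<bar> * size y"
  using M_mul[of "complex_of_real r"] B.S_in assms
  by (simp add: size_def B.nrm_smult max_mult_distrib_left)

text \<open>Homogeneity extends an estimate from the unit ball of \<open>size\<close>. Dividing by
  \<open>size y\<close> fails only for \<open>y = 0\<close>, because of the term
  \<open>nrm B y / R\<close>.\<close>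

lemma unit_size_imp:
  assumes g: "\<And>y r. y \<in> B.S \<Longrightarrow> g (complex_of_real r \<odot>\<^bsub>B\<^esub> y) = r * g y"
    and p: "\<And>y r. \<lbrakk>y \<in> B.S; 0 \<le> r\<rbrakk> \<Longrightarrow> p (complex_of_real r \<odot>\<^bsub>B\<^esub> y) = r * (p y :: real)"
    and unit: "\<And>y. \<lbrakk>y \<in> B.S; M y \<le> 1; nrm B y \<le> R\<rbrakk> \<Longrightarrow> g y \<le> p y + e"
    and y: "y \<in> B.S"
  shows "g y \<le> p y + e * size y"
proof (cases "size y = 0")
  case True
  then have "nrm B y / R \<le> 0" unfolding size_def by linarith
  then have "nrm B y = 0" using R B.nrm_nonneg[OF B.S_in[OF y]] by (simp add: divide_le_0_iff)
  then have "y = \<zero>\<^bsub>B\<^esub>" using B.nrm_eq_zero_iff[OF B.S_in[OF y]] by simp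
  then have "y = complex_of_real 0 \<odot>\<^bsub>B\<^esub> y" by simp
  then have "g y = 0" "p y = 0" using g[OF y, of 0] p[OF y, of 0] by simp_all
  then show ?thesis using True by simp
next
  case False
  define c where "c = size y"
  have c: "c > 0" using False M_nonneg[OF y] unfolding c_def size_def by linarith
  have le: "M y \<le> c" "nrm B y / R \<le> c" by (simp_all add: c_def size_def)
  define z where "z = complex_of_real (1 / c) \<odot>\<^bsub>B\<^esub> y"
  have z: "z \<in> B.S" unfolding z_def by (rule B.S_smult[OF y])
  have "M z \<le> 1" using M_mul[of "complex_of_real (1/c)" y] y le(1) c by (simp add: z_def norm_divide)
  moreover have "nrm B z \<le> R"
    using B.nrm_smult[OF B.S_in[OF y], of "complex_of_real (1/c)"] le(2) c R
    by (simp add: z_def norm_divide divide_le_eq mult.commute)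
  ultimately have "g z \<le> p z + e" using z by (intro unit)
  moreover have "g z = (1 / c) * g y" unfolding z_def by (rule g[OF y])
  moreover have "p z = (1 / c) * p y" unfolding z_def using c by (intro p[OF y]) simp
  ultimately have "(1 / c) * g y \<le> (1 / c) * p y + e" by simp
  then show ?thesis using c unfolding c_def[symmetric] by (simp add: field_simps)
qed

text \<open>The shift is self-adjoint, so \<open>re y\<close> plus the shift is the real part of
  \<open>k' y\<close> plus the shift, and its norm is no larger. The reverse estimate pays a second
  \<open>d\<close> for the distance from \<open>k' y\<close> to its real part, which
  \<open>star_close\<close> bounds.\<close>

lemma close_norms:
  assumes y: "y \<in> B.S" "M y \<le> 1" "nrm B y \<le> R"
  defines "m \<equiv> D * R"
  shows "nrm A (re y) \<le> m" "nrm B y \<le> m"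
    "nrm A (re y \<oplus>\<^bsub>A\<^esub> A.scal m) \<le> nrm B (y \<oplus>\<^bsub>B\<^esub> B.scal m) + d"
    "nrm B (y \<oplus>\<^bsub>B\<^esub> B.scal m) \<le> nrm A (re y \<oplus>\<^bsub>A\<^esub> A.scal m) + 2 * d"
proof -
  have v: "k' y \<in> V" "k' y \<in> carrier A" using k'_in A.V_in B.S_V[OF y(1)] by blast+
  have nk: "nrm A (k' y) \<le> m"
    using k'_nrm[OF B.S_V[OF y(1)]] mult_left_mono[OF y(3) D(1)] unfolding m_def by linarith
  have "nrm A (re y) \<le> nrm A (k' y)" unfolding re_def by (rule nrm_half[OF v(2)])
  then show "nrm A (re y) \<le> m" using nk by simp
  show "nrm B y \<le> m" using y(3) R mult_right_mono[OF D(2), of R] unfolding m_def by linarith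
  have close: "\<bar>nrm A (k' y \<oplus>\<^bsub>A\<^esub> A.scal m) - nrm B (y \<oplus>\<^bsub>B\<^esub> B.scal m)\<bar> \<le> d"
    unfolding m_def by (rule nrm_close[OF y])
  define z where "z = star A (k' y)"
  have z: "z \<in> carrier A" using v by (simp add: z_def)
  obtain F where F: "A.frame (k' y) z \<one>\<^bsub>A\<^esub> z F" by (rule A.frame_exists[OF v(2) z A.one_closed z])
  have "re y \<oplus>\<^bsub>A\<^esub> A.scal m = (1/2) \<odot>\<^bsub>A\<^esub> ((k' y \<oplus>\<^bsub>A\<^esub> A.scal m) \<oplus>\<^bsub>A\<^esub> (z \<oplus>\<^bsub>A\<^esub> A.scal m))"
    unfolding re_def z_def[symmetric] by (simp add: A.frameD[OF F])
  also have "z \<oplus>\<^bsub>A\<^esub> A.scal m = star A (k' y \<oplus>\<^bsub>A\<^esub> A.scal m)"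
    using v by (simp add: z_def A.star_add A.star_smult)
  finally have "nrm A (re y \<oplus>\<^bsub>A\<^esub> A.scal m) \<le> nrm A (k' y \<oplus>\<^bsub>A\<^esub> A.scal m)"
    using nrm_half[of "k' y \<oplus>\<^bsub>A\<^esub> A.scal m"] v by simp
  then show "nrm A (re y \<oplus>\<^bsub>A\<^esub> A.scal m) \<le> nrm B (y \<oplus>\<^bsub>B\<^esub> B.scal m) + d" using close by simp
  have "k' y \<oplus>\<^bsub>A\<^esub> A.scal m = (re y \<oplus>\<^bsub>A\<^esub> A.scal m) \<ominus>\<^bsub>A\<^esub> (1/2) \<odot>\<^bsub>A\<^esub> (z \<ominus>\<^bsub>A\<^esub> k' y)"
    unfolding re_def z_def[symmetric] by (simp add: A.frameD[OF F])
  also have "nrm A \<dots> \<le> nrm A (re y \<oplus>\<^bsub>A\<^esub> A.scal m) + nrm A ((1/2) \<odot>\<^bsub>A\<^esub> (z \<ominus>\<^bsub>A\<^esub> k' y))"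
    using v z A.S_in[OF re_in[OF y(1)]] by (intro A.nrm_triangle_diff) auto
  also have "nrm A ((1/2) \<odot>\<^bsub>A\<^esub> (z \<ominus>\<^bsub>A\<^esub> k' y)) \<le> d"
    using star_close[OF y] v z d by (simp add: A.nrm_smult z_def)
  finally show "nrm B (y \<oplus>\<^bsub>B\<^esub> B.scal m) \<le> nrm A (re y \<oplus>\<^bsub>A\<^esub> A.scal m) + 2 * d" using close by simp
qed

text \<open>On the unit ball of \<open>size\<close> both values of \<open>upper\<close> are norms at
  the shift \<open>D * R\<close> minus \<open>D * R\<close>, so \<open>close_norms\<close> provides
  the compatibility condition and \<open>state_near\<close> the state. The error
  \<open>2 * d * size y\<close> is chosen to fit both directions.\<close>

lemma state_B_exists:
  assumes \<mu>: "\<mu> \<in> states A V"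
  obtains \<nu> where "\<nu> \<in> states B W" "\<forall>y\<in>B.S. \<bar>\<mu> (re y) - \<nu> y\<bar> \<le> 2 * d * size y"
proof -
  have bound: "\<mu> (re y) \<le> B.upper y + 2 * d * size y" if "y \<in> B.S" for y
  proof (rule unit_size_imp[OF _ _ _ that])
    fix y assume y: "y \<in> B.S" "M y \<le> 1" "nrm B y \<le> R"
    note c = close_norms[OF y]
    have "\<mu> (re y) \<le> A.upper (re y)" by (rule A.state_le_upper[OF \<mu> re_in[OF y(1)]])
    also have "\<dots> = nrm A (re y \<oplus>\<^bsub>A\<^esub> A.scal (D * R)) - D * R"
      by (rule A.upper_eq[OF A.nonzero A.S_herm[OF re_in[OF y(1)]] c(1)])
    also have "\<dots> \<le> nrm B (y \<oplus>\<^bsub>B\<^esub> B.scal (D * R)) - D * R + d" using c(3) by simp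
    also have "\<dots> = B.upper y + d" using B.upper_eq[OF B.nonzero B.S_herm[OF y(1)] c(2)] by simp
    finally show "\<mu> (re y) \<le> B.upper y + 2 * d" using d by simp
  qed (simp_all add: re_smult A.state_smult[OF \<mu>] re_in B.upper_smult B.S_herm)
  obtain \<nu> where \<nu>: "\<nu> \<in> states B W" "\<forall>y\<in>B.S. \<bar>\<nu> y - \<mu> (re y)\<bar> \<le> 2 * d * size y"
  proof (rule B.state_near[OF B.unital_cstar_algebra_axioms B.S_real_subspace,
        where h = "\<lambda>y. y" and g = "\<lambda>y. \<mu> (re y)" and s = "\<lambda>y. 2 * d * size y"])
    show "2 * d * size (y \<oplus>\<^bsub>B\<^esub> z) \<le> 2 * d * size y + 2 * d * size z" if "y \<in> B.S" "z \<in> B.S" for y z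
      using mult_left_mono[OF size_add[OF that], of "2 * d"] d by (simp add: distrib_left)
  qed (simp_all add: re_add re_smult A.state_add[OF \<mu>] A.state_smult[OF \<mu>] re_in size_smult bound)
  have "\<forall>y\<in>B.S. \<bar>\<mu> (re y) - \<nu> y\<bar> \<le> 2 * d * size y"
    using \<nu>(2) by (simp add: abs_minus_commute)
  then show thesis using that \<nu>(1) by blast
qed

lemma state_A_exists:
  assumes \<nu>: "\<nu> \<in> states B W"
  obtains \<mu> where "\<mu> \<in> states A V" "\<forall>y\<in>B.S. \<bar>\<mu> (re y) - \<nu> y\<bar> \<le> 2 * d * size y"
proof -
  have bound: "\<nu> y \<le> A.upper (re y) + 2 * d * size y" if "y \<in> B.S" for y
  proof (rule unit_size_imp[OF _ _ _ that])
    fix y assume y: "y \<in> B.S" "M y \<le> 1" "nrm B y \<le> R"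
    note c = close_norms[OF y]
    have "\<nu> y \<le> B.upper y" by (rule B.state_le_upper[OF \<nu> y(1)])
    also have "\<dots> = nrm B (y \<oplus>\<^bsub>B\<^esub> B.scal (D * R)) - D * R"
      by (rule B.upper_eq[OF B.nonzero B.S_herm[OF y(1)] c(2)])
    also have "\<dots> \<le> nrm A (re y \<oplus>\<^bsub>A\<^esub> A.scal (D * R)) - D * R + 2 * d" using c(4) by simp
    also have "\<dots> = A.upper (re y) + 2 * d"
      using A.upper_eq[OF A.nonzero A.S_herm[OF re_in[OF y(1)]] c(1)] by simp
    finally show "\<nu> y \<le> A.upper (re y) + 2 * d" .
  qed (simp_all add: re_smult B.state_smult[OF \<nu>] A.upper_smult[OF A.S_herm[OF re_in]])
  show thesis
  proof (rule A.state_near[OF B.unital_cstar_algebra_axioms B.S_real_subspace,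
        where h = re and g = \<nu> and s = "\<lambda>y. 2 * d * size y"])
    show "2 * d * size (y \<oplus>\<^bsub>B\<^esub> z) \<le> 2 * d * size y + 2 * d * size z" if "y \<in> B.S" "z \<in> B.S" for y z
      using mult_left_mono[OF size_add[OF that], of "2 * d"] d by (simp add: distrib_left)
  qed (use that in \<open>simp_all add: re_add re_smult B.state_add[OF \<nu>] B.state_smult[OF \<nu>] re_in size_smult bound\<close>)
qed

section \<open>The bridge semi-norm\<close>

abbreviation C where "C \<equiv> direct_sum A B"

definition bridge_seminorm :: "'a \<times> 'b \<Rightarrow> real"
  where "bridge_seminorm = (\<lambda>(x, y). max (max (L x) (M y)) (nrm B (k x \<ominus>\<^bsub>B\<^esub> y) / d))"

lemma C_cstar: "unital_cstar_algebra C"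
  by (rule unital_cstar_algebra_direct_sum[OF A.unital_cstar_algebra_axioms B.unital_cstar_algebra_axioms])

lemma C_diff: "\<lbrakk>a \<in> carrier A; b \<in> carrier B; a' \<in> carrier A; b' \<in> carrier B\<rbrakk> \<Longrightarrow>
    (a, b) \<ominus>\<^bsub>C\<^esub> (a', b') = (a \<ominus>\<^bsub>A\<^esub> a', b \<ominus>\<^bsub>B\<^esub> b')"
  by (rule direct_sum_diff[OF A.unital_cstar_algebra_axioms B.unital_cstar_algebra_axioms])

lemma sa_C: "sa C (V \<times> W) = A.S \<times> B.S"
  by (auto simp: sa_def)

sublocale C: unital_subspace C "V \<times> W"
proof (intro unital_subspace.intro C_cstar unital_subspace_axioms.intro)
  interpret C: unital_cstar_algebra C by (rule C_cstar)
  show "\<one>\<^bsub>C\<^esub> \<noteq> \<zero>\<^bsub>C\<^esub>" using A.nonzero by simp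
  have zero: "\<zero>\<^bsub>A\<^esub> \<in> V" "\<zero>\<^bsub>B\<^esub> \<in> W" using A.S_V[OF A.S_zero] B.S_V[OF B.S_zero] by auto
  have "submodule (V \<times> W) complex_field C"
  proof (rule C.submoduleI)
    show "V \<times> W \<subseteq> carrier C" using A.V_in B.V_in by auto
    show "\<zero>\<^bsub>C\<^esub> \<in> V \<times> W" using zero by simp
    show "\<ominus>\<^bsub>C\<^esub> x \<in> V \<times> W" if x: "x \<in> V \<times> W" for x
    proof -
      obtain a b where ab: "x = (a, b)" "a \<in> V" "b \<in> W" using x by auto
      have "\<ominus>\<^bsub>C\<^esub> x = (- 1) \<odot>\<^bsub>C\<^esub> x"
        using ab A.V_in B.V_in by (intro C.a_inv_smult) simp
      then show ?thesis using ab A.V_smult B.V_smult by simp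
    qed
    show "x \<oplus>\<^bsub>C\<^esub> y \<in> V \<times> W" if "x \<in> V \<times> W" "y \<in> V \<times> W" for x y
      using that A.V_add B.V_add by auto
    show "c \<odot>\<^bsub>C\<^esub> x \<in> V \<times> W" if "x \<in> V \<times> W" for c :: complex and x
      using that A.V_smult B.V_smult by auto
  qed
  moreover have "star C ` (V \<times> W) = V \<times> W"
  proof
    show "star C ` (V \<times> W) \<subseteq> V \<times> W" using A.V_star B.V_star by auto
    show "V \<times> W \<subseteq> star C ` (V \<times> W)"
    proof
      fix x assume "x \<in> V \<times> W"
      then obtain a b where ab: "x = (a, b)" "a \<in> V" "b \<in> W" by auto
      then have "x = star C (star A a, star B b)" "(star A a, star B b) \<in> V \<times> W"
        using A.V_in B.V_in A.V_star B.V_star by simp_all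
      then show "x \<in> star C ` (V \<times> W)" by blast
    qed
  qed
  ultimately show "unital_selfadjoint_subspace C (V \<times> W)"
    using A.V_one B.V_one by (simp add: unital_selfadjoint_subspace_def)
qed

lemma bridge_seminorm: "seminorm_on \<real> C C.S bridge_seminorm"
  unfolding seminorm_on_def sa_C
proof (intro conjI ballI)
  fix p assume p: "p \<in> A.S \<times> B.S"
  then obtain x y where xy: "p = (x, y)" "x \<in> A.S" "y \<in> B.S" by auto
  note v = A.S_V[OF xy(2)] B.S_V[OF xy(3)] B.V_in[OF k_in[OF A.S_V[OF xy(2)]]] B.S_in[OF xy(3)]
  show "0 \<le> bridge_seminorm p" using L_nonneg[OF xy(2)] by (simp add: bridge_seminorm_def xy le_max_iff_disj)
  show "bridge_seminorm (p \<oplus>\<^bsub>C\<^esub> q) \<le> bridge_seminorm p + bridge_seminorm q" if q: "q \<in> A.S \<times> B.S" for q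
  proof -
    obtain x' y' where xy': "q = (x', y')" "x' \<in> A.S" "y' \<in> B.S" using q by auto
    note v' = A.S_V[OF xy'(2)] B.S_V[OF xy'(3)] B.V_in[OF k_in[OF A.S_V[OF xy'(2)]]] B.S_in[OF xy'(3)]
    obtain F where F: "B.frame (k x) (k x') y y' F" by (rule B.frame_exists[OF v(3) v'(3) v(4) v'(4)])
    have "k (x \<oplus>\<^bsub>A\<^esub> x') \<ominus>\<^bsub>B\<^esub> (y \<oplus>\<^bsub>B\<^esub> y') = (k x \<ominus>\<^bsub>B\<^esub> y) \<oplus>\<^bsub>B\<^esub> (k x' \<ominus>\<^bsub>B\<^esub> y')"
      unfolding k_add[OF v(1) v'(1)] by (simp add: B.frameD[OF F])
    then have "nrm B (k (x \<oplus>\<^bsub>A\<^esub> x') \<ominus>\<^bsub>B\<^esub> (y \<oplus>\<^bsub>B\<^esub> y')) / d \<le>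
        nrm B (k x \<ominus>\<^bsub>B\<^esub> y) / d + nrm B (k x' \<ominus>\<^bsub>B\<^esub> y') / d"
      using B.nrm_triangle[of "k x \<ominus>\<^bsub>B\<^esub> y" "k x' \<ominus>\<^bsub>B\<^esub> y'"] v v' d
      by (simp add: divide_right_mono flip: add_divide_distrib)
    then show ?thesis
      using L_add[OF xy(2) xy'(2)] M_add[OF xy(3) xy'(3)]
      unfolding xy(1) xy'(1) bridge_seminorm_def by simp linarith
  qed
next
  fix c :: complex and p assume c: "c \<in> \<real>" and "p \<in> A.S \<times> B.S"
  then obtain x y where xy: "p = (x, y)" "x \<in> A.S" "y \<in> B.S" by auto
  note v = A.S_V[OF xy(2)] B.S_V[OF xy(3)] B.V_in[OF k_in[OF A.S_V[OF xy(2)]]] B.S_in[OF xy(3)]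
  have "k (c \<odot>\<^bsub>A\<^esub> x) \<ominus>\<^bsub>B\<^esub> c \<odot>\<^bsub>B\<^esub> y = c \<odot>\<^bsub>B\<^esub> (k x \<ominus>\<^bsub>B\<^esub> y)"
  proof -
    obtain F where F: "B.frame (k x) y y y F" by (rule B.frame_exists[OF v(3,4,4,4)])
    show ?thesis unfolding k_smult[OF v(1)] by (simp add: B.frameD[OF F])
  qed
  then have "nrm B (k (c \<odot>\<^bsub>A\<^esub> x) \<ominus>\<^bsub>B\<^esub> c \<odot>\<^bsub>B\<^esub> y) = cmod c * nrm B (k x \<ominus>\<^bsub>B\<^esub> y)"
    using v by (simp add: B.nrm_smult)
  then show "bridge_seminorm (c \<odot>\<^bsub>C\<^esub> p) = cmod c * bridge_seminorm p"
    using L_mul[OF c xy(2)] M_mul[OF c xy(3)]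
    by (simp add: bridge_seminorm_def xy(1) max_mult_distrib_left)
qed

lemma bridge_seminorm_le_iff:
  "bridge_seminorm (x, y) \<le> 1 \<longleftrightarrow> L x \<le> 1 \<and> M y \<le> 1 \<and> nrm B (k x \<ominus>\<^bsub>B\<^esub> y) \<le> d"
  using d by (simp add: bridge_seminorm_def)

text \<open>Subtracting a scalar bounds \<open>x\<close> by \<open>R\<close>, and then the bridge
  term bounds \<open>y\<close> by \<open>D * R + d\<close>. So a product of finite nets of the two
  Lipschitz balls is a net modulo scalars.\<close>

lemma bridge_metrizes: "metrizes_states C (V \<times> W) bridge_seminorm"
proof (rule C.metrizes_states_of_totally_bounded[OF bridge_seminorm])
  fix e :: real assume e: "e > 0"
  obtain F1 where F1: "finite F1" "F1 \<subseteq> {x \<in> A.S. L x \<le> 1 \<and> nrm A x \<le> R}"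
    "\<forall>x\<in>A.S. L x \<le> 1 \<longrightarrow> nrm A x \<le> R \<longrightarrow> (\<exists>w\<in>F1. nrm A (x \<ominus>\<^bsub>A\<^esub> w) \<le> e)"
    by (rule A.lip_ball_totally_bounded[OF Lmet e])
  obtain F2 where F2: "finite F2" "F2 \<subseteq> {y \<in> B.S. M y \<le> 1 \<and> nrm B y \<le> D * R + d}"
    "\<forall>y\<in>B.S. M y \<le> 1 \<longrightarrow> nrm B y \<le> D * R + d \<longrightarrow> (\<exists>w\<in>F2. nrm B (y \<ominus>\<^bsub>B\<^esub> w) \<le> e)"
    by (rule B.lip_ball_totally_bounded[OF Mmet e])
  show "\<exists>F. finite F \<and> F \<subseteq> C.S \<and> (\<forall>p\<in>C.S. bridge_seminorm p \<le> 1 \<longrightarrow>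
      (\<exists>w\<in>F. \<exists>c. nrm C (p \<ominus>\<^bsub>C\<^esub> C.scal c \<ominus>\<^bsub>C\<^esub> w) \<le> e))"
  proof (intro exI[of _ "F1 \<times> F2"] conjI ballI impI)
    show "finite (F1 \<times> F2)" using F1(1) F2(1) by simp
    show "F1 \<times> F2 \<subseteq> C.S" using F1(2) F2(2) by (auto simp: sa_C)
    fix p assume "p \<in> C.S" and p1: "bridge_seminorm p \<le> 1"
    then obtain x y where xy: "p = (x, y)" "x \<in> A.S" "y \<in> B.S" by (auto simp: sa_C)
    have le: "L x \<le> 1" "M y \<le> 1" "nrm B (k x \<ominus>\<^bsub>B\<^esub> y) \<le> d"
      using p1 bridge_seminorm_le_iff by (simp_all add: xy(1))
    obtain c where c: "nrm A (x \<ominus>\<^bsub>A\<^esub> A.scal c) \<le> 2 * (R / 2)"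
      by (rule A.radius_bound[OF L_radius _ xy(2) le(1)]) (use R in simp)
    define x' y' where "x' = x \<ominus>\<^bsub>A\<^esub> A.scal c" and "y' = y \<ominus>\<^bsub>B\<^esub> B.scal c"
    have x': "x' \<in> A.S" and y': "y' \<in> B.S" using xy A.S_diff B.S_diff by (auto simp: x'_def y'_def)
    note v = A.S_in[OF x'] B.S_in[OF y'] B.V_in[OF k_in[OF A.S_V[OF x']]]
    have L': "L x' \<le> 1" "M y' \<le> 1"
      using L_shift[OF xy(2), of c] M_shift[OF xy(3), of c] le by (simp_all add: x'_def y'_def)
    have nx: "nrm A x' \<le> R" using c by (simp add: x'_def)
    have "nrm B y' \<le> nrm B (k x') + nrm B (k x' \<ominus>\<^bsub>B\<^esub> y')"
    proof -
      obtain F where F: "B.frame (k x') y' y' y' F" by (rule B.frame_exists[OF v(3,2,2,2)])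
      have "y' = k x' \<ominus>\<^bsub>B\<^esub> (k x' \<ominus>\<^bsub>B\<^esub> y')" by (simp add: B.frameD[OF F])
      then show ?thesis using B.nrm_triangle_diff[OF v(3), of "k x' \<ominus>\<^bsub>B\<^esub> y'"] v by simp
    qed
    also have "\<dots> \<le> D * R + d"
    proof -
      have "nrm B (k x' \<ominus>\<^bsub>B\<^esub> y') \<le> d" using le(3) k_shift[OF xy(2,3), of c] by (simp add: x'_def y'_def)
      then show ?thesis
        using k_nrm[OF A.S_V[OF x']] mult_left_mono[OF nx D(1)] by linarith
    qed
    finally have ny: "nrm B y' \<le> D * R + d" .
    obtain w1 where w1: "w1 \<in> F1" "nrm A (x' \<ominus>\<^bsub>A\<^esub> w1) \<le> e" using F1(3) x' L'(1) nx by blast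
    obtain w2 where w2: "w2 \<in> F2" "nrm B (y' \<ominus>\<^bsub>B\<^esub> w2) \<le> e" using F2(3) y' L'(2) ny by blast
    have ws: "w1 \<in> carrier A" "w2 \<in> carrier B"
      using w1(1) w2(1) F1(2) F2(2) A.S_in B.S_in by blast+
    have "p \<ominus>\<^bsub>C\<^esub> C.scal c \<ominus>\<^bsub>C\<^esub> (w1, w2) = (x' \<ominus>\<^bsub>A\<^esub> w1, y' \<ominus>\<^bsub>B\<^esub> w2)"
      using ws v A.S_in[OF xy(2)] B.S_in[OF xy(3)] by (simp add: xy(1) C_diff x'_def y'_def)
    then show "\<exists>w\<in>F1 \<times> F2. \<exists>c. nrm C (p \<ominus>\<^bsub>C\<^esub> C.scal c \<ominus>\<^bsub>C\<^esub> w) \<le> e"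
      using w1 w2 by (intro bexI[of _ "(w1, w2)"] exI[of _ c]) simp_all
  qed
qed

lemma bridge_scale:
  assumes "x \<in> A.S" "y \<in> B.S" "0 \<le> r"
  shows "bridge_seminorm (complex_of_real r \<odot>\<^bsub>A\<^esub> x, complex_of_real r \<odot>\<^bsub>B\<^esub> y) = r * bridge_seminorm (x, y)"
proof -
  have "bridge_seminorm (complex_of_real r \<odot>\<^bsub>C\<^esub> (x, y)) = cmod (complex_of_real r) * bridge_seminorm (x, y)"
    using bridge_seminorm assms unfolding seminorm_on_def sa_C by (metis Reals_of_real mem_Sigma_iff)
  then show ?thesis using assms by simp
qed

text \<open>The maximum gives one inequality. For the other, rescale \<open>x\<close> into the
  Lipschitz ball and take the partner from \<open>L_approx\<close>: its tolerance \<open>d\<close>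
  means exactly a bridge term of at most 1. Dividing by \<open>L x + e\<close> covers
  \<open>L x = 0\<close>.\<close>

lemma L_quotient:
  assumes x: "x \<in> A.S"
  shows "L x = (INF y\<in>B.S. bridge_seminorm (x, y))"
proof (rule antisym)
  show "L x \<le> (INF y\<in>B.S. bridge_seminorm (x, y))"
  proof (rule cINF_greatest)
    show "B.S \<noteq> {}" using B.S_one by blast
  qed (simp add: bridge_seminorm_def)
  have bdd: "bdd_below ((\<lambda>y. bridge_seminorm (x, y)) ` B.S)"
    by (rule bdd_belowI[of _ "L x"]) (auto simp: bridge_seminorm_def)
  show "(INF y\<in>B.S. bridge_seminorm (x, y)) \<le> L x"
  proof (rule field_le_epsilon)
    fix e :: real assume e: "e > 0"
    define r where "r = L x + e"
    have r: "r > 0" "L x \<le> r" using e L_nonneg[OF x] by (auto simp: r_def)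
    define z where "z = complex_of_real (1 / r) \<odot>\<^bsub>A\<^esub> x"
    have z: "z \<in> A.S" unfolding z_def by (rule A.S_smult[OF x])
    have "L z \<le> 1" using L_mul[of "complex_of_real (1 / r)" x] x r by (simp add: z_def norm_divide)
    then obtain y where y: "y \<in> B.S" "M y \<le> 1" "nrm B (k z \<ominus>\<^bsub>B\<^esub> y) \<le> d"
      using L_approx[OF z] by blast
    have "bridge_seminorm (z, y) \<le> 1" using y \<open>L z \<le> 1\<close> bridge_seminorm_le_iff by simp
    moreover have "x = complex_of_real r \<odot>\<^bsub>A\<^esub> z" using r A.S_in[OF x] by (simp add: z_def)
    ultimately have "bridge_seminorm (x, complex_of_real r \<odot>\<^bsub>B\<^esub> y) \<le> r"
      using bridge_scale[OF z y(1), of r] r by simp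
    then show "(INF y\<in>B.S. bridge_seminorm (x, y)) \<le> L x + e"
      using cINF_lower[OF bdd B.S_smult[OF y(1), of r]] unfolding r_def by linarith
  qed
qed

lemma M_quotient:
  assumes y: "y \<in> B.S"
  shows "M y = (INF x\<in>A.S. bridge_seminorm (x, y))"
proof (rule antisym)
  show "M y \<le> (INF x\<in>A.S. bridge_seminorm (x, y))"
  proof (rule cINF_greatest)
    show "A.S \<noteq> {}" using A.S_one by blast
  qed (simp add: bridge_seminorm_def)
  have bdd: "bdd_below ((\<lambda>x. bridge_seminorm (x, y)) ` A.S)"
    by (rule bdd_belowI[of _ "M y"]) (auto simp: bridge_seminorm_def)
  show "(INF x\<in>A.S. bridge_seminorm (x, y)) \<le> M y"
  proof (rule field_le_epsilon)
    fix e :: real assume e: "e > 0"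
    define r where "r = M y + e"
    have r: "r > 0" "M y \<le> r" using e M_nonneg[OF y] by (auto simp: r_def)
    define z where "z = complex_of_real (1 / r) \<odot>\<^bsub>B\<^esub> y"
    have z: "z \<in> B.S" unfolding z_def by (rule B.S_smult[OF y])
    have "M z \<le> 1" using M_mul[of "complex_of_real (1 / r)" y] y r by (simp add: z_def norm_divide)
    then obtain x where x: "x \<in> A.S" "L x \<le> 1" "nrm B (k x \<ominus>\<^bsub>B\<^esub> z) \<le> d"
      using M_approx[OF z] by blast
    have "bridge_seminorm (x, z) \<le> 1" using x \<open>M z \<le> 1\<close> bridge_seminorm_le_iff by simp
    moreover have "y = complex_of_real r \<odot>\<^bsub>B\<^esub> z" using r B.S_in[OF y] by (simp add: z_def)
    ultimately have "bridge_seminorm (complex_of_real r \<odot>\<^bsub>A\<^esub> x, y) \<le> r"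
      using bridge_scale[OF x(1) z, of r] r by simp
    then show "(INF x\<in>A.S. bridge_seminorm (x, y)) \<le> M y + e"
      using cINF_lower[OF bdd A.S_smult[OF x(1), of r]] unfolding r_def by linarith
  qed
qed

lemma bridge_admissible: "admissible A V L B W M bridge_seminorm"
proof -
  have "bridge_seminorm \<one>\<^bsub>C\<^esub> = 0"
    using L1 M1 k_one B.M.r_neg[of "\<one>\<^bsub>B\<^esub>"] by (simp add: bridge_seminorm_def B.M.minus_eq)
  then show ?thesis
    using C.subspace bridge_seminorm bridge_metrizes L_quotient M_quotient
    by (simp add: admissible_def order_unit_cqms_def)
qed

text \<open>\<open>D * d\<close> is the cost of replacing \<open>x\<close> by \<open>re y\<close>,
  and \<open>2 * d\<close> that of comparing the states at \<open>re y\<close> and \<open>y\<close>.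
  Beforehand one scalar is subtracted from both \<open>x\<close> and \<open>y\<close>, which changes
  both state values equally and makes \<open>size\<close> at most 1.\<close>

lemma rho_bridge_le:
  assumes \<mu>: "\<mu> \<in> states A V" and \<nu>: "\<nu> \<in> states B W"
    and close: "\<forall>y\<in>B.S. \<bar>\<mu> (re y) - \<nu> y\<bar> \<le> 2 * d * size y"
  shows "rho C (V \<times> W) bridge_seminorm (pullback_fst A V B W \<mu>) (pullback_snd A V B W \<nu>)
    \<le> ennreal ((D + 2) * d)"
  unfolding rho_def
proof (rule SUP_least)
  fix p assume p: "p \<in> {p \<in> C.S. bridge_seminorm p \<le> 1}"
  then obtain x y where xy: "p = (x, y)" "x \<in> A.S" "y \<in> B.S" by (auto simp: sa_C)
  have le: "L x \<le> 1" "M y \<le> 1" "nrm B (k x \<ominus>\<^bsub>B\<^esub> y) \<le> d"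
    using p bridge_seminorm_le_iff by (simp_all add: xy(1))
  obtain c where c: "nrm B (y \<ominus>\<^bsub>B\<^esub> B.scal c) \<le> 2 * (R / 2)"
    by (rule B.radius_bound[OF M_radius _ xy(3) le(2)]) (use R in simp)
  define x' y' where "x' = x \<ominus>\<^bsub>A\<^esub> A.scal c" and "y' = y \<ominus>\<^bsub>B\<^esub> B.scal c"
  have x': "x' \<in> A.S" and y': "y' \<in> B.S" using xy A.S_diff B.S_diff by (auto simp: x'_def y'_def)
  have "size y' \<le> 1"
    using M_shift[OF xy(3), of c] le(2) c R by (simp add: size_def y'_def)
  then have 1: "\<bar>\<mu> (re y') - \<nu> y'\<bar> \<le> 2 * d"
    using bspec[OF close y'] mult_left_mono[of "size y'" 1 "2 * d"] d by linarith
  have "\<bar>\<mu> (x' \<ominus>\<^bsub>A\<^esub> re y')\<bar> \<le> nrm A (x' \<ominus>\<^bsub>A\<^esub> re y')"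
    by (intro A.state_abs_le[OF \<mu>] A.S_diff x' re_in y')
  also have "\<dots> \<le> D * nrm B (k x' \<ominus>\<^bsub>B\<^esub> y')" by (rule nrm_diff_re[OF x' y'])
  also have "\<dots> \<le> D * d"
    using le(3) k_shift[OF xy(2,3), of c] D(1) by (intro mult_left_mono) (simp_all add: x'_def y'_def)
  finally have 2: "\<bar>\<mu> x' - \<mu> (re y')\<bar> \<le> D * d"
    using A.state_diff[OF \<mu> x' re_in[OF y']] by simp
  have "\<mu> x - \<nu> y = \<mu> x' - \<nu> y'"
    using xy(2,3) by (simp add: x'_def y'_def A.state_diff[OF \<mu>] B.state_diff[OF \<nu>] A.state_scal[OF \<mu>] B.state_scal[OF \<nu>])
  then have "\<bar>\<mu> x - \<nu> y\<bar> \<le> (D + 2) * d" using 1 2 by (simp add: distrib_right)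
  moreover have "p \<in> C.S" using p by simp
  ultimately show "ennreal \<bar>pullback_fst A V B W \<mu> p - pullback_snd A V B W \<nu> p\<bar> \<le> ennreal ((D + 2) * d)"
    unfolding pullback_fst_def pullback_snd_def by (intro ennreal_leI) (simp add: xy(1))
qed

theorem dist_q_le: "dist_q A V L B W M \<le> ennreal ((D + 2) * d)"
proof -
  let ?rho = "rho C (V \<times> W) bridge_seminorm"
  let ?X = "pullback_fst A V B W ` states A V" and ?Y = "pullback_snd A V B W ` states B W"
  have "hausdorff_distance ?rho ?X ?Y \<le> ennreal ((D + 2) * d)"
    unfolding hausdorff_distance_def
  proof (rule max.boundedI; rule SUP_least)
    fix p assume "p \<in> ?X"
    then obtain \<mu> where \<mu>: "\<mu> \<in> states A V" "p = pullback_fst A V B W \<mu>" by blast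
    obtain \<nu> where \<nu>: "\<nu> \<in> states B W" "\<forall>y\<in>B.S. \<bar>\<mu> (re y) - \<nu> y\<bar> \<le> 2 * d * size y"
      by (rule state_B_exists[OF \<mu>(1)])
    show "(INF q\<in>?Y. ?rho p q) \<le> ennreal ((D + 2) * d)"
      using rho_bridge_le[OF \<mu>(1) \<nu>] \<nu>(1) unfolding \<mu>(2) by (intro INF_lower2) auto
  next
    fix q assume "q \<in> ?Y"
    then obtain \<nu> where \<nu>: "\<nu> \<in> states B W" "q = pullback_snd A V B W \<nu>" by blast
    obtain \<mu> where \<mu>: "\<mu> \<in> states A V" "\<forall>y\<in>B.S. \<bar>\<mu> (re y) - \<nu> y\<bar> \<le> 2 * d * size y"
      by (rule state_A_exists[OF \<nu>(1)])
    show "(INF p\<in>?X. ?rho p q) \<le> ennreal ((D + 2) * d)"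
      using rho_bridge_le[OF \<mu>(1) \<nu>(1) \<mu>(2)] \<mu>(1) unfolding \<nu>(2) by (intro INF_lower2) auto
  qed
  then show ?thesis
    unfolding dist_q_def using bridge_admissible by (intro INF_lower2) auto
qed

end

section \<open>Continuity at a point\<close>

text \<open>\<open>D\<close> encodes condition (4) as a direct comparison of any two fibre norms on
  \<open>V\<close>, and \<open>R\<close> the uniform bound on the radii.\<close>

locale uniform_field = cstar_field A j for A :: "'a cstar" (structure)
    and j :: "('t::topological_space \<Rightarrow> complex) \<Rightarrow> 'a" +
  fixes V :: "'a set" and L :: "'t \<Rightarrow> 'a set \<Rightarrow> real" and t0 :: 't and D R :: real
  assumes field: "continuous_field A j"
    and V: "submodule V complex_field A"
    and V_one: "\<one> \<in> V"
    and subspaces: "unital_subspace (fibre A j t) (ev A j t ` V)"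
    and inj: "inj_on (ev A j t) V"
    and L_seminorm: "seminorm_on UNIV (fibre A j t) (ev A j t ` V) (L t)"
    and L_one: "L t \<one>\<^bsub>fibre A j t\<^esub> = 0"
    and L_star: "X \<in> ev A j t ` V \<Longrightarrow> L t (star (fibre A j t) X) = L t X"
    and cqms: "order_unit_cqms (fibre A j t) (ev A j t ` V) (L t)"
    and L_cont: "y \<in> V \<Longrightarrow> continuous_on UNIV (\<lambda>t. L t (ev A j t y))"
    and L_lower: "e > 0 \<Longrightarrow> \<exists>U. open U \<and> t0 \<in> U \<and>
      (\<forall>y\<in>V. \<forall>t\<in>U. (1 - e) * L t0 (ev A j t0 y) \<le> L t (ev A j t y))"
    and D: "1 \<le> D" and R: "0 < R"
    and nrm_bound: "y \<in> V \<Longrightarrow> nrm (fibre A j t) (ev A j t y) \<le> D * nrm (fibre A j s) (ev A j s y)"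
    and radius_bound: "radius (fibre A j t) (ev A j t ` V) (L t) \<le> ennreal (R / 2)"
begin

abbreviation B where "B t \<equiv> fibre A j t"
abbreviation E where "E t \<equiv> ev A j t"

section \<open>Norms, semi-norms and involutions pulled back to \<open>V\<close>\<close>

definition n :: "'t \<Rightarrow> 'a \<Rightarrow> real" where "n t x = nrm (B t) (E t x)"
definition l :: "'t \<Rightarrow> 'a \<Rightarrow> real" where "l t x = L t (E t x)"
definition v :: "'t \<Rightarrow> 'a set \<Rightarrow> 'a" where "v t = inv_into V (E t)"

lemma VA: "x \<in> V \<Longrightarrow> x \<in> carrier A"
  and VA_add: "\<lbrakk>x \<in> V; y \<in> V\<rbrakk> \<Longrightarrow> x \<oplus> y \<in> V"
  and VA_smult: "x \<in> V \<Longrightarrow> c \<odot> x \<in> V"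
  using submoduleE(1,5)[OF V] submoduleE(4)[OF V, of c x] by (auto simp: complex_field_def)

lemma VA_diff: "\<lbrakk>x \<in> V; y \<in> V\<rbrakk> \<Longrightarrow> x \<ominus> y \<in> V"
  using VA_add[of x "(- 1) \<odot> y"] VA_smult[of y "-1"] VA by (simp add: M.minus_eq a_inv_smult)

lemma E_in [simp]: "x \<in> carrier A \<Longrightarrow> E t x \<in> carrier (B t)"
  by (rule ev_in)

lemma E_diff: "\<lbrakk>x \<in> carrier A; y \<in> carrier A\<rbrakk> \<Longrightarrow> E t (x \<ominus> y) = E t x \<ominus>\<^bsub>B t\<^esub> E t y"
proof -
  assume x: "x \<in> carrier A" "y \<in> carrier A"
  interpret Bt: unital_cstar_algebra "B t" by (rule fibre_cstar)
  show ?thesis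
    using x ev_add[of x "(-1) \<odot> y" t] ev_smult[of y t "-1"]
    by (simp add: M.minus_eq a_inv_smult Bt.M.minus_eq Bt.a_inv_smult)
qed

lemma E_scal: "E t (scal r) = complex_of_real r \<odot>\<^bsub>B t\<^esub> \<one>\<^bsub>B t\<^esub>"
  using ev_smult[of \<one> t "complex_of_real r"] ev_one[of \<one> t] by simp

lemma n_nonneg: "x \<in> carrier A \<Longrightarrow> 0 \<le> n t x"
  and n_add: "\<lbrakk>x \<in> carrier A; y \<in> carrier A\<rbrakk> \<Longrightarrow> n t (x \<oplus> y) \<le> n t x + n t y"
  and n_diff: "\<lbrakk>x \<in> carrier A; y \<in> carrier A\<rbrakk> \<Longrightarrow> n t (x \<ominus> y) \<le> n t x + n t y"
  and n_smult: "x \<in> carrier A \<Longrightarrow> n t (c \<odot> x) = cmod c * n t x"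
  and n_star: "x \<in> carrier A \<Longrightarrow> n t (star A x) = n t x"
proof -
  interpret Bt: unital_cstar_algebra "B t" by (rule fibre_cstar)
  show "x \<in> carrier A \<Longrightarrow> 0 \<le> n t x" "x \<in> carrier A \<Longrightarrow> n t (c \<odot> x) = cmod c * n t x"
    "x \<in> carrier A \<Longrightarrow> n t (star A x) = n t x"
    by (simp_all add: n_def ev_smult ev_star Bt.nrm_nonneg Bt.nrm_smult)
  show "\<lbrakk>x \<in> carrier A; y \<in> carrier A\<rbrakk> \<Longrightarrow> n t (x \<oplus> y) \<le> n t x + n t y"
    by (simp add: n_def ev_add Bt.nrm_triangle)
  show "\<lbrakk>x \<in> carrier A; y \<in> carrier A\<rbrakk> \<Longrightarrow> n t (x \<ominus> y) \<le> n t x + n t y"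
    by (simp add: n_def E_diff Bt.nrm_triangle_diff)
qed

lemma n_bound: "y \<in> V \<Longrightarrow> n t y \<le> D * n s y"
  unfolding n_def by (rule nrm_bound)

lemma l_nonneg: "x \<in> V \<Longrightarrow> 0 \<le> l t x"
  and l_add: "\<lbrakk>x \<in> V; y \<in> V\<rbrakk> \<Longrightarrow> l t (x \<oplus> y) \<le> l t x + l t y"
  and l_smult: "x \<in> V \<Longrightarrow> l t (c \<odot> x) = cmod c * l t x"
  using L_seminorm[of t] VA by (simp_all add: l_def seminorm_on_def ev_add ev_smult)

lemma v_in: "X \<in> E t ` V \<Longrightarrow> v t X \<in> V"
  and E_v: "X \<in> E t ` V \<Longrightarrow> E t (v t X) = X"
  unfolding v_def by (rule inv_into_into, assumption, rule f_inv_into_f)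

lemma v_E: "x \<in> V \<Longrightarrow> v t (E t x) = x"
  unfolding v_def using inj by (rule inv_into_f_f)

text \<open>The involution of the fibre transported to \<open>V\<close>, the same map as
  \<open>induced_star\<close>; the involution of \<open>A\<close> itself may lead out of
  \<open>V\<close>.\<close>

definition conj_at :: "'t \<Rightarrow> 'a \<Rightarrow> 'a" where "conj_at t x = v t (star (B t) (E t x))"

lemma conj_at:
  assumes "x \<in> V"
  shows "conj_at t x \<in> V" "E t (conj_at t x) = E t (star A x)" "l t (conj_at t x) = l t x"
proof -
  interpret Bt: unital_subspace "B t" "E t ` V" by (rule subspaces)
  have s: "star (B t) (E t x) \<in> E t ` V" using assms by (intro Bt.V_star) blast
  show "conj_at t x \<in> V" unfolding conj_at_def by (rule v_in[OF s])
  show "E t (conj_at t x) = E t (star A x)"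
    unfolding conj_at_def E_v[OF s] using VA[OF assms] by (simp add: ev_star)
  show "l t (conj_at t x) = l t x"
    unfolding l_def conj_at_def E_v[OF s] using assms by (intro L_star) blast
qed

text \<open>Classes in the fibre are compared, as \<open>star A x\<close> need not lie in
  \<open>V\<close>.\<close>

definition selfadj :: "'t \<Rightarrow> 'a \<Rightarrow> bool" where "selfadj t x \<longleftrightarrow> x \<in> V \<and> E t (star A x) = E t x"

lemma selfadj_iff: "selfadj t x \<longleftrightarrow> x \<in> V \<and> E t x \<in> sa (B t) (E t ` V)"
proof (cases "x \<in> V")
  case True
  then show ?thesis by (simp add: selfadj_def sa_def ev_star[OF VA[OF True]])
qed (simp add: selfadj_def)

lemma selfadj_shift:
  assumes "selfadj t x"
  shows "selfadj t (x \<oplus> scal c)" "selfadj t (x \<ominus> scal c)" "l t (x \<oplus> scal c) \<le> l t x"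
    "l t (x \<ominus> scal c) \<le> l t x"
proof -
  have x: "x \<in> V" "x \<in> carrier A" "E t (star A x) = E t x" using assms VA by (auto simp: selfadj_def)
  have sV: "scal r \<in> V" for r by (rule VA_smult[OF V_one])
  have "l t (scal r) = 0" for r
    using l_smult[OF V_one, of t "complex_of_real r"] L_one[of t] ev_one[of \<one> t] by (simp add: l_def)
  then have le: "l t (x \<oplus> scal r) \<le> l t x" for r using l_add[OF x(1) sV[of r], of t] by simp
  have eq: "x \<ominus> scal r = x \<oplus> scal (- r)" for r using x by (simp add: M.minus_eq minus_smult)
  have sa: "selfadj t (x \<oplus> scal r)" for r
    using x VA_add[OF x(1) sV[of r]] by (simp add: selfadj_def star_add star_smult ev_add)
  show "selfadj t (x \<oplus> scal c)" "selfadj t (x \<ominus> scal c)" "l t (x \<oplus> scal c) \<le> l t x"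
    "l t (x \<ominus> scal c) \<le> l t x"
    unfolding eq by (rule sa le)+
qed

lemma bounded_shift:
  assumes x: "selfadj t x" "l t x \<le> 1"
  obtains c where "n t (x \<ominus> scal c) \<le> R"
proof -
  interpret Bt: unital_subspace "B t" "E t ` V" by (rule subspaces)
  have "E t x \<in> Bt.S" "L t (E t x) \<le> 1" using x selfadj_iff by (auto simp: l_def)
  then obtain c where "nrm (B t) (E t x \<ominus>\<^bsub>B t\<^esub> Bt.scal c) \<le> 2 * (R / 2)"
    using Bt.radius_bound[OF radius_bound, of "E t x"] R by (metis less_imp_le half_gt_zero)
  then show thesis
    using that[of c] x VA by (simp add: n_def E_diff E_scal selfadj_def)
qed

text \<open>The norm bound is \<open>D * R\<close> rather than \<open>R\<close> so that the real and
  imaginary parts of an element with norm at most \<open>R\<close> in another fibre meet it as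
  well.\<close>

definition unit_ball :: "'a set"
  where "unit_ball = {y. selfadj t0 y \<and> l t0 y \<le> 1 \<and> n t0 y \<le> D * R}"

lemma unit_ballD: "y \<in> unit_ball \<Longrightarrow> y \<in> V"
  by (simp add: unit_ball_def selfadj_def)

lemma unit_ball_net:
  assumes "e > 0"
  obtains F where "finite F" "F \<subseteq> unit_ball" "\<forall>y\<in>unit_ball. \<exists>w\<in>F. n t0 (y \<ominus> w) \<le> e"
proof -
  interpret B0: unital_subspace "B t0" "E t0 ` V" by (rule subspaces)
  have m: "metrizes_states (B t0) (E t0 ` V) (L t0)" using cqms by (simp add: order_unit_cqms_def)
  obtain F where F: "finite F" "F \<subseteq> {X \<in> B0.S. L t0 X \<le> 1 \<and> nrm (B t0) X \<le> D * R}"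
    "\<forall>X\<in>B0.S. L t0 X \<le> 1 \<longrightarrow> nrm (B t0) X \<le> D * R \<longrightarrow> (\<exists>w\<in>F. nrm (B t0) (X \<ominus>\<^bsub>B t0\<^esub> w) \<le> e)"
    by (rule B0.lip_ball_totally_bounded[OF m assms])
  have vF: "v t0 X \<in> unit_ball" "E t0 (v t0 X) = X" if "X \<in> F" for X
  proof -
    have X: "X \<in> B0.S" "L t0 X \<le> 1" "nrm (B t0) X \<le> D * R" using F(2) that by auto
    have "X \<in> E t0 ` V" using X(1) by (simp add: sa_def)
    note * = v_in[OF this] E_v[OF this]
    show "E t0 (v t0 X) = X" by (rule *(2))
    show "v t0 X \<in> unit_ball" using * X by (simp add: unit_ball_def selfadj_iff l_def n_def)
  qed
  show thesis
  proof (rule that[of "v t0 ` F"])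
    show "finite (v t0 ` F)" using F(1) by simp
    show "v t0 ` F \<subseteq> unit_ball" using vF(1) by blast
    show "\<forall>y\<in>unit_ball. \<exists>w\<in>v t0 ` F. n t0 (y \<ominus> w) \<le> e"
    proof
      fix y assume y: "y \<in> unit_ball"
      then have "E t0 y \<in> B0.S" "L t0 (E t0 y) \<le> 1" "nrm (B t0) (E t0 y) \<le> D * R"
        by (simp_all add: unit_ball_def selfadj_iff l_def n_def)
      then obtain X where X: "X \<in> F" "nrm (B t0) (E t0 y \<ominus>\<^bsub>B t0\<^esub> X) \<le> e" using F(3) by blast
      have "n t0 (y \<ominus> v t0 X) \<le> e"
        using X vF[OF X(1)] VA[OF unit_ballD[OF y]] VA[OF unit_ballD[OF vF(1)[OF X(1)]]]
        by (simp add: n_def E_diff)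
      then show "\<exists>w\<in>v t0 ` F. n t0 (y \<ominus> w) \<le> e" using X(1) by blast
    qed
  qed
qed

text \<open>Continuity of the norms and semi-norms is available for one element at a time, hence
  near \<open>t0\<close> for finitely many \<open>w\<close> simultaneously; the last clause is
  condition (3), already uniform over \<open>V\<close>.\<close>

definition good :: "real \<Rightarrow> 'a set \<Rightarrow> 't \<Rightarrow> bool"
  where "good e F t \<longleftrightarrow>
    (\<forall>w\<in>F. \<bar>n t (w \<oplus> scal (D * R)) - n t0 (w \<oplus> scal (D * R))\<bar> < e \<and>
      n t (star A w \<ominus> w) < e \<and> l t w < 1 + e) \<and>
    (\<forall>y\<in>V. (1 - e) * l t0 y \<le> l t y)"

lemma eventually_good:
  assumes e: "e > 0" and F: "finite F" "F \<subseteq> unit_ball"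
  shows "eventually (good e F) (at t0)"
proof -
  have cont: "((\<lambda>t. n t x) \<longlongrightarrow> n t0 x) (at t0)" if "x \<in> carrier A" for x
    using field that unfolding continuous_field_def continuous_on_def n_def by auto
  have 1: "eventually (\<lambda>t. \<bar>n t x - n t0 x\<bar> < e) (at t0)" if "x \<in> carrier A" for x
    using tendstoD[OF cont[OF that] e] by (simp add: dist_real_def)
  have "eventually (\<lambda>t. \<bar>n t (w \<oplus> scal (D * R)) - n t0 (w \<oplus> scal (D * R))\<bar> < e \<and>
      n t (star A w \<ominus> w) < e \<and> l t w < 1 + e) (at t0)" if w: "w \<in> F" for w
  proof -
    have wb: "w \<in> unit_ball" using F(2) w by blast
    have wV: "w \<in> V" and wc: "w \<in> carrier A" using unit_ballD[OF wb] VA by auto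
    interpret B0: unital_cstar_algebra "B t0" by (rule fibre_cstar)
    \<comment> \<open>The defect of self-adjointness vanishes at \<open>t0\<close>, so continuity of
      its norm makes it small nearby.\<close>
    have "E t0 (star A w) = E t0 w" using wb by (simp add: unit_ball_def selfadj_def)
    then have "n t0 (star A w \<ominus> w) = 0"
      using wc by (simp add: n_def E_diff B0.M.minus_eq B0.M.r_neg)
    then have "eventually (\<lambda>t. n t (star A w \<ominus> w) < e) (at t0)"
      using 1[of "star A w \<ominus> w"] wc by (auto elim: eventually_mono)
    moreover have "((\<lambda>t. l t w) \<longlongrightarrow> l t0 w) (at t0)"
      using L_cont[OF wV] unfolding continuous_on_def l_def by auto
    then have "eventually (\<lambda>t. l t w < 1 + e) (at t0)"
      using wb e by (intro order_tendstoD(2)) (auto simp: unit_ball_def)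
    ultimately show ?thesis
      using 1[of "w \<oplus> scal (D * R)"] wc by (intro eventually_conj) auto
  qed
  then have "eventually (\<lambda>t. \<forall>w\<in>F. \<bar>n t (w \<oplus> scal (D * R)) - n t0 (w \<oplus> scal (D * R))\<bar> < e \<and>
      n t (star A w \<ominus> w) < e \<and> l t w < 1 + e) (at t0)"
    by (rule eventually_ball_finite[OF F(1) ballI])
  moreover obtain U where "open U" "t0 \<in> U" "\<forall>y\<in>V. \<forall>t\<in>U. (1 - e) * l t0 y \<le> l t y"
    using L_lower[OF e] unfolding l_def by blast
  then have "eventually (\<lambda>t. \<forall>y\<in>V. (1 - e) * l t0 y \<le> l t y) (at t0)"
    unfolding eventually_at_topological by blast
  ultimately show ?thesis unfolding good_def by (rule eventually_conj)
qed

text \<open>The sum of the constants in \<open>star_close\<close> and \<open>nrm_close\<close>,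
  \<open>approx_from_limit\<close> and \<open>approx_to_limit\<close>, so that one tolerance
  \<open>gap * e\<close> serves for all.\<close>

definition gap :: real
  where "gap = 3 * D + (D + D ^ 3 * R + D\<^sup>2) + (6 * D\<^sup>2 + D * R)"

context
  fixes e F t
  assumes e: "0 < e" "e \<le> 1 / 2" and F: "F \<subseteq> unit_ball"
    and net: "\<forall>y\<in>unit_ball. \<exists>w\<in>F. n t0 (y \<ominus> w) \<le> e" and good: "good e F t"
begin

section \<open>Comparison of nearby fibres\<close>

lemma net_approx:
  assumes y: "y \<in> unit_ball"
  obtains w where "w \<in> F" "w \<in> unit_ball" "n t0 (y \<ominus> w) \<le> e" "n t (y \<ominus> w) \<le> D * e"
proof -
  obtain w where w: "w \<in> F" "n t0 (y \<ominus> w) \<le> e" using net y by blast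
  have wb: "w \<in> unit_ball" using F w(1) by blast
  have "n t (y \<ominus> w) \<le> D * n t0 (y \<ominus> w)" by (intro n_bound VA_diff unit_ballD y wb)
  also have "\<dots> \<le> D * e" using w(2) D by simp
  finally show thesis using that w wb by blast
qed

text \<open>The defect is below \<open>e\<close> at the net point; moving there changes
  \<open>y\<close> and its adjoint by at most \<open>D * e\<close> each in the fibre at
  \<open>t\<close>.\<close>

lemma star_close:
  assumes y: "y \<in> unit_ball"
  shows "n t (star A y \<ominus> y) \<le> 3 * D * e"
proof -
  obtain w where w: "w \<in> F" "w \<in> unit_ball" "n t (y \<ominus> w) \<le> D * e" by (rule net_approx[OF y])
  have c: "y \<in> carrier A" "w \<in> carrier A" using y w(2) unit_ballD VA by blast+
  define y' w' where "y' = star A y" and "w' = star A w"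
  have c': "y' \<in> carrier A" "w' \<in> carrier A" using c by (simp_all add: y'_def w'_def)
  obtain G where G: "frame y w y' w' G" by (rule frame_exists[OF c c'])
  have "y' \<ominus> y = ((w' \<ominus> w) \<oplus> (y' \<ominus> w')) \<ominus> (y \<ominus> w)" by (simp add: frameD[OF G])
  then have "n t (y' \<ominus> y) \<le> n t (w' \<ominus> w) + n t (y' \<ominus> w') + n t (y \<ominus> w)"
    using n_diff[of "(w' \<ominus> w) \<oplus> (y' \<ominus> w')" "y \<ominus> w" t] n_add[of "w' \<ominus> w" "y' \<ominus> w'" t] c c' by simp
  also have "n t (y' \<ominus> w') = n t (y \<ominus> w)"
    using n_star[of "y \<ominus> w" t] c by (simp add: star_diff y'_def w'_def)
  also have "n t (w' \<ominus> w) \<le> e" using good w(1) unfolding good_def w'_def by (simp add: less_imp_le)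
  finally have "n t (y' \<ominus> y) \<le> e + D * e + D * e" using w(3) by simp
  also have "\<dots> \<le> 3 * D * e" using D e mult_right_mono[of 1 D e] by simp
  finally show ?thesis by (simp add: y'_def)
qed

text \<open>The error is \<open>e\<close> at the net point, \<open>D * e\<close> for moving to it in
  the fibre at \<open>t\<close>, and \<open>e\<close> for moving to it in the fibre at
  \<open>t0\<close>.\<close>

lemma nrm_close:
  assumes y: "y \<in> unit_ball"
  shows "\<bar>n t (y \<oplus> scal (D * R)) - n t0 (y \<oplus> scal (D * R))\<bar> \<le> 3 * D * e"
proof -
  let ?m = "scal (D * R)"
  obtain w where w: "w \<in> F" "w \<in> unit_ball" "n t0 (y \<ominus> w) \<le> e" "n t (y \<ominus> w) \<le> D * e"
    by (rule net_approx[OF y])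
  have c: "y \<in> carrier A" "w \<in> carrier A" using y w(2) unit_ballD VA by blast+
  have lip: "\<bar>n s (y \<oplus> ?m) - n s (w \<oplus> ?m)\<bar> \<le> n s (y \<ominus> w)" for s
  proof -
    obtain G where G: "frame y w \<one> w G" by (rule frame_exists[OF c one_closed c(2)])
    have "y \<oplus> ?m = (w \<oplus> ?m) \<oplus> (y \<ominus> w)" "w \<oplus> ?m = (y \<oplus> ?m) \<ominus> (y \<ominus> w)"
      by (simp_all add: frameD[OF G])
    then have "n s (y \<oplus> ?m) \<le> n s (w \<oplus> ?m) + n s (y \<ominus> w)" "n s (w \<oplus> ?m) \<le> n s (y \<oplus> ?m) + n s (y \<ominus> w)"
      using n_add[of "w \<oplus> ?m" "y \<ominus> w" s] n_diff[of "y \<oplus> ?m" "y \<ominus> w" s] c by simp_all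
    then show ?thesis by simp
  qed
  have "\<bar>n t (w \<oplus> ?m) - n t0 (w \<oplus> ?m)\<bar> < e" using good w(1) unfolding good_def by blast
  moreover have "e \<le> D * e" using D e mult_right_mono[of 1 D e] by simp
  ultimately show ?thesis using lip[of t] lip[of t0] w(3,4) by (simp add: mult.assoc)
qed

text \<open>An upper bound for the semi-norm at \<open>t\<close> is known at net points, so
  \<open>y\<close> is replaced by such a \<open>w\<close>, then by the real part of \<open>w\<close>
  in the fibre at \<open>t\<close>, and scaled down.\<close>

lemma approx_from_limit:
  assumes y: "y \<in> unit_ball"
  obtains x where "selfadj t x" "l t x \<le> 1" "n t0 (x \<ominus> y) \<le> (D + D ^ 3 * R + D\<^sup>2) * e"
proof -
  obtain w where w: "w \<in> F" "w \<in> unit_ball" "n t (y \<ominus> w) \<le> D * e" by (rule net_approx[OF y])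
  have wV: "w \<in> V" "y \<in> V" using y w(2) unit_ballD by blast+
  define w' where "w' = conj_at t w"
  have w': "w' \<in> V" "E t w' = E t (star A w)" "l t w' = l t w"
    using conj_at[OF wV(1), of t] by (simp_all add: w'_def)
  note c = VA[OF wV(1)] VA[OF wV(2)] VA[OF w'(1)]
  \<comment> \<open>Compensates \<open>l t w < 1 + e\<close>, which may exceed the bound 1
    slightly.\<close>
  define r where "r = 1 / (1 + e)"
  have r: "0 < r" "r \<le> 1" "1 - r \<le> e" using e by (simp_all add: r_def field_simps)
  define x where "x = complex_of_real (r / 2) \<odot> (w \<oplus> w')"
  have xV: "x \<in> V" unfolding x_def by (intro VA_smult VA_add wV w')
  obtain G where G: "frame w w' y y G" by (rule frame_exists[OF c(1,3,2,2)])
  have nw': "n t w' = n t w" using n_star[OF c(1), of t] by (simp add: n_def w'(2))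
  have "selfadj t x"
  proof -
    have "E t (star A w') = E t w"
    proof -
      have "E t (star A w') = star (B t) (E t w')" using c by (simp add: ev_star)
      also have "\<dots> = E t (star A (star A w))" using c unfolding w'(2) by (subst ev_star) auto
      finally show ?thesis using c by simp
    qed
    then have "E t (star A x) = complex_of_real (r / 2) \<odot>\<^bsub>B t\<^esub> (E t (star A w) \<oplus>\<^bsub>B t\<^esub> E t w)"
      using c by (simp add: x_def star_smult star_add ev_smult ev_add)
    also have "\<dots> = complex_of_real (r / 2) \<odot>\<^bsub>B t\<^esub> (E t w' \<oplus>\<^bsub>B t\<^esub> E t w)" by (simp add: w'(2))
    also have "\<dots> = E t (complex_of_real (r / 2) \<odot> (w' \<oplus> w))" using c by (simp add: ev_smult ev_add)
    finally show ?thesis using xV c by (simp add: selfadj_def x_def M.a_comm)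
  qed
  moreover have "l t x \<le> 1"
  proof -
    have "l t x = (r / 2) * l t (w \<oplus> w')"
      unfolding x_def using l_smult[OF VA_add[OF wV(1) w'(1)], of t "complex_of_real (r / 2)"] r by simp
    also have "\<dots> \<le> (r / 2) * (l t w + l t w)"
      using l_add[OF wV(1) w'(1), of t] w'(3) r by (intro mult_left_mono) auto
    also have "\<dots> \<le> r * (1 + e)"
      using good w(1) r unfolding good_def by (simp add: less_imp_le)
    finally show ?thesis using e by (simp add: r_def)
  qed
  moreover have "n t0 (x \<ominus> y) \<le> (D + D ^ 3 * R + D\<^sup>2) * e"
  proof -
    have eq: "x \<ominus> y = ((1/2) \<odot> (w' \<ominus> w) \<ominus> complex_of_real ((1 - r) / 2) \<odot> (w \<oplus> w')) \<ominus> (y \<ominus> w)"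
      unfolding x_def by (simp add: frameD[OF G] field_simps)
    have "n t (x \<ominus> y) \<le> n t ((1/2) \<odot> (w' \<ominus> w)) + n t (complex_of_real ((1 - r) / 2) \<odot> (w \<oplus> w')) + n t (y \<ominus> w)"
      unfolding eq
      using n_diff[of "(1/2) \<odot> (w' \<ominus> w) \<ominus> complex_of_real ((1 - r) / 2) \<odot> (w \<oplus> w')" "y \<ominus> w" t]
        n_diff[of "(1/2) \<odot> (w' \<ominus> w)" "complex_of_real ((1 - r) / 2) \<odot> (w \<oplus> w')" t] c by simp
    also have "n t ((1/2) \<odot> (w' \<ominus> w)) \<le> e"
    proof -
      have "n t (w' \<ominus> w) = n t (star A w \<ominus> w)" using c by (simp add: n_def E_diff w'(2))
      then have "n t (w' \<ominus> w) < e" using good w(1) unfolding good_def by simp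
      then show ?thesis using n_smult[of "w' \<ominus> w" t "1/2"] c n_nonneg[of "w' \<ominus> w" t] e by simp
    qed
    also have "n t (complex_of_real ((1 - r) / 2) \<odot> (w \<oplus> w')) \<le> e * (D * (D * R))"
    proof -
      have "n t w \<le> D * n t0 w" by (rule n_bound[OF wV(1)])
      also have "\<dots> \<le> D * (D * R)" using w(2) D by (intro mult_left_mono) (auto simp: unit_ball_def)
      finally have nw: "n t w \<le> D * (D * R)" .
      have "n t (complex_of_real ((1 - r) / 2) \<odot> (w \<oplus> w')) = cmod (complex_of_real ((1 - r) / 2)) * n t (w \<oplus> w')"
        using c by (intro n_smult) auto
      also have "cmod (complex_of_real ((1 - r) / 2)) = (1 - r) / 2" using r unfolding norm_of_real by simp
      also have "(1 - r) / 2 * n t (w \<oplus> w') \<le> (1 - r) / 2 * (2 * n t w)"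
        using n_add[OF c(1,3), of t] nw' r by (intro mult_left_mono) auto
      also have "\<dots> \<le> e * n t w" using r n_nonneg[OF c(1), of t] by (simp add: mult_right_mono)
      also have "\<dots> \<le> e * (D * (D * R))" using nw e by simp
      finally show ?thesis .
    qed
    finally have "n t (x \<ominus> y) \<le> e + e * (D * (D * R)) + D * e" using w(3) by simp
    \<comment> \<open>The estimate was made in the fibre at \<open>t\<close>; the factor
      \<open>D\<close> carries it to \<open>t0\<close>.\<close>
    then have "D * n t (x \<ominus> y) \<le> D * (e + e * (D * (D * R)) + D * e)" using D by (intro mult_left_mono) auto
    also have "\<dots> = (D + D ^ 3 * R + D\<^sup>2) * e" by (simp add: power2_eq_square power3_eq_cube algebra_simps)
    finally show ?thesis using n_bound[OF VA_diff[OF xV wV(2)], of t0 t] by simp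
  qed
  ultimately show thesis by (rule that)
qed

text \<open>Condition (3) bounds the semi-norm of \<open>x\<close> at \<open>t0\<close> directly, so
  \<open>x\<close> is split into its real and imaginary parts there. The imaginary part is small:
  \<open>x\<close> is self-adjoint at \<open>t\<close>, and by \<open>star_close\<close> both parts
  nearly are.\<close>

lemma approx_to_limit:
  assumes x: "selfadj t x" "l t x \<le> 1" "n t x \<le> R"
  obtains y where "selfadj t0 y" "l t0 y \<le> 1" "n t0 (x \<ominus> y) \<le> (6 * D\<^sup>2 + D * R) * e"
proof -
  have xV: "x \<in> V" using x(1) by (simp add: selfadj_def)
  have lx: "(1 - e) * l t0 x \<le> 1" using good xV x(2) unfolding good_def by fastforce
  \<comment> \<open>As \<open>e \<le> 1 / 2\<close>, the factor \<open>1 - e\<close> is at least one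
    half.\<close>
  then have l2: "l t0 x \<le> 2"
    using e l_nonneg[OF xV, of t0] mult_right_mono[of "1/2" "1 - e" "l t0 x"] by simp
  have nx: "n t0 x \<le> D * R" 
    by (rule order_trans[OF n_bound[OF xV] mult_left_mono[OF x(3)]]) (use D in simp)
  define x' where "x' = conj_at t0 x"
  have x': "x' \<in> V" "E t0 x' = E t0 (star A x)" "l t0 x' = l t0 x"
    using conj_at[OF xV, of t0] by (simp_all add: x'_def)
  note c = VA[OF xV] VA[OF x'(1)]
  have nx': "n t0 x' = n t0 x" using n_star[OF c(1), of t0] by (simp add: n_def x'(2))
  have sx': "E t0 (star A x') = E t0 x"
  proof -
    have "E t0 (star A x') = star (B t0) (E t0 x')" using c by (simp add: ev_star)
    also have "\<dots> = E t0 (star A (star A x))" using c unfolding x'(2) by (subst ev_star) auto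
    finally show ?thesis using c by simp
  qed
  \<comment> \<open>Half the real and half the imaginary part of \<open>x\<close> at
    \<open>t0\<close>; since \<open>l t0 x\<close> may be as large as 2, halving puts them into
    \<open>unit_ball\<close>.\<close>
  define p where "p = (1/4) \<odot> (x \<oplus> x')"
  define q where "q = (- \<i> / 4) \<odot> (x \<ominus> x')"
  have pV: "p \<in> V" "q \<in> V" unfolding p_def q_def by (intro VA_smult VA_add VA_diff xV x')+
  note cp = VA[OF pV(1)] VA[OF pV(2)]
  interpret B0: unital_cstar_algebra "B t0" by (rule fibre_cstar)
  have sp: "selfadj t0 p"
  proof -
    have "E t0 (star A p) = (1/4) \<odot>\<^bsub>B t0\<^esub> (E t0 (star A x) \<oplus>\<^bsub>B t0\<^esub> E t0 (star A x'))"
      using c by (simp add: p_def star_smult star_add ev_smult ev_add)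
    also have "\<dots> = E t0 p" unfolding sx' x'(2)[symmetric] using c
      by (simp add: p_def ev_smult ev_add B0.M.a_comm)
    finally show ?thesis using pV by (simp add: selfadj_def)
  qed
  have sq: "selfadj t0 q"
  proof -
    have "E t0 (star A q) = (\<i> / 4) \<odot>\<^bsub>B t0\<^esub> (E t0 (star A x) \<ominus>\<^bsub>B t0\<^esub> E t0 (star A x'))"
      using c by (simp add: q_def star_smult star_diff ev_smult E_diff)
    also have "\<dots> = (\<i> / 4) \<odot>\<^bsub>B t0\<^esub> (E t0 x' \<ominus>\<^bsub>B t0\<^esub> E t0 x)" unfolding sx' x'(2) ..
    also have "\<dots> = (- \<i> / 4) \<odot>\<^bsub>B t0\<^esub> (E t0 x \<ominus>\<^bsub>B t0\<^esub> E t0 x')"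
    proof -
      have E: "E t0 x \<in> carrier (B t0)" "E t0 x' \<in> carrier (B t0)" using c by auto
      obtain G where G: "B0.frame (E t0 x) (E t0 x') (E t0 x) (E t0 x) G"
        by (rule B0.frame_exists[OF E E(1) E(1)])
      show ?thesis by (simp add: B0.frameD[OF G])
    qed
    also have "\<dots> = E t0 q" using c by (simp add: q_def ev_smult E_diff)
    finally show ?thesis using pV by (simp add: selfadj_def)
  qed
  have lp: "l t0 p \<le> 1"
    using l_smult[OF VA_add[OF xV x'(1)], of t0 "1/4"] l_add[OF xV x'(1), of t0] x'(3) l2
    by (simp add: p_def)
  have lq: "l t0 q \<le> 1"
  proof -
    have "x \<ominus> x' = x \<oplus> (-1) \<odot> x'" using c by (simp add: M.minus_eq a_inv_smult)
    then have "l t0 (x \<ominus> x') \<le> l t0 x + l t0 x'"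
      using l_add[OF xV VA_smult[OF x'(1)], of t0 "-1"] l_smult[OF x'(1), of t0 "-1"] by simp
    then show ?thesis
      using l_smult[OF VA_diff[OF xV x'(1)], of t0 "- \<i> / 4"] x'(3) l2 by (simp add: q_def norm_divide)
  qed
  have DR: "0 \<le> D * R" using D R by simp
  have np: "n t0 p \<le> D * R"
    using n_smult[of "x \<oplus> x'" t0 "1/4"] n_add[OF c, of t0] nx nx' c DR by (simp add: p_def)
  have nq: "n t0 q \<le> D * R"
    using n_smult[of "x \<ominus> x'" t0 "- \<i> / 4"] n_diff[OF c, of t0] nx nx' c DR by (simp add: q_def norm_divide)
  have pb: "p \<in> unit_ball" and qb: "q \<in> unit_ball"
    using sp sq lp lq np nq by (simp_all add: unit_ball_def)
  obtain G where G: "frame x x' x x G" by (rule frame_exists[OF c c(1) c(1)])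
  have xpq: "x = 2 \<odot> (p \<oplus> \<i> \<odot> q)" unfolding p_def q_def by (simp add: frameD[OF G])
  have nq': "n t q \<le> 3 * D * e"
  proof -
    define p' q' where "p' = star A p" and "q' = star A q"
    have c': "p' \<in> carrier A" "q' \<in> carrier A" using cp by (simp_all add: p'_def q'_def)
    obtain H where H: "frame p q p' q' H" by (rule frame_exists[OF cp c'])
    interpret Bt: unital_cstar_algebra "B t" by (rule fibre_cstar)
    have sx: "star A x = 2 \<odot> (p' \<ominus> \<i> \<odot> q')"
    proof -
      have "star A x = 2 \<odot> (p' \<oplus> (- \<i>) \<odot> q')"
        unfolding xpq using cp by (simp add: star_smult star_add p'_def q'_def)
      then show ?thesis by (simp add: frameD[OF H])
    qed
    have "E t (star A x \<ominus> x) = \<zero>\<^bsub>B t\<^esub>"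
      using x(1) c by (simp add: selfadj_def E_diff Bt.M.minus_eq Bt.M.r_neg)
    then have z: "n t (star A x \<ominus> x) = 0" by (simp add: n_def)
    \<comment> \<open>Solves the formula for \<open>star A x \<ominus> x\<close> for
      \<open>q\<close>; the first term vanishes at \<open>t\<close>, and \<open>star_close\<close>
      bounds the others.\<close>
    have "q = (\<i> / 4) \<odot> (star A x \<ominus> x) \<ominus> (\<i> / 2) \<odot> (p' \<ominus> p) \<ominus> (1 / 2) \<odot> (q' \<ominus> q)"
      unfolding sx unfolding xpq by (simp add: frameD[OF H])
    then have "n t q \<le> n t ((\<i> / 4) \<odot> (star A x \<ominus> x)) + n t ((\<i> / 2) \<odot> (p' \<ominus> p)) + n t ((1 / 2) \<odot> (q' \<ominus> q))"
      using n_diff[of "(\<i> / 4) \<odot> (star A x \<ominus> x) \<ominus> (\<i> / 2) \<odot> (p' \<ominus> p)" "(1 / 2) \<odot> (q' \<ominus> q)" t]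
        n_diff[of "(\<i> / 4) \<odot> (star A x \<ominus> x)" "(\<i> / 2) \<odot> (p' \<ominus> p)" t] c cp c' by simp
    also have "\<dots> = 1 / 2 * n t (p' \<ominus> p) + 1 / 2 * n t (q' \<ominus> q)"
      using n_smult[of "star A x \<ominus> x" t "\<i> / 4"] n_smult[of "p' \<ominus> p" t "\<i> / 2"]
        n_smult[of "q' \<ominus> q" t "1 / 2"] c cp c' z by (simp add: norm_divide)
    also have "\<dots> \<le> 3 * D * e"
      using star_close[OF pb] star_close[OF qb] by (simp add: p'_def q'_def)
    finally show ?thesis .
  qed
  \<comment> \<open>The real part \<open>2 \<odot> p\<close>, shrunk by \<open>1 - e\<close> because
    condition (3) gives the bound 1 for \<open>(1 - e) * l t0 x\<close>.\<close>
  define y where "y = complex_of_real (2 * (1 - e)) \<odot> p"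
  have y: "selfadj t0 y"
  proof -
    have "E t0 (star A y) = complex_of_real (2 * (1 - e)) \<odot>\<^bsub>B t0\<^esub> E t0 (star A p)"
      using cp by (simp add: y_def star_smult ev_smult)
    also have "\<dots> = E t0 y" using sp cp by (simp add: selfadj_def y_def ev_smult)
    finally show ?thesis using VA_smult[OF pV(1)] by (simp add: selfadj_def y_def)
  qed
  have ly: "l t0 y \<le> 1"
  proof -
    have lp2: "l t0 p \<le> l t0 x / 2"
      using l_smult[OF VA_add[OF xV x'(1)], of t0 "1/4"] l_add[OF xV x'(1), of t0] x'(3)
      by (simp add: p_def)
    have "l t0 y = cmod (complex_of_real (2 * (1 - e))) * l t0 p"
      unfolding y_def by (rule l_smult[OF pV(1)])
    also have "cmod (complex_of_real (2 * (1 - e))) = 2 * (1 - e)" using e unfolding norm_of_real by simp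
    also have "2 * (1 - e) * l t0 p \<le> 2 * (1 - e) * (l t0 x / 2)"
      using lp2 e by (intro mult_left_mono) auto
    also have "\<dots> = (1 - e) * l t0 x" by simp
    also note lx
    finally show ?thesis .
  qed
  have "n t0 (x \<ominus> y) \<le> (6 * D\<^sup>2 + D * R) * e"
  proof -
    obtain H where H: "frame p q p p H" by (rule frame_exists[OF cp cp(1) cp(1)])
    \<comment> \<open>The first term contributes \<open>6 * D\<^sup>2 * e\<close>, the shrinking
      \<open>D * R * e\<close>.\<close>
    have "x \<ominus> y = (2 * \<i>) \<odot> q \<oplus> complex_of_real (2 * e) \<odot> p"
      unfolding xpq y_def by (simp add: frameD[OF H] algebra_simps)
    then have "n t0 (x \<ominus> y) \<le> 2 * n t0 q + 2 * e * n t0 p"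
      using n_add[of "(2 * \<i>) \<odot> q" "complex_of_real (2 * e) \<odot> p" t0] cp e
        n_smult[of q t0 "2 * \<i>"] n_smult[of p t0 "complex_of_real (2 * e)"]
      by (simp add: norm_mult)
    also have "n t0 q \<le> D * (3 * D * e)"
      by (rule order_trans[OF n_bound[OF pV(2)] mult_left_mono[OF nq']]) (use D in simp)
    also have "n t0 p \<le> D * R / 2"
      using n_smult[of "x \<oplus> x'" t0 "1/4"] n_add[OF c, of t0] nx nx' c by (simp add: p_def)
    finally have "n t0 (x \<ominus> y) \<le> 2 * (D * (3 * D * e)) + 2 * e * (D * R / 2)" using e by simp
    then show ?thesis by (simp add: power2_eq_square algebra_simps)
  qed
  then show thesis using that y ly by blast
qed

lemma gap_bounds:
  "3 * D * e \<le> gap * e" "(D + D ^ 3 * R + D\<^sup>2) * e \<le> gap * e" "(6 * D\<^sup>2 + D * R) * e \<le> gap * e" "0 < gap * e"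
proof -
  have "0 \<le> D ^ 3 * R" "0 \<le> D\<^sup>2" "0 \<le> D * R" "0 < D" using D R by simp_all
  then have g: "3 * D \<le> gap" "D + D ^ 3 * R + D\<^sup>2 \<le> gap" "6 * D\<^sup>2 + D * R \<le> gap" "0 < gap"
    unfolding gap_def by linarith+
  then show "3 * D * e \<le> gap * e" "(D + D ^ 3 * R + D\<^sup>2) * e \<le> gap * e"
    "(6 * D\<^sup>2 + D * R) * e \<le> gap * e" "0 < gap * e"
    using e(1) by (auto intro!: mult_right_mono)
qed

text \<open>Subtracting a scalar brings \<open>z\<close> into the range of
  \<open>approx_to_limit\<close>, and adding it back keeps self-adjointness and the bound on the
  semi-norm. \<open>from_limit\<close> proceeds likewise.\<close>

lemma to_limit:
  assumes z: "selfadj t z" "l t z \<le> 1"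
  shows "\<exists>y. selfadj t0 y \<and> l t0 y \<le> 1 \<and> n t0 (z \<ominus> y) \<le> gap * e"
proof -
  obtain c where c: "n t (z \<ominus> scal c) \<le> R" by (rule bounded_shift[OF z])
  obtain y where y: "selfadj t0 y" "l t0 y \<le> 1" "n t0 (z \<ominus> scal c \<ominus> y) \<le> (6 * D\<^sup>2 + D * R) * e"
    by (rule approx_to_limit[of "z \<ominus> scal c"])
      (use selfadj_shift[OF z(1), of c] z(2) c in auto)
  have zy: "z \<in> carrier A" "y \<in> carrier A" using z y VA by (auto simp: selfadj_def)
  obtain G where G: "frame z y \<one> y G" by (rule frame_exists[OF zy one_closed zy(2)])
  have "z \<ominus> scal c \<ominus> y = z \<ominus> (y \<oplus> scal c)" by (simp add: frameD[OF G])
  then show ?thesis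
    using y selfadj_shift[OF y(1), of c] gap_bounds(3) by (intro exI[of _ "y \<oplus> scal c"]) auto
qed

lemma from_limit:
  assumes z: "selfadj t0 z" "l t0 z \<le> 1"
  shows "\<exists>x. selfadj t x \<and> l t x \<le> 1 \<and> n t0 (x \<ominus> z) \<le> gap * e"
proof -
  obtain c where c: "n t0 (z \<ominus> scal c) \<le> R" by (rule bounded_shift[OF z])
  have "R \<le> D * R" using D R by simp
  then have "z \<ominus> scal c \<in> unit_ball"
    using selfadj_shift[OF z(1), of c] z(2) c by (simp add: unit_ball_def)
  then obtain x where x: "selfadj t x" "l t x \<le> 1"
    "n t0 (x \<ominus> (z \<ominus> scal c)) \<le> (D + D ^ 3 * R + D\<^sup>2) * e"
    by (rule approx_from_limit)
  have zx: "z \<in> carrier A" "x \<in> carrier A" using z x VA by (auto simp: selfadj_def)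
  obtain G where G: "frame z x \<one> x G" by (rule frame_exists[OF zx one_closed zx(2)])
  have "x \<ominus> (z \<ominus> scal c) = (x \<oplus> scal c) \<ominus> z" by (simp add: frameD[OF G])
  then show ?thesis
    using x selfadj_shift[OF x(1), of c] gap_bounds(2) by (intro exI[of _ "x \<oplus> scal c"]) auto
qed

lemma v_selfadj:
  assumes "X \<in> sa (B s) (E s ` V)" "L s X \<le> 1"
  shows "selfadj s (v s X)" "l s (v s X) \<le> 1" "E s (v s X) = X" "v s X \<in> V"
proof -
  have "X \<in> E s ` V" using assms(1) by (simp add: sa_def)
  then show "E s (v s X) = X" "v s X \<in> V" using E_v v_in by blast+
  then show "selfadj s (v s X)" "l s (v s X) \<le> 1" using assms by (simp_all add: selfadj_iff l_def)
qed

lemma fibre_dist_q_le: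
  "dist_q (B t) (E t ` V) (L t) (B t0) (E t0 ` V) (L t0) \<le> ennreal ((D + 2) * (gap * e))"
proof -
  let ?k = "\<lambda>X. E t0 (v t X)" and ?k' = "\<lambda>Y. E t (v t0 Y)"
  interpret Bt: unital_subspace "B t" "E t ` V" by (rule subspaces)
  interpret B0: unital_subspace "B t0" "E t0 ` V" by (rule subspaces)
  have ball: "v t0 Y \<in> unit_ball" if "Y \<in> B0.S" "L t0 Y \<le> 1" "nrm (B t0) Y \<le> R" for Y
  proof -
    have "R \<le> D * R" using D R by simp
    then show ?thesis using v_selfadj[OF that(1,2)] that(3) by (simp add: unit_ball_def n_def)
  qed
  have "bridge (B t) (E t ` V) (B t0) (E t0 ` V) ?k ?k' (L t) (L t0) D R (gap * e)"
  proof (intro bridge.intro subspaces bridge_axioms.intro)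
    show "?k X \<in> E t0 ` V" if "X \<in> E t ` V" for X using v_in[OF that] by simp
    show "?k' Y \<in> E t ` V" if "Y \<in> E t0 ` V" for Y using v_in[OF that] by simp
    show "?k (?k' Y) = Y" if "Y \<in> E t0 ` V" for Y using v_in[OF that] E_v[OF that] by (simp add: v_E)
    show "?k' (?k X) = X" if "X \<in> E t ` V" for X using v_in[OF that] E_v[OF that] by (simp add: v_E)
    show "?k (X \<oplus>\<^bsub>B t\<^esub> Z) = ?k X \<oplus>\<^bsub>B t0\<^esub> ?k Z" if XZ: "X \<in> E t ` V" "Z \<in> E t ` V" for X Z
    proof -
      obtain x z where xz: "x \<in> V" "z \<in> V" "X = E t x" "Z = E t z" using XZ by blast
      then have eq: "X \<oplus>\<^bsub>B t\<^esub> Z = E t (x \<oplus> z)" using VA by (simp add: ev_add)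
      show ?thesis
        unfolding eq v_E[OF VA_add[OF xz(1,2)]] using xz VA by (simp add: v_E ev_add)
    qed
    show "?k (c \<odot>\<^bsub>B t\<^esub> X) = c \<odot>\<^bsub>B t0\<^esub> ?k X" if X: "X \<in> E t ` V" for c X
    proof -
      obtain x where x: "x \<in> V" "X = E t x" using X by blast
      then have eq: "c \<odot>\<^bsub>B t\<^esub> X = E t (c \<odot> x)" using VA by (simp add: ev_smult)
      show ?thesis unfolding eq v_E[OF VA_smult[OF x(1)]] using x VA by (simp add: v_E ev_smult)
    qed
    show "?k \<one>\<^bsub>B t\<^esub> = \<one>\<^bsub>B t0\<^esub>"
      using v_E[OF V_one, of t] ev_one[of \<one> t] ev_one[of \<one> t0] by simp
    show "nrm (B t0) (?k X) \<le> D * nrm (B t) X" if "X \<in> E t ` V" for X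
      using nrm_bound[OF v_in[OF that], of t0 t] E_v[OF that] by simp
    show "nrm (B t) (?k' Y) \<le> D * nrm (B t0) Y" if "Y \<in> E t0 ` V" for Y
      using nrm_bound[OF v_in[OF that], of t t0] E_v[OF that] by simp
    show "\<exists>Y\<in>B0.S. L t0 Y \<le> 1 \<and> nrm (B t0) (?k X \<ominus>\<^bsub>B t0\<^esub> Y) \<le> gap * e"
      if X: "X \<in> Bt.S" "L t X \<le> 1" for X
    proof -
      obtain y where y: "selfadj t0 y" "l t0 y \<le> 1" "n t0 (v t X \<ominus> y) \<le> gap * e"
        using to_limit[OF v_selfadj(1,2)[OF X]] by blast
      have "y \<in> carrier A" using y VA by (simp add: selfadj_def)
      then show ?thesis
        using y VA[OF v_selfadj(4)[OF X]]
        by (intro bexI[of _ "E t0 y"]) (auto simp: selfadj_iff l_def n_def E_diff)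
    qed
    show "\<exists>X\<in>Bt.S. L t X \<le> 1 \<and> nrm (B t0) (?k X \<ominus>\<^bsub>B t0\<^esub> Y) \<le> gap * e"
      if Y: "Y \<in> B0.S" "L t0 Y \<le> 1" for Y
    proof -
      obtain x where x: "selfadj t x" "l t x \<le> 1" "n t0 (x \<ominus> v t0 Y) \<le> gap * e"
        using from_limit[OF v_selfadj(1,2)[OF Y]] by blast
      have "x \<in> V" "x \<in> carrier A" using x VA by (simp_all add: selfadj_def)
      then show ?thesis
        using x VA[OF v_selfadj(4)[OF Y]] v_selfadj(3)[OF Y]
        by (intro bexI[of _ "E t x"]) (auto simp: selfadj_iff l_def n_def E_diff v_E)
    qed
    show "\<bar>nrm (B t) (?k' Y \<oplus>\<^bsub>B t\<^esub> Bt.scal (D * R)) - nrm (B t0) (Y \<oplus>\<^bsub>B t0\<^esub> B0.scal (D * R))\<bar> \<le> gap * e"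
      if Y: "Y \<in> B0.S" "L t0 Y \<le> 1" "nrm (B t0) Y \<le> R" for Y
    proof -
      have yc: "v t0 Y \<in> carrier A" using VA[OF v_selfadj(4)[OF Y(1,2)]] .
      have "E s (v t0 Y \<oplus> scal (D * R)) = E s (v t0 Y) \<oplus>\<^bsub>B s\<^esub> complex_of_real (D * R) \<odot>\<^bsub>B s\<^esub> \<one>\<^bsub>B s\<^esub>" for s
        using yc ev_add[OF yc scal_in, of s "D * R"] E_scal[of s "D * R"] by simp
      then show ?thesis
        using nrm_close[OF ball[OF Y]] gap_bounds(1) v_selfadj(3)[OF Y(1,2)] unfolding n_def by simp
    qed
    show "nrm (B t) (star (B t) (?k' Y) \<ominus>\<^bsub>B t\<^esub> ?k' Y) \<le> gap * e"
      if Y: "Y \<in> B0.S" "L t0 Y \<le> 1" "nrm (B t0) Y \<le> R" for Y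
    proof -
      have yc: "v t0 Y \<in> carrier A" using VA[OF v_selfadj(4)[OF Y(1,2)]] .
      then have "star (B t) (?k' Y) \<ominus>\<^bsub>B t\<^esub> ?k' Y = E t (star A (v t0 Y) \<ominus> v t0 Y)"
        by (simp add: E_diff ev_star)
      then show ?thesis using star_close[OF ball[OF Y]] gap_bounds(1) by (simp add: n_def)
    qed
  qed (use D R gap_bounds(4) cqms radius_bound in auto)
  then show ?thesis by (rule bridge.dist_q_le)
qed

end

theorem dist_q_tendsto_zero:
  "((\<lambda>t. dist_q (B t) (E t ` V) (L t) (B t0) (E t0 ` V) (L t0)) \<longlongrightarrow> 0) (at t0)"
proof (rule order_tendstoI)
  fix a :: ennreal assume "0 < a"
  \<comment> \<open>A finite \<open>r\<close> below \<open>a\<close> is chosen, as \<open>a\<close>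
    may be infinite.\<close>
  then obtain r where r: "0 < ennreal r" "ennreal r < a" "0 \<le> r"
    by (metis dense ennreal_cases less_top_ennreal order_less_trans top.not_eq_extremum)
  then have r0: "0 < r" by simp
  define K where "K = (D + 2) * gap"
  have K: "K > 0" using D R by (simp add: K_def gap_def add_pos_nonneg)
  \<comment> \<open>\<open>1 / 2\<close> is the bound demanded by the comparison of fibres, and
    \<open>r / K\<close> makes the final estimate at most \<open>r\<close>.\<close>
  define e where "e = min (1 / 2) (r / K)"
  have e: "0 < e" using r0 K by (simp add: e_def)
  have e_le: "e \<le> 1 / 2" unfolding e_def by (rule min.cobounded1)
  have Ke: "K * e \<le> r" using K by (simp add: e_def min_def field_simps)
  obtain F where F: "finite F" "F \<subseteq> unit_ball" "\<forall>y\<in>unit_ball. \<exists>w\<in>F. n t0 (y \<ominus> w) \<le> e"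
    by (rule unit_ball_net[OF e])
  show "\<forall>\<^sub>F t in at t0. dist_q (B t) (E t ` V) (L t) (B t0) (E t0 ` V) (L t0) < a"
    using eventually_good[OF e F(1,2)]
  proof (rule eventually_mono)
    fix t assume "good e F t"
    note fibre_dist_q_le[OF e e_le F(2,3) this]
    also have "ennreal ((D + 2) * (gap * e)) \<le> ennreal r"
      using Ke by (intro ennreal_leI) (simp add: K_def mult.assoc)
    also note r(2)
    finally show "dist_q (B t) (E t ` V) (L t) (B t0) (E t0 ` V) (L t0) < a" .
  qed
qed simp

end

theorem theorem6p3:
  fixes A :: "'a cstar"
    and j :: "('t::t2_space \<Rightarrow> complex) \<Rightarrow> 'a"
    and V :: "'a set"
    and L :: "'t \<Rightarrow> 'a set \<Rightarrow> real"
    and t0 :: 't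
  assumes "compact (UNIV :: 't set)"
    and "unital_cstar_algebra A"
    and "j \<in> unital_star_hom continuous_functions A"
    and "inj_on j (carrier continuous_functions)"
    and "j ` carrier continuous_functions \<subseteq> centre A"
    and "continuous_field A j"
    and "submodule V complex_field A"
    and "\<one>\<^bsub>A\<^esub> \<in> V"
    and "\<And>t. inj_on (ev A j t) V"
    and "\<And>t \<xi>. \<xi> \<in> ev A j t ` V \<Longrightarrow> star (fibre A j t) \<xi> \<in> ev A j t ` V"
    and "\<And>t. seminorm_on UNIV (fibre A j t) (ev A j t ` V) (L t)"
    and "\<And>t. L t \<one>\<^bsub>fibre A j t\<^esub> = 0"
    and "\<And>t \<xi>. \<xi> \<in> ev A j t ` V \<Longrightarrow> L t (star (fibre A j t) \<xi>) = L t \<xi>"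
    and "uniform_family A j V L"
    and "(SUP t. radius (fibre A j t) (ev A j t ` V) (L t)) < \<infinity>"
    and "separable_space (norm_topology (fibre A j t0))"
  shows "((\<lambda>t. dist_q (fibre A j t) (ev A j t ` V) (L t)
             (fibre A j t0) (ev A j t0 ` V) (L t0)) \<longlongrightarrow> 0) (at t0)"
proof -
  interpret cstar_field A j
    using assms(2,3,5) by (intro cstar_field.intro cstar_field_axioms.intro)
  obtain N C where NC: "C > 0" "seminorm_on UNIV A V N"
    and N_bounds: "\<And>\<xi> t. \<xi> \<in> V \<Longrightarrow> 1 / C * N \<xi> \<le> nrm (fibre A j t) (ev A j t \<xi>)"
      "\<And>\<xi> t. \<xi> \<in> V \<Longrightarrow> nrm (fibre A j t) (ev A j t \<xi>) \<le> C * N \<xi>"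
    using assms(14) unfolding uniform_family_def by blast
  have cqms: "order_unit_cqms (fibre A j t) (ev A j t ` V) (L t)" for t
    using assms(14) unfolding uniform_family_def by blast
  have VA: "x \<in> carrier A" if "x \<in> V" for x
    using submoduleE(1)[OF assms(7)] that by blast
  \<comment> \<open>The constant functions 1 and 0 differ, so injectivity of \<open>j\<close> keeps
    their images apart.\<close>
  have ne: "\<one>\<^bsub>A\<^esub> \<noteq> \<zero>\<^bsub>A\<^esub>"
  proof
    assume "\<one>\<^bsub>A\<^esub> = \<zero>\<^bsub>A\<^esub>"
    then have "j (\<lambda>x. 1) = j (\<lambda>x. 0)"
      using j_smult[of "\<lambda>x. 1" 0] by (simp add: j_one)
    then have "(\<lambda>x :: 't. 1 :: complex) = (\<lambda>x. 0)"
      by (rule inj_onD[OF assms(4)]) (simp_all add: continuous_functions_def)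
    from fun_cong[OF this] show False by simp
  qed
  have zero: "\<zero>\<^bsub>A\<^esub> \<in> V"
    using submoduleE(4)[OF assms(7), of 0 "\<one>\<^bsub>A\<^esub>"] assms(8) by (simp add: complex_field_def)
  have subspaces: "unital_subspace (fibre A j t) (ev A j t ` V)" for t
  proof (intro unital_subspace.intro fibre_cstar unital_subspace_axioms.intro)
    have "ev A j t \<one>\<^bsub>A\<^esub> \<noteq> ev A j t \<zero>\<^bsub>A\<^esub>"
      using inj_onD[OF assms(9), of t] ne zero assms(8) by blast
    then show "\<one>\<^bsub>fibre A j t\<^esub> \<noteq> \<zero>\<^bsub>fibre A j t\<^esub>"
      using ev_one[of "\<one>\<^bsub>A\<^esub>" t] ev_zero[of "\<one>\<^bsub>A\<^esub>" t] by simp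
    show "unital_selfadjoint_subspace (fibre A j t) (ev A j t ` V)"
      using cqms[of t] by (simp add: order_unit_cqms_def)
  qed
  \<comment> \<open>Passing from one fibre norm to \<open>N\<close> and on to another costs a factor
    \<open>C\<close> twice; the maximum with 1 secures \<open>1 \<le> D\<close>.\<close>
  define D where "D = max 1 (C * C)"
  have nrm_bound: "nrm (fibre A j t) (ev A j t y) \<le> D * nrm (fibre A j s) (ev A j s y)"
    if y: "y \<in> V" for s t y
  proof -
    interpret Bs: unital_cstar_algebra "fibre A j s" by (rule fibre_cstar)
    have n: "0 \<le> nrm (fibre A j s) (ev A j s y)" using ev_in[OF VA[OF y]] by (rule Bs.nrm_nonneg)
    have "N y \<le> C * nrm (fibre A j s) (ev A j s y)"
      using N_bounds(1)[OF y, of s] NC(1) by (simp add: field_simps)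
    then have "C * N y \<le> C * (C * nrm (fibre A j s) (ev A j s y))"
      using NC(1) by (intro mult_left_mono) auto
    also have "\<dots> \<le> D * nrm (fibre A j s) (ev A j s y)"
      using n by (simp add: D_def mult.assoc[symmetric] mult_right_mono)
    finally show ?thesis using N_bounds(2)[OF y, of t] by simp
  qed
  obtain r where r: "0 \<le> r" "(SUP t. radius (fibre A j t) (ev A j t ` V) (L t)) = ennreal r"
    using assms(15) by (cases "SUP t. radius (fibre A j t) (ev A j t ` V) (L t)") auto
  \<comment> \<open>\<open>R / 2\<close> dominates every radius, and the added 1 keeps
    \<open>R\<close> positive when all radii vanish.\<close>
  define R where "R = 2 * r + 1"
  have radius: "radius (fibre A j t) (ev A j t ` V) (L t) \<le> ennreal (R / 2)" for t
  proof -
    have "radius (fibre A j t) (ev A j t ` V) (L t) \<le> ennreal r"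
      unfolding r(2)[symmetric] by (rule SUP_upper) simp
    also have "\<dots> \<le> ennreal (R / 2)" by (intro ennreal_leI) (simp add: R_def)
    finally show ?thesis .
  qed
  have "uniform_field A j V L t0 D R"
  proof (intro uniform_field.intro uniform_field_axioms.intro cstar_field_axioms)
    show "continuous_on UNIV (\<lambda>t. L t (ev A j t y))" if "y \<in> V" for y
      using assms(14) that unfolding uniform_family_def by blast
    show "\<exists>U. open U \<and> t0 \<in> U \<and> (\<forall>y\<in>V. \<forall>t\<in>U. (1 - e) * L t0 (ev A j t0 y) \<le> L t (ev A j t y))"
      if "e > 0" for e
      using assms(14) that unfolding uniform_family_def by blast
    show "1 \<le> D" "0 < R" using r(1) by (simp_all add: D_def R_def)
  qed (fact assms subspaces cqms nrm_bound radius)+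
  then show ?thesis by (rule uniform_field.dist_q_tendsto_zero)
qed

end
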